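(* Let $1<p<\infty$ and let $X$ and $Y$ be separable infinite dimensional $\mathcal L_p$-spaces. Then every compact $T\in L(X)$ factors through $Y$ as $T=T^{(2)}T^{(1)}$, with $T^{(1)}\in L(X,Y)$ and $T^{(2)}\in L(Y,X)$, such that $T^{(1)}(X)$ is dense in $Y$ and both $T^{(1)}$ and $T^{(2)}$ are compact.
   Context: Banach spaces $X,Y$ are over the same field, $\mathbb R$ or $\mathbb C$; $L(X,Y)$ denotes the bounded linear operators and $L(X)=L(X,X)$. A Banach space $X$ is an $\mathcal L_p$-space if there is $\lambda\ge1$ such that every finite dimensional subspace $M\subset X$ is contained in a finite dimensional subspace $N\subset X$ with $d(N,\ell_p^{\dim N})\le\lambda$, where $d$ is the Banach--Mazur distance. *)

theory Defs
  imports "HOL-Analysis.Analysis" "HOL-Library.Function_Algebras"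
begin

text \<open>
  The scalar field is \<open>\<real>\<close> or \<open>\<complex>\<close>. Both are covered by one type class: a field in this class
  consists of \<open>\<real>\<close> alone, or of all \<open>a + b i\<close> with \<open>a, b\<close> real for some \<open>i\<close> with \<open>i\<^sup>2 = -1\<close>.
  As the norm of a \<open>real_normed_field\<close> is multiplicative and extends the absolute value of
  \<open>\<real>\<close>, it is then the usual modulus, so up to isometric isomorphism the class contains exactly
  \<open>\<real>\<close> and \<open>\<complex>\<close>.
\<close>

class real_or_complex = real_normed_field +
  assumes real_or_complex:
    "(\<forall>z. \<exists>a. z = a *\<^sub>R 1) \<or> (\<exists>i. i * i = - 1 \<and> (\<forall>z. \<exists>a b. z = a *\<^sub>R 1 + b *\<^sub>R i))"

instance real :: real_or_complex
  by standard simp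

instance complex :: real_or_complex
proof
  have "\<forall>z. \<exists>a b. z = a *\<^sub>R 1 + b *\<^sub>R \<i>"
    by (metis complex_eq mult.commute mult.right_neutral scaleR_conv_of_real)
  then show "(\<forall>z. \<exists>a. z = a *\<^sub>R (1::complex)) \<or>
      (\<exists>i::complex. i * i = - 1 \<and> (\<forall>z. \<exists>a b. z = a *\<^sub>R 1 + b *\<^sub>R i))"
    using i_squared by blast
qed

text \<open>
  A Banach space over the scalar field \<open>'k\<close>: the class \<open>banach\<close> supplies addition, norm,
  completeness and the underlying real scalar multiplication, which \<open>scale\<close> extends.
\<close>

locale banach_space = vector_space scale
  for scale :: "'k::real_or_complex \<Rightarrow> 'x::banach \<Rightarrow> 'x" +
  assumes scale_of_real: "scale (of_real r) x = r *\<^sub>R x"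
    and norm_scale: "norm (scale c x) = norm c * norm x"

lemma banach_space_scaleR: "banach_space (scaleR :: real \<Rightarrow> 'x::banach \<Rightarrow> 'x)"
  by unfold_locales (simp_all add: algebra_simps)

lemma banach_space_mult: "banach_space ((*) :: complex \<Rightarrow> complex \<Rightarrow> complex)"
  by unfold_locales (simp_all add: algebra_simps norm_mult scaleR_conv_of_real)

definition linear_iso_between ::
  "('k \<Rightarrow> 'a::ab_group_add \<Rightarrow> 'a) \<Rightarrow> 'a set \<Rightarrow> ('k \<Rightarrow> 'b::ab_group_add \<Rightarrow> 'b) \<Rightarrow> 'b set
    \<Rightarrow> ('a \<Rightarrow> 'b) \<Rightarrow> bool"
  where "linear_iso_between sE E sF F f \<longleftrightarrow>
    bij_betw f E F \<and>
    (\<forall>u\<in>E. \<forall>v\<in>E. f (u + v) = f u + f v) \<and>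
    (\<forall>c. \<forall>u\<in>E. f (sE c u) = sF c (f u))"

definition op_norm_on :: "'a set \<Rightarrow> ('a \<Rightarrow> real) \<Rightarrow> ('b \<Rightarrow> real) \<Rightarrow> ('a \<Rightarrow> 'b) \<Rightarrow> ennreal"
  where "op_norm_on E nE nF f = (SUP u\<in>{u\<in>E. nE u \<le> 1}. ennreal (nF (f u)))"

text \<open>
  Spaces are given by a carrier, a scalar multiplication and a norm on the carrier. Values are
  taken in \<open>ennreal\<close>, so that the distance between non-isomorphic spaces is \<open>\<infinity>\<close>.
\<close>

definition banach_mazur_distance ::
  "('k \<Rightarrow> 'a::ab_group_add \<Rightarrow> 'a) \<Rightarrow> ('a \<Rightarrow> real) \<Rightarrow> 'a set
    \<Rightarrow> ('k \<Rightarrow> 'b::ab_group_add \<Rightarrow> 'b) \<Rightarrow> ('b \<Rightarrow> real) \<Rightarrow> 'b set \<Rightarrow> ennreal"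
  where "banach_mazur_distance sE nE E sF nF F =
    (INF f\<in>{f. linear_iso_between sE E sF F f}.
      op_norm_on E nE nF f * op_norm_on F nF nE (inv_into E f))"

text \<open>
  The space \<open>\<ell>\<^sub>p\<^sup>n\<close> over \<open>'k\<close>: its elements are the sequences vanishing from index \<open>n\<close> on, with
  pointwise addition (from \<open>Function_Algebras\<close>) and scalar multiplication.
\<close>

definition lp_carrier :: "nat \<Rightarrow> (nat \<Rightarrow> 'k::zero) set"
  where "lp_carrier n = {v. \<forall>i\<ge>n. v i = 0}"

definition lp_scale :: "'k::times \<Rightarrow> (nat \<Rightarrow> 'k) \<Rightarrow> nat \<Rightarrow> 'k"
  where "lp_scale c v = (\<lambda>i. c * v i)"

definition lp_norm :: "real \<Rightarrow> nat \<Rightarrow> (nat \<Rightarrow> 'k::real_normed_field) \<Rightarrow> real"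
  where "lp_norm p n v = (\<Sum>i<n. norm (v i) powr p) powr (1 / p)"

context banach_space
begin

definition finite_dim_subspace :: "'x set \<Rightarrow> bool"
  where "finite_dim_subspace M \<longleftrightarrow> (\<exists>B. finite B \<and> M = span B)"

definition infinite_dimensional :: bool
  where "infinite_dimensional \<longleftrightarrow> \<not> finite_dim_subspace UNIV"

definition script_Lp_space :: "real \<Rightarrow> bool"
  where "script_Lp_space p \<longleftrightarrow>
    (\<exists>C::real. 1 \<le> C \<and>
      (\<forall>M. finite_dim_subspace M \<longrightarrow>
        (\<exists>N. finite_dim_subspace N \<and> M \<subseteq> N \<and>
          banach_mazur_distance scale norm N
            (lp_scale :: 'k \<Rightarrow> _) (lp_norm p (dim N)) (lp_carrier (dim N)) \<le> ennreal C)))"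

end

definition bounded_operator ::
  "('k::real_or_complex \<Rightarrow> 'x::banach \<Rightarrow> 'x) \<Rightarrow> ('k \<Rightarrow> 'y::banach \<Rightarrow> 'y) \<Rightarrow> ('x \<Rightarrow> 'y) \<Rightarrow> bool"
  where "bounded_operator sX sY T \<longleftrightarrow>
    Vector_Spaces.linear sX sY T \<and> (\<exists>C. \<forall>x. norm (T x) \<le> C * norm x)"

definition compact_operator ::
  "('k::real_or_complex \<Rightarrow> 'x::banach \<Rightarrow> 'x) \<Rightarrow> ('k \<Rightarrow> 'y::banach \<Rightarrow> 'y) \<Rightarrow> ('x \<Rightarrow> 'y) \<Rightarrow> bool"
  where "compact_operator sX sY T \<longleftrightarrow>
    bounded_operator sX sY T \<and> compact (closure (T ` cball 0 1))"

end

theory Submission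
  imports Defs
begin

text \<open>
  A compact operator on an \<open>\<L>\<^sub>p\<close>-space is a sum \<open>T = (\<Sum>n. b\<^sub>n a\<^sub>n)\<close> with \<open>a\<^sub>n : X \<rightarrow> \<ell>\<^sub>p\<^sup>k\<close>
  bounded and \<open>b\<^sub>n : \<ell>\<^sub>p\<^sup>k \<rightarrow> T(X)\<close> of geometrically small norm, \<open>k\<close> depending on \<open>n\<close>: on the finite-dimensional
  copies of \<open>\<ell>\<^sub>p\<^sup>n\<close> one approximates \<open>T\<close> by means of conditional expectations onto blocks, with a
  number of blocks depending only on the compact set \<open>T(ball)\<close>, and passes to an ultralimit.
  On the other side, \<open>Y\<close> contains uniformly complemented copies of every \<open>\<ell>\<^sub>p\<^sup>k\<close>: by averaging
  over signs, the images of the unit vectors of \<open>\<ell>\<^sub>p\<^sup>m\<close> in a large \<open>\<ell>\<^sub>p\<^sup>n\<close> have large disjoint parts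
  (for \<open>p = 2\<close> the adjoint is used instead), and a matrix with bounded columns and large diagonal has
  a nearly diagonal principal submatrix.
  Choosing biorthogonal copies in \<open>Y\<close> with embeddings \<open>A\<^sub>n\<close> and projections \<open>B\<^sub>n\<close> and weights
  \<open>w\<^sub>n\<close>, the operators \<open>(\<Sum>n. w\<^sub>n A\<^sub>n a\<^sub>n)\<close> and \<open>T\<^sub>2 = (\<Sum>n. w\<^sub>n\<^sup>-\<^sup>1 b\<^sub>n B\<^sub>n)\<close> factor \<open>T\<close>.
  The \<open>B\<^sub>n\<close> are made to vanish on more and more of a dense sequence \<open>y\<^sub>j\<close>, so that
  \<open>T\<^sub>2 y\<^sub>j \<in> T(X)\<close>. Hence \<open>y\<^sub>j\<close> differs from a value of the first factor by an element of the kernel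
  of \<open>T\<^sub>2\<close>, and small rank one perturbations with values in that kernel make its range dense.
\<close>

section \<open>Ultrafilters\<close>

text \<open>The obstacle is uniformity. Each space offers only isolated finite-dimensional copies of
  \<open>\<ell>\<^sub>p\<^sup>n\<close>, with no control on \<open>n\<close>, and a fixed number of
  coordinates has to survive the limit over all finite subsets. This is why the number of blocks
  must come from the compact image alone. It is also why functionals on the whole space are
  ultralimits along one common ultrafilter rather than separate norm-preserving extensions: their
  joint bound as a map into \<open>\<ell>\<^sub>p\<^sup>k\<close> then persists.

  Two rates have to be matched. Making the copies in \<open>Y\<close> biorthogonal lets the norms of
  the embeddings \<open>A\<^sub>n\<close> grow like \<open>r ^ n\<close> with
  \<open>r = 1 + C^2\<close>. The expansion of \<open>T\<close> can be given any geometric rate, so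
  its terms are made to decay like \<open>1 / (4 * r) ^ n\<close>; the weights
  \<open>1 / (2 * r) ^ n\<close> then leave \<open>1 / 2 ^ n\<close> on both sides, and both factors
  are norm limits of finite rank operators.

  The values of \<open>b\<^sub>n\<close> are kept inside \<open>T(X)\<close> because
  \<open>T(X)\<close> is not closed in general: finite sums stay in it, limits need not. Vanishing
  of the \<open>B\<^sub>n\<close> turns \<open>T\<^sub>2 y\<^sub>j\<close> into such a finite
  sum.\<close>

definition ultra :: "'i filter \<Rightarrow> bool"
  where "ultra U \<longleftrightarrow> U \<noteq> bot \<and> (\<forall>P. eventually P U \<or> eventually (\<lambda>x. \<not> P x) U)"

text \<open>Zorn's lemma for the reversed order on the proper filters below \<open>F\<close>. The
  infimum of a chain is proper because every nonempty finite subset of a chain has a least element.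
  A minimal \<open>U\<close> decides every \<open>P\<close>: meeting \<open>U\<close> with the
  principal filter of \<open>P\<close> gives either \<open>bot\<close> or \<open>U\<close>
  itself.\<close>

lemma exists_ultra:
  fixes F :: "'i filter"
  assumes "F \<noteq> bot"
  shows "\<exists>U. ultra U \<and> U \<le> F"
proof -
  let ?A = "{G. G \<noteq> bot \<and> G \<le> F}"
  have po: "partial_order_on ?A (relation_of (\<lambda>a b. b \<le> a) ?A)"
    by (rule partial_order_on_relation_ofI, simp, rule order_trans, assumption, assumption,
        rule antisym, assumption, assumption)
  have "\<exists>m\<in>?A. \<forall>a\<in>?A. a \<le> m \<longrightarrow> a = m"
  proof (rule predicate_Zorn[OF po])
    fix C assume C: "C \<in> Chains (relation_of (\<lambda>a b. b \<le> a) ?A)"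
    have chain: "a \<le> b \<or> b \<le> a" and mem: "a \<in> ?A" if "a \<in> C" "b \<in> C" for a b
      using C that by (auto simp: Chains_def relation_of_def)
    have fin: "X = {} \<or> Inf X \<in> X" if "finite X" "X \<subseteq> C" for X
      using that
    proof (induction X)
      case (insert x X)
      show ?case
      proof (cases "X = {}")
        case False
        with insert have "Inf X \<in> X" by auto
        then have "x \<le> Inf X \<or> Inf X \<le> x" using chain insert.prems by blast
        then have "inf x (Inf X) = x \<or> inf x (Inf X) = Inf X"
          by (auto simp: inf_absorb1 inf_absorb2)
        then show ?thesis
        proof
          assume "inf x (Inf X) = x"
          then have "Inf (insert x X) = x" by simp
          then show ?thesis by simp
        next
          assume "inf x (Inf X) = Inf X"
          then have "Inf (insert x X) = Inf X" by simp
          then show ?thesis using \<open>Inf X \<in> X\<close> by simp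
        qed
      qed auto
    qed auto
    have "Inf C \<noteq> bot"
    proof (rule Inf_filter_not_bot)
      fix X assume "X \<subseteq> C" "finite X"
      have "X = {} \<or> Inf X \<in> C" using fin[of X] \<open>X \<subseteq> C\<close> \<open>finite X\<close> by blast
      then show "Inf X \<noteq> bot"
      proof
        assume "Inf X \<in> C"
        then show ?thesis using mem by blast
      next
        assume "X = {}"
        have "(top :: 'i filter) \<noteq> bot" using assms bot.extremum_uniqueI top_greatest by metis
        then show ?thesis using \<open>X = {}\<close> by simp
      qed
    qed
    moreover have "Inf C \<le> F" if ne: "C \<noteq> {}"
    proof -
      obtain a where "a \<in> C" using ne by blast
      then have "Inf C \<le> a" "a \<le> F" using mem by (auto simp: Inf_lower)
      then show ?thesis by (rule order_trans)
    qed
    moreover have "\<forall>a\<in>C. Inf C \<le> a" by (simp add: Inf_lower)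
    ultimately show "\<exists>u\<in>?A. \<forall>a\<in>C. u \<le> a"
      using assms by (cases "C = {}") auto
  qed
  then obtain U where U: "U \<noteq> bot" "U \<le> F" and max: "\<And>G. G \<noteq> bot \<Longrightarrow> G \<le> F \<Longrightarrow> G \<le> U \<Longrightarrow> G = U"
    by auto
  have "eventually P U \<or> eventually (\<lambda>x. \<not> P x) U" for P
  proof (cases "inf U (principal {x. P x}) = bot")
    case True
    then have "eventually (\<lambda>x. False) (inf U (principal {x. P x}))" by simp
    then show ?thesis by (simp add: eventually_inf_principal)
  next
    case False
    then have "inf U (principal {x. P x}) = U"
      using max U(2) by (meson inf_le1 order_trans)
    then have "eventually P (inf U (principal {x. P x})) = eventually P U" by simp
    then show ?thesis by (simp add: eventually_inf_principal)
  qed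
  with U show ?thesis by (auto simp: ultra_def)
qed

text \<open>Compactness gives a cluster point \<open>l\<close> of the image filter. An ultrafilter
  that is not eventually inside a neighbourhood of \<open>l\<close> is eventually outside it, which
  a cluster point excludes; so \<open>l\<close> is a limit.\<close>

lemma ultra_tendsto_compact:
  fixes f :: "'i \<Rightarrow> 'a::topological_space"
  assumes U: "ultra U" and "compact K" "eventually (\<lambda>i. f i \<in> K) U"
  shows "\<exists>l\<in>K. (f \<longlongrightarrow> l) U"
proof -
  have "filtermap f U \<noteq> bot" using U by (simp add: ultra_def filtermap_bot_iff)
  moreover have "eventually (\<lambda>x. x \<in> K) (filtermap f U)"
    using assms by (simp add: eventually_filtermap)
  ultimately obtain l where l: "l \<in> K" "inf (nhds l) (filtermap f U) \<noteq> bot"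
    using \<open>compact K\<close> unfolding compact_filter by blast
  have "(f \<longlongrightarrow> l) U"
  proof (rule topological_tendstoI, rule ccontr)
    fix S assume S: "open S" "l \<in> S" "\<not> eventually (\<lambda>x. f x \<in> S) U"
    then have "eventually (\<lambda>x. f x \<notin> S) U"
      using U unfolding ultra_def by blast
    then have "eventually (\<lambda>y. y \<notin> S) (filtermap f U)" by (simp add: eventually_filtermap)
    moreover have "eventually (\<lambda>y. y \<in> S) (nhds l)"
      using S by (simp add: eventually_nhds_in_open)
    ultimately have "eventually (\<lambda>y. False) (inf (nhds l) (filtermap f U))"
      unfolding eventually_inf by blast
    with l show False by (simp add: trivial_limit_def)
  qed
  with l show ?thesis by blast
qed

section \<open>The scalar field\<close>

lemma le_of_power_bound:
  fixes x y c :: real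
  assumes "0 \<le> x" "0 \<le> y" and bound: "\<And>n. x ^ n \<le> c * y ^ n"
  shows "x \<le> y"
proof (rule ccontr)
  assume "\<not> x \<le> y"
  show False
  proof (cases "y = 0")
    case True
    with bound[of 1] \<open>\<not> x \<le> y\<close> show False by simp
  next
    case False
    then have y: "0 < y" using assms by simp
    with \<open>\<not> x \<le> y\<close> have "1 < x / y" by simp
    then obtain n where n: "c < (x / y) ^ n" using real_arch_pow by blast
    have "(x / y) ^ n \<le> c" using bound[of n] y by (simp add: power_divide field_simps)
    with n show False by simp
  qed
qed

text \<open>The class gives only a root \<open>i\<close> of \<open>-1\<close> and a multiplicative
  norm, so the modulus formula has to be derived. Powers give
  \<open>(norm (a + b i))^2 \<le> a^2 + b^2\<close>. The same bound holds for
  \<open>a - b i\<close>, and the product of both numbers is \<open>a^2 + b^2\<close>, which forces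
  equality.\<close>

lemma exists_conjugation:
  "\<exists>cnj :: 'k::real_or_complex \<Rightarrow> 'k. (\<forall>x y. cnj (x + y) = cnj x + cnj y) \<and>
     (\<forall>z. z * cnj z = of_real ((norm z)\<^sup>2))"
proof -
  consider (re) "\<forall>z::'k. \<exists>a. z = a *\<^sub>R 1"
    | (co) i where "i * i = (- 1 :: 'k)" "\<forall>z. \<exists>a b. z = a *\<^sub>R 1 + b *\<^sub>R i"
    using real_or_complex[where ?'a='k] by blast
  then show ?thesis
  proof cases
    case re
    have "z * z = of_real ((norm z)\<^sup>2)" for z :: 'k
    proof -
      obtain a where "z = of_real a" using re by (metis of_real_def)
      then show ?thesis by (simp add: power2_eq_square)
    qed
    then show ?thesis by (intro exI[of _ "\<lambda>z. z"]) simp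
  next
    case co
    let ?z = "\<lambda>a b. of_real a + of_real b * i"
    have i2: "i * (i * x) = - x" for x using co(1) by (simp flip: mult.assoc)
    have ex: "\<exists>a b. z = ?z a b" for z
      using co(2) by (metis of_real_def scaleR_conv_of_real)
    have inj: "a = 0 \<and> b = 0" if "?z a b = 0" for a b
    proof -
      have "(?z a b) * (?z a (-b)) = of_real (a\<^sup>2 + b\<^sup>2)"
        by (simp add: algebra_simps power2_eq_square co(1) i2)
      with that have "a\<^sup>2 + b\<^sup>2 = 0" by (metis mult_zero_left of_real_eq_0_iff)
      then show ?thesis by (simp add: sum_power2_eq_zero_iff)
    qed
    have uniq: "a = c \<and> b = d" if "?z a b = ?z c d" for a b c d
      using inj[of "a - c" "b - d"] that by (simp add: algebra_simps)
    have ni: "norm i = 1"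
    proof -
      have "norm i * norm i = 1" using co(1) by (metis norm_minus_cancel norm_mult norm_one)
      then show ?thesis by (metis norm_ge_zero real_sqrt_abs2 real_sqrt_one abs_of_nonneg)
    qed
    \<comment> \<open>The crude bound \<open>norm (c + d i) \<le> \<bar>c\<bar> + \<bar>d\<bar>\<close>, applied to all powers of \<open>a + b i\<close>, becomes sharp.\<close>
    have le: "(norm (?z a b))\<^sup>2 \<le> a\<^sup>2 + b\<^sup>2" for a b
    proof (rule le_of_power_bound[where c=2])
      fix n
      have "\<exists>c d. (?z a b) ^ n = ?z c d \<and> c\<^sup>2 + d\<^sup>2 = (a\<^sup>2 + b\<^sup>2) ^ n"
      proof (induction n)
        case 0 show ?case by (intro exI[of _ 1] exI[of _ 0]) simp
      next
        case (Suc n)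
        then obtain c d where IH: "(?z a b) ^ n = ?z c d" "c\<^sup>2 + d\<^sup>2 = (a\<^sup>2 + b\<^sup>2) ^ n" by blast
        have "(?z a b) ^ Suc n = ?z (a * c - b * d) (a * d + b * c)"
          using IH(1) by (simp add: algebra_simps co(1) i2)
        moreover have "(a * c - b * d)\<^sup>2 + (a * d + b * c)\<^sup>2 = (a\<^sup>2 + b\<^sup>2) * (c\<^sup>2 + d\<^sup>2)"
          by (simp add: algebra_simps power2_eq_square)
        ultimately show ?case using IH(2) by (intro exI conjI) auto
      qed
      then obtain c d where cd: "(?z a b) ^ n = ?z c d" "c\<^sup>2 + d\<^sup>2 = (a\<^sup>2 + b\<^sup>2) ^ n" by blast
      have "norm (?z c d) \<le> \<bar>c\<bar> + \<bar>d\<bar>"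
        using norm_triangle_ineq[of "of_real c :: 'k" "of_real d * i"] ni by (simp add: norm_mult)
      then have "(norm (?z c d))\<^sup>2 \<le> (\<bar>c\<bar> + \<bar>d\<bar>)\<^sup>2" by (intro power_mono) auto
      also have "\<dots> \<le> 2 * (c\<^sup>2 + d\<^sup>2)"
        using sum_squares_bound[of "\<bar>c\<bar>" "\<bar>d\<bar>"] by (simp add: power2_sum)
      finally show "((norm (?z a b))\<^sup>2) ^ n \<le> 2 * (a\<^sup>2 + b\<^sup>2) ^ n"
        using cd by (metis norm_power power_mult mult.commute)
    qed auto
    have prod: "(?z a b) * (?z a (-b)) = of_real (a\<^sup>2 + b\<^sup>2)" for a b
      by (simp add: algebra_simps power2_eq_square co(1) i2)
    have eq: "(norm (?z a b))\<^sup>2 = a\<^sup>2 + b\<^sup>2" for a b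
    proof -
      let ?s = "a\<^sup>2 + b\<^sup>2"
      have "norm (?z a b) * norm (?z a (-b)) = ?s"
        using prod[of a b] by (metis abs_of_nonneg norm_mult norm_of_real sum_power2_ge_zero)
      then have "(norm (?z a b))\<^sup>2 * (norm (?z a (-b)))\<^sup>2 = ?s\<^sup>2" by (metis power_mult_distrib)
      moreover have "(norm (?z a b))\<^sup>2 * (norm (?z a (-b)))\<^sup>2 \<le> (norm (?z a b))\<^sup>2 * ?s"
        using le[of a "-b"] by (intro mult_left_mono) auto
      ultimately have *: "?s * ?s \<le> (norm (?z a b))\<^sup>2 * ?s" by (simp add: power2_eq_square)
      show ?thesis
      proof (cases "?s = 0")
        case False
        then have "0 < ?s" by (metis less_eq_real_def sum_power2_ge_zero)
        with * have "?s \<le> (norm (?z a b))\<^sup>2" by simp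
        with le[of a b] show ?thesis by simp
      qed (use le[of a b] in simp)
    qed
    define cnj where "cnj z = (THE w. \<exists>a b. z = ?z a b \<and> w = ?z a (-b))" for z
    have cnj: "cnj (?z a b) = ?z a (-b)" for a b
      unfolding cnj_def by (rule the_equality) (use uniq in blast)+
    have "cnj (x + y) = cnj x + cnj y" for x y
    proof -
      obtain a b c d where xy: "x = ?z a b" "y = ?z c d" using ex by blast
      have xy': "x + y = ?z (a + c) (b + d)" using xy by (simp add: algebra_simps)
      show ?thesis unfolding xy' cnj unfolding xy cnj by (simp add: algebra_simps)
    qed
    moreover have "z * cnj z = of_real ((norm z)\<^sup>2)" for z
      using ex[of z] cnj prod eq by fastforce
    ultimately show ?thesis by blast
  qed
qed

text \<open>Exact second moments of random signs rest on this identity; it comes from expanding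
  \<open>z * cnj z\<close>.\<close>

lemma norm_parallelogram:
  fixes x y :: "'k::real_or_complex"
  shows "(norm (x + y))\<^sup>2 + (norm (x - y))\<^sup>2 = 2 * (norm x)\<^sup>2 + 2 * (norm y)\<^sup>2"
proof -
  obtain cnj :: "'k \<Rightarrow> 'k" where add: "\<And>x y. cnj (x + y) = cnj x + cnj y"
    and mult: "\<And>z. z * cnj z = of_real ((norm z)\<^sup>2)"
    using exists_conjugation by blast
  have diff: "cnj (x - y) = cnj x - cnj y" using add[of "x - y" y] by simp
  have "of_real ((norm (x + y))\<^sup>2 + (norm (x - y))\<^sup>2) = (x + y) * cnj (x + y) + (x - y) * cnj (x - y)"
    by (simp add: mult)
  also have "\<dots> = 2 * (x * cnj x) + 2 * (y * cnj y)"
    unfolding add diff by (simp add: algebra_simps)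
  also have "\<dots> = of_real (2 * (norm x)\<^sup>2 + 2 * (norm y)\<^sup>2)" unfolding mult by simp
  finally show ?thesis using of_real_eq_iff by blast
qed

text \<open>Coordinate bounds with a lossy constant are enough: the ball is then a closed subset of
  the continuous image of an interval or a square.\<close>

lemma compact_scalar_cball: "compact (cball (0::'k::real_or_complex) r)"
proof -
  \<comment> \<open>The value \<open>i = 0\<close> encodes the real case, so that both alternatives
    of the class are covered by one choice of \<open>i\<close>.\<close>
  obtain i :: 'k where i: "\<forall>z. \<exists>a b. z = a *\<^sub>R 1 + b *\<^sub>R i"
    and "i = 0 \<or> i * i = -1"
    using real_or_complex[where ?'a='k] by (metis add.right_neutral scaleR_zero_right)
  show ?thesis
  proof (cases "i = 0")
    case True
    have "z \<in> (\<lambda>a. a *\<^sub>R 1) ` {-r..r}" if "z \<in> cball 0 r" for z :: 'k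
    proof -
      obtain a where a: "z = a *\<^sub>R 1" using i True by auto
      then have "\<bar>a\<bar> \<le> r" using that by simp
      then show ?thesis using a by (intro image_eqI[of _ _ a]) auto
    qed
    then have eq: "cball 0 r = cball 0 r \<inter> (\<lambda>a. a *\<^sub>R (1::'k)) ` {-r..r}" by blast
    moreover have "compact ((\<lambda>a. a *\<^sub>R (1::'k)) ` {-r..r})"
      by (intro compact_continuous_image continuous_intros compact_Icc)
    ultimately show ?thesis by (subst eq) (intro closed_Int_compact closed_cball)
  next
    case False
    then have ii: "i * i = -1" using \<open>i = 0 \<or> i * i = -1\<close> by simp
    have i2: "i * (i * x) = - x" for x using ii by (simp flip: mult.assoc)
    have ni: "norm i = 1" using ii
      by (metis norm_ge_zero norm_minus_cancel norm_mult norm_one real_sqrt_abs2 real_sqrt_one abs_of_nonneg)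
    let ?f = "\<lambda>x::real \<times> real. fst x *\<^sub>R 1 + snd x *\<^sub>R i"
    let ?B = "{-2*r..2*r}"
    have "z \<in> ?f ` (?B \<times> ?B)" if "z \<in> cball 0 r" for z
    proof -
      obtain a b where z: "z = a *\<^sub>R 1 + b *\<^sub>R i" using i by blast
      have "norm z \<le> r" using that by simp
      have "z * (a *\<^sub>R 1 - b *\<^sub>R i) = of_real (a\<^sup>2 + b\<^sup>2)"
        unfolding z by (simp add: algebra_simps power2_eq_square scaleR_conv_of_real ii i2)
      then have "a\<^sup>2 + b\<^sup>2 = norm z * norm (a *\<^sub>R 1 - b *\<^sub>R i)"
        by (metis abs_of_nonneg norm_mult norm_of_real sum_power2_ge_zero)
      also have "\<dots> \<le> r * (\<bar>a\<bar> + \<bar>b\<bar>)"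
      proof (rule mult_mono)
        show "norm (a *\<^sub>R 1 - b *\<^sub>R i) \<le> \<bar>a\<bar> + \<bar>b\<bar>"
          using norm_triangle_ineq4[of "a *\<^sub>R 1" "b *\<^sub>R i"] ni by simp
      qed (use \<open>norm z \<le> r\<close> order_trans[OF norm_ge_zero] in auto)
      finally have *: "\<bar>a\<bar>\<^sup>2 + \<bar>b\<bar>\<^sup>2 \<le> r * (\<bar>a\<bar> + \<bar>b\<bar>)" by simp
      have r: "0 \<le> r" using \<open>norm z \<le> r\<close> norm_ge_zero order_trans by blast
      \<comment> \<open>If \<open>s > 2 * r\<close>, then \<open>s * s - r * s\<close> exceeds
        \<open>r * r / 4\<close>, whereas \<open>r * t - t^2\<close> never does.\<close>
      have aux: "s \<le> 2 * r" if "s\<^sup>2 + t\<^sup>2 \<le> r * (s + t)" "0 \<le> s" "0 \<le> t" for s t :: real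
      proof (rule ccontr)
        assume "\<not> s \<le> 2 * r"
        then have s: "2 * r < s" by simp
        have "0 \<le> (2 * t - r)\<^sup>2" by simp
        then have "r * t - t\<^sup>2 \<le> r * r / 4" by (simp add: power2_eq_square algebra_simps)
        moreover have "s * s - r * s > r * r / 4"
        proof -
          have "s * (s - r) \<ge> s * r" using s r that by (intro mult_left_mono) auto
          moreover have "r * s \<ge> r * (2 * r)" using s r by (intro mult_left_mono) auto
          moreover have "r * r \<ge> 0" by simp
          moreover have "s * s > 0" using s r by simp
          ultimately show ?thesis unfolding right_diff_distrib by (cases "r = 0") (auto simp: mult.commute)
        qed
        ultimately show False using that r by (simp add: power2_eq_square algebra_simps)
      qed
      have "\<bar>a\<bar> \<le> 2 * r" "\<bar>b\<bar> \<le> 2 * r"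
        using aux[of "\<bar>a\<bar>" "\<bar>b\<bar>"] aux[of "\<bar>b\<bar>" "\<bar>a\<bar>"] * by (auto simp: add.commute)
      then show ?thesis using z by (intro image_eqI[of _ _ "(a, b)"]) auto
    qed
    then have eq: "cball 0 r = cball 0 r \<inter> ?f ` (?B \<times> ?B)" by blast
    moreover have "compact (?f ` (?B \<times> ?B))"
      by (intro compact_continuous_image continuous_intros compact_Times compact_Icc)
    ultimately show ?thesis by (subst eq) (intro closed_Int_compact closed_cball)
  qed
qed

lemma exists_unimodular:
  fixes z :: "'k::real_normed_field"
  shows "\<exists>s. norm s = 1 \<and> s * z = of_real (norm z)"
proof (cases "z = 0")
  case False
  then show ?thesis by (intro exI[of _ "of_real (norm z) / z"]) (simp add: norm_divide)
qed (auto intro: exI[of _ 1])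

section \<open>Finite-dimensional sequence spaces\<close>

definition conjugate_exponents :: "real \<Rightarrow> real \<Rightarrow> bool"
  where "conjugate_exponents p q \<longleftrightarrow> 1 < p \<and> 1 < q \<and> 1 / p + 1 / q = 1"

lemma conjugate_exponents_sym: "conjugate_exponents p q \<Longrightarrow> conjugate_exponents q p"
  by (auto simp: conjugate_exponents_def)

lemma conjugate_exponentsD:
  assumes "conjugate_exponents p q"
  shows "1 < p" "1 < q" "(q - 1) * p = q"
  using assms by (auto simp: conjugate_exponents_def field_simps)

lemma exists_conjugate_exponent: "1 < p \<Longrightarrow> \<exists>q. conjugate_exponents p q"
  by (intro exI[of _ "p / (p - 1)"]) (auto simp: conjugate_exponents_def field_simps)

text \<open>The index set is arbitrary, so that the same norm also measures the blocks of a
  partition.\<close>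

definition lps :: "real \<Rightarrow> 'i set \<Rightarrow> ('i \<Rightarrow> 'k::real_normed_field) \<Rightarrow> real"
  where "lps p I v = (\<Sum>i\<in>I. norm (v i) powr p) powr (1 / p)"

lemma lp_norm_eq_lps: "lp_norm p n = lps p {..<n}"
  by (simp add: fun_eq_iff lp_norm_def lps_def)

lemma lps_nonneg [simp]: "0 \<le> lps p I v"
  by (simp add: lps_def)

lemma lps_cong: "(\<And>i. i \<in> I \<Longrightarrow> norm (v i) = norm (w i)) \<Longrightarrow> lps p I v = lps p I w"
  by (simp add: lps_def)

lemma lps_powr: "0 < p \<Longrightarrow> lps p I v powr p = (\<Sum>i\<in>I. norm (v i) powr p)"
  by (simp add: lps_def powr_powr sum_nonneg)

lemma lps_le_iff:
  assumes "0 < p" "0 \<le> C"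
  shows "lps p I v \<le> C \<longleftrightarrow> (\<Sum>i\<in>I. norm (v i) powr p) \<le> C powr p"
proof -
  have "lps p I v \<le> C \<longleftrightarrow> lps p I v powr p \<le> C powr p"
    using assms by (metis lps_nonneg not_le powr_less_mono2 powr_mono2 less_imp_le)
  then show ?thesis using assms by (simp add: lps_powr)
qed

lemma lps_mult: "0 < p \<Longrightarrow> lps p I (\<lambda>i. c * v i) = norm c * lps p I v"
  by (simp add: lps_def norm_mult powr_mult sum_nonneg powr_powr flip: sum_distrib_left)

lemma lps_zero [simp]: "lps p I (\<lambda>i. 0) = 0"
  by (simp add: lps_def)

lemma norm_le_lps:
  assumes "finite I" "i \<in> I" "0 < p"
  shows "norm (v i) \<le> lps p I v"
proof -
  have "norm (v i) powr p \<le> (\<Sum>i\<in>I. norm (v i) powr p)"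
    using assms by (intro member_le_sum) auto
  then have "(norm (v i) powr p) powr (1 / p) \<le> lps p I v"
    unfolding lps_def using assms by (intro powr_mono2) auto
  then show ?thesis using assms by (simp add: powr_powr)
qed

lemma lps_eq_0D: "\<lbrakk>lps p I v = 0; finite I; i \<in> I; 0 < p\<rbrakk> \<Longrightarrow> v i = 0"
  by (metis norm_le_lps norm_le_zero_iff)

lemma lps_unit:
  assumes "finite I" "i \<in> I" "0 < p"
  shows "lps p I (\<lambda>j. if j = i then c else 0) = norm c"
proof -
  have "(\<Sum>j\<in>I. norm (if j = i then c else 0) powr p) = (\<Sum>j\<in>I. if j = i then norm c powr p else 0)"
    by (intro sum.cong) auto
  then show ?thesis using assms by (simp add: lps_def powr_powr)
qed

lemma lps_empty [simp]: "lps p {} v = 0"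
  by (simp add: lps_def)

lemma lps_reindex: "inj_on b I \<Longrightarrow> lps p (b ` I) v = lps p I (\<lambda>i. v (b i))"
  by (simp add: lps_def sum.reindex)

lemma lps_mono_set:
  assumes "finite J" "I \<subseteq> J" "0 < p"
  shows "lps p I v \<le> lps p J v"
  unfolding lps_def using assms by (intro powr_mono2 sum_mono2) (auto intro: sum_nonneg)

section \<open>Hoelder's inequality, norming vectors and contractive block maps\<close>

lemma holder_sum:
  assumes pq: "conjugate_exponents p q" and "finite I"
  shows "(\<Sum>i\<in>I. norm (f i) * norm (v i)) \<le> lps q I f * lps p I v"
proof (cases "lps q I f = 0 \<or> lps p I v = 0")
  case True
  have "norm (f i) * norm (v i) = 0" if "i \<in> I" for i
    using True
  proof
    assume "lps q I f = 0"
    then have "f i = 0"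
      using lps_eq_0D[of q I f i] that assms(2) conjugate_exponentsD(2)[OF pq] by simp
    then show ?thesis by simp
  next
    assume "lps p I v = 0"
    then have "v i = 0"
      using lps_eq_0D[of p I v i] that assms(2) conjugate_exponentsD(1)[OF pq] by simp
    then show ?thesis by simp
  qed
  then have "(\<Sum>i\<in>I. norm (f i) * norm (v i)) = 0" by (intro sum.neutral) blast
  then show ?thesis by simp
next
  case False
  note D = conjugate_exponentsD[OF pq]
  let ?a = "lps q I f" and ?b = "lps p I v"
  have pos: "0 < ?a" "0 < ?b" using False by (simp_all add: less_le)
  have "(\<Sum>i\<in>I. (norm (v i) / ?b) * (norm (f i) / ?a))
      \<le> (\<Sum>i\<in>I. (norm (v i) / ?b) powr p / p + (norm (f i) / ?a) powr q / q)"
    using pos pq by (intro sum_mono Youngs_inequality) (auto simp: conjugate_exponents_def)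
  also have "\<dots> = (\<Sum>i\<in>I. norm (v i) powr p) / ?b powr p / p + (\<Sum>i\<in>I. norm (f i) powr q) / ?a powr q / q"
    using pos by (simp add: sum.distrib powr_divide sum_divide_distrib)
  also have "\<dots> = 1 / p + 1 / q"
  proof -
    have "?b powr p = (\<Sum>i\<in>I. norm (v i) powr p)" "?a powr q = (\<Sum>i\<in>I. norm (f i) powr q)"
      using D(1,2) by (simp_all add: lps_powr)
    moreover have "?b powr p > 0" "?a powr q > 0" using pos by auto
    ultimately show ?thesis by simp
  qed
  also have "\<dots> = 1" using pq by (simp add: conjugate_exponents_def)
  finally have "(\<Sum>i\<in>I. norm (f i) * norm (v i)) / (?a * ?b) \<le> 1"
    by (simp add: sum_divide_distrib mult.commute)
  then show ?thesis using pos by (simp add: field_simps)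
qed

lemma holder:
  assumes "conjugate_exponents p q" "finite I"
  shows "norm (\<Sum>i\<in>I. f i * v i) \<le> lps q I f * lps p I v"
proof -
  have "norm (\<Sum>i\<in>I. f i * v i) \<le> (\<Sum>i\<in>I. norm (f i) * norm (v i))"
    by (rule order_trans[OF norm_sum]) (simp add: norm_mult)
  also have "\<dots> \<le> lps q I f * lps p I v" using assms by (rule holder_sum)
  finally show ?thesis .
qed

text \<open>The equality case of Hoelder's inequality: \<open>v i\<close> has modulus proportional
  to \<open>norm (f i) powr (q - 1)\<close> and the phase that makes \<open>f i * v i\<close>
  nonnegative. The relation \<open>(q - 1) * p = q\<close> gives its norm.\<close>

lemma exists_norming:
  fixes f :: "'i \<Rightarrow> 'k::real_normed_field"
  assumes pq: "conjugate_exponents p q" and "finite I"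
  shows "\<exists>v. (\<Sum>i\<in>I. f i * v i) = of_real (lps q I f) \<and> lps p I v \<le> 1"
proof (cases "lps q I f = 0")
  case True
  then show ?thesis by (intro exI[of _ "\<lambda>_. 0"]) simp
next
  case False
  note D = conjugate_exponentsD[OF pq]
  define s where "s = lps q I f"
  have s: "0 < s" using False unfolding s_def by (simp add: less_le)
  have sq: "s powr q = (\<Sum>i\<in>I. norm (f i) powr q)" using D(2) unfolding s_def by (simp add: lps_powr)
  have "\<forall>i. \<exists>s. norm s = 1 \<and> s * f i = of_real (norm (f i))" using exists_unimodular by blast
  then obtain \<sigma> where \<sigma>: "\<And>i. norm (\<sigma> i) = 1" "\<And>i. \<sigma> i * f i = of_real (norm (f i))"
    by metis
  define v where "v i = of_real ((norm (f i) / s) powr (q - 1)) * \<sigma> i" for i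
  have nv: "norm (v i) = (norm (f i) / s) powr (q - 1)" for i
    unfolding v_def using \<sigma> by (simp add: norm_mult)
  have fv: "f i * v i = of_real (norm (f i) powr q / s powr (q - 1))" for i
  proof -
    have "f i * v i = of_real ((norm (f i) / s) powr (q - 1)) * (\<sigma> i * f i)"
      by (simp add: v_def mult_ac)
    also have "\<dots> = of_real ((norm (f i) / s) powr (q - 1) * norm (f i))" using \<sigma> by simp
    also have "(norm (f i) / s) powr (q - 1) * norm (f i) = norm (f i) powr q / s powr (q - 1)"
      using s D(2) by (cases "f i = 0") (auto simp: powr_divide powr_diff)
    finally show ?thesis .
  qed
  have "(\<Sum>i\<in>I. f i * v i) = of_real (s powr q / s powr (q - 1))"
    unfolding fv sq by (simp add: sum_divide_distrib)
  also have "s powr q / s powr (q - 1) = s" using s by (simp flip: powr_diff)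
  finally have 1: "(\<Sum>i\<in>I. f i * v i) = of_real s" .
  have "(\<Sum>i\<in>I. norm (v i) powr p) = (\<Sum>i\<in>I. norm (f i) powr q / s powr q)"
    unfolding nv using s by (simp add: powr_powr powr_divide D(3))
  also have "\<dots> = s powr q / s powr q" unfolding sq by (rule sum_divide_distrib[symmetric])
  also have "\<dots> = 1" using s by simp
  finally have "lps p I v \<le> 1" by (simp add: lps_def)
  with 1 show ?thesis unfolding s_def by blast
qed

lemma lps_dual_le:
  assumes pq: "conjugate_exponents p q" and "finite I" "0 \<le> C"
    and bound: "\<And>v. norm (\<Sum>i\<in>I. f i * v i) \<le> C * lps p I v"
  shows "lps q I f \<le> C"
proof -
  obtain v where v: "(\<Sum>i\<in>I. f i * v i) = of_real (lps q I f)" "lps p I v \<le> 1"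
    using exists_norming[OF pq \<open>finite I\<close>] by blast
  have "lps q I f = norm (\<Sum>i\<in>I. f i * v i)" unfolding v(1) by simp
  also have "\<dots> \<le> C * lps p I v" by (rule bound)
  also have "\<dots> \<le> C" using v(2) \<open>0 \<le> C\<close> by (simp add: mult_left_le)
  finally show ?thesis .
qed

text \<open>Hoelder's inequality bounds each scalar by the \<open>p\<close>-norm of \<open>v\<close>
  on its own block, and \<open>p\<close>-th powers add over disjoint blocks.\<close>

lemma lps_block_functionals:
  assumes pq: "conjugate_exponents p q" and fin: "finite J" "finite I" and "\<beta> ` J \<subseteq> I"
    and \<phi>: "\<And>B. B \<in> I \<Longrightarrow> lps q {i\<in>J. \<beta> i = B} \<phi> \<le> 1"
  shows "lps p I (\<lambda>B. \<Sum>i\<in>{i\<in>J. \<beta> i = B}. \<phi> i * v i) \<le> lps p J v"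
proof -
  note D = conjugate_exponentsD[OF pq]
  have p0: "0 < p" using D by simp
  have "(\<Sum>B\<in>I. norm (\<Sum>i\<in>{i\<in>J. \<beta> i = B}. \<phi> i * v i) powr p)
      \<le> (\<Sum>B\<in>I. \<Sum>i\<in>{i\<in>J. \<beta> i = B}. norm (v i) powr p)"
  proof (rule sum_mono)
    fix B assume "B \<in> I"
    let ?S = "{i\<in>J. \<beta> i = B}"
    have "norm (\<Sum>i\<in>?S. \<phi> i * v i) \<le> lps q ?S \<phi> * lps p ?S v"
      using fin by (intro holder[OF pq]) auto
    also have "\<dots> \<le> 1 * lps p ?S v" using \<phi>[OF \<open>B \<in> I\<close>] by (intro mult_right_mono) auto
    finally have "norm (\<Sum>i\<in>?S. \<phi> i * v i) powr p \<le> lps p ?S v powr p"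
      using D by (intro powr_mono2) auto
    then show "norm (\<Sum>i\<in>?S. \<phi> i * v i) powr p \<le> (\<Sum>i\<in>?S. norm (v i) powr p)"
      using p0 by (simp add: lps_powr)
  qed
  also have "\<dots> = (\<Sum>i\<in>J. norm (v i) powr p)" using fin assms(4) by (rule sum.group)
  finally show ?thesis
    unfolding lps_def using p0 by (intro powr_mono2) (auto intro: sum_nonneg)
qed

text \<open>Disjointly supported vectors of norm at most 1 are dominated by the unit vectors.
  Composed with \<open>lps_block_functionals\<close>, this makes block projections
  contractive.\<close>

lemma lps_block_vectors:
  assumes "0 < p" and fin: "finite J" "finite I" and "\<beta> ` J \<subseteq> I"
    and g: "\<And>B. B \<in> I \<Longrightarrow> lps p {i\<in>J. \<beta> i = B} g \<le> 1"
  shows "lps p J (\<lambda>i. t (\<beta> i) * g i) \<le> lps p I t"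
proof -
  have "(\<Sum>i\<in>J. norm (t (\<beta> i) * g i) powr p)
      = (\<Sum>B\<in>I. \<Sum>i\<in>{i\<in>J. \<beta> i = B}. norm (t (\<beta> i) * g i) powr p)"
    using fin assms(4) by (rule sum.group[symmetric])
  also have "\<dots> = (\<Sum>B\<in>I. norm (t B) powr p * (\<Sum>i\<in>{i\<in>J. \<beta> i = B}. norm (g i) powr p))"
    by (simp add: sum_distrib_left norm_mult powr_mult)
  also have "\<dots> \<le> (\<Sum>B\<in>I. norm (t B) powr p * 1)"
    using g \<open>0 < p\<close> by (intro sum_mono mult_left_mono) (simp_all add: lps_le_iff)
  finally show ?thesis
    unfolding lps_def using \<open>0 < p\<close> by (intro powr_mono2) (auto intro: sum_nonneg)
qed

text \<open>Gaussian elimination: a zero row imposes no condition, and otherwise a pivot expresses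
  one unknown through the others and the remaining rows form a smaller system of the same
  kind.\<close>

lemma exists_nontrivial_kernel:
  fixes M :: "'i \<Rightarrow> 'j \<Rightarrow> 'k::field"
  assumes "finite I" "finite J" "card I < card J"
  shows "\<exists>t. (\<exists>j\<in>J. t j \<noteq> 0) \<and> (\<forall>i\<in>I. (\<Sum>j\<in>J. M i j * t j) = 0)"
  using assms
proof (induction I arbitrary: J M)
  case empty
  then have "J \<noteq> {}" by auto
  then show ?case by (intro exI[of _ "\<lambda>_. 1"]) auto
next
  case (insert i0 I)
  show ?case
  proof (cases "\<forall>j\<in>J. M i0 j = 0")
    case True
    have "card I < card J" using insert by simp
    then obtain t where "\<exists>j\<in>J. t j \<noteq> 0" "\<forall>i\<in>I. (\<Sum>j\<in>J. M i j * t j) = 0"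
      using insert.IH[OF insert.prems(1), of M] by blast
    moreover have "(\<Sum>j\<in>J. M i0 j * t j) = 0" using True by simp
    ultimately show ?thesis by blast
  next
    case False
    then obtain j0 where j0: "j0 \<in> J" "M i0 j0 \<noteq> 0" by blast
    let ?J = "J - {j0}"
    have "card I < card ?J" using insert j0 by simp
    then obtain t where t: "\<exists>j\<in>?J. t j \<noteq> 0"
      "\<forall>i\<in>I. (\<Sum>j\<in>?J. (M i j - M i j0 * M i0 j / M i0 j0) * t j) = 0"
      using insert.IH[of ?J "\<lambda>i j. M i j - M i j0 * M i0 j / M i0 j0"] insert.prems by auto
    define t' where "t' = t(j0 := - (\<Sum>j\<in>?J. M i0 j * t j) / M i0 j0)"
    have split: "(\<Sum>j\<in>J. M i j * t' j) = M i j0 * t' j0 + (\<Sum>j\<in>?J. M i j * t j)" for i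
      using sum.remove[OF insert.prems(1) j0(1), of "\<lambda>j. M i j * t' j"]
      by (simp add: t'_def)
    have "(\<Sum>j\<in>J. M i j * t' j) = 0" if "i \<in> I" for i
    proof -
      have "(\<Sum>j\<in>?J. (M i j - M i j0 * M i0 j / M i0 j0) * t j)
          = (\<Sum>j\<in>?J. M i j * t j) - (\<Sum>j\<in>?J. M i j0 / M i0 j0 * (M i0 j * t j))"
        by (simp add: sum_subtractf left_diff_distrib mult.assoc)
      also have "\<dots> = (\<Sum>j\<in>?J. M i j * t j) - M i j0 / M i0 j0 * (\<Sum>j\<in>?J. M i0 j * t j)"
        by (simp only: sum_distrib_left)
      finally show ?thesis using t(2) that unfolding split by (simp add: t'_def)
    qed
    moreover have "(\<Sum>j\<in>J. M i0 j * t' j) = 0" unfolding split using j0 by (simp add: t'_def)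
    moreover have "\<exists>j\<in>J. t' j \<noteq> 0" using t(1) by (auto simp: t'_def)
    ultimately show ?thesis by blast
  qed
qed

text \<open>
  A conditional expectation: the coordinates \<open>i\<close> are grouped according to the approximate direction
  of \<open>(\<phi> j i)\<^sub>j\<close>, so that every \<open>\<phi> j\<close> is on each group nearly a multiple of the weight
  \<open>h i = (\<Sum>j. norm (\<phi> j i))\<close>. The number \<open>k\<close> of groups does not depend on the dimension \<open>n\<close>.
\<close>

lemma exists_block_projection:
  fixes L \<epsilon> :: real and m :: nat
  assumes pq: "conjugate_exponents p q" and "0 \<le> L" "0 < \<epsilon>"
  shows "\<exists>k::nat. \<forall>(n::nat) (\<phi> :: nat \<Rightarrow> nat \<Rightarrow> 'k::real_or_complex).
    (\<forall>j<m. lps q {..<n} (\<phi> j) \<le> L) \<longrightarrow>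
    (\<exists>\<alpha> \<gamma>. (\<forall>v. lps p {..<k} (\<lambda>l. \<Sum>i<n. \<alpha> l i * v i) \<le> lps p {..<n} v) \<and>
      (\<forall>t. lps p {..<n} (\<lambda>i. \<Sum>l<k. t l * \<gamma> l i) \<le> lps p {..<k} t) \<and>
      (\<forall>v. \<forall>j<m. norm (\<Sum>i<n. \<phi> j i * (v i - (\<Sum>l<k. (\<Sum>i'<n. \<alpha> l i' * v i') * \<gamma> l i)))
         \<le> \<epsilon> * lps p {..<n} v))"
proof -
  note D = conjugate_exponentsD[OF pq]
  \<comment> \<open>The mesh of the net of directions. The final error is
    \<open>\<delta> * (m * L) * 2\<close>: Hoelder gives \<open>L\<close> for each of the
    \<open>m\<close> functionals, and the factor 2 is for \<open>v\<close> and its projection. The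
    added 1 avoids division by 0.\<close>
  define \<delta> where "\<delta> = \<epsilon> / (2 * (real m * L + 1))"
  have \<delta>: "0 < \<delta>" unfolding \<delta>_def using assms by (intro divide_pos_pos mult_pos_pos add_nonneg_pos) auto
  have \<delta>': "\<delta> * (real m * L) * 2 \<le> \<epsilon>"
  proof -
    have "0 < real m * L + 1" using assms by (intro add_nonneg_pos) auto
    then have "\<delta> * (real m * L + 1) * 2 = \<epsilon>" unfolding \<delta>_def by (simp add: field_simps)
    then show ?thesis using \<delta> by (simp add: algebra_simps)
  qed
  obtain N where N: "finite N" "cball (0::'k) 1 \<subseteq> (\<Union>x\<in>N. ball x \<delta>)"
  proof -
    have "\<forall>e>0. \<exists>k. finite k \<and> cball (0::'k) 1 \<subseteq> (\<Union>x\<in>k. ball x e)"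
      using compact_scalar_cball[of 1] unfolding compact_eq_totally_bounded by blast
    then show ?thesis using \<delta> that by blast
  qed
  then obtain rd where rd: "\<And>z::'k. norm z \<le> 1 \<Longrightarrow> rd z \<in> N \<and> norm (z - rd z) < \<delta>"
  proof -
    have "\<exists>x. norm z \<le> 1 \<longrightarrow> x \<in> N \<and> norm (z - x) < \<delta>" for z :: 'k
      using N(2) by (cases "norm z \<le> 1") (auto simp: dist_norm norm_minus_commute[of z] subset_iff)
    then show ?thesis using that by metis
  qed
  \<comment> \<open>One group for each \<open>m\<close>-tuple of net points, hence a number of
    groups that is fixed before \<open>n\<close> and \<open>\<phi>\<close>.\<close>
  define I where "I = PiE {..<m} (\<lambda>_. N)"
  have "finite I" using N by (simp add: I_def finite_PiE)
  then obtain b where b: "bij_betw b I {..<card I}"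
    using ex_bij_betw_finite_nat[of I] by (auto simp: atLeast0LessThan)
  define k where "k = card I"
  show ?thesis
  proof (intro exI[of _ k] allI impI)
    fix n :: nat and \<phi> :: "nat \<Rightarrow> nat \<Rightarrow> 'k"
    assume \<phi>: "\<forall>j<m. lps q {..<n} (\<phi> j) \<le> L"
    define h where "h i = (\<Sum>j<m. norm (\<phi> j i))" for i
    have h0: "0 \<le> h i" for i by (simp add: h_def sum_nonneg)
    have h_ge: "norm (\<phi> j i) \<le> h i" if "j < m" for i j
      unfolding h_def using that by (intro member_le_sum) auto
    have dir: "norm (\<phi> j i / of_real (h i)) \<le> 1" if "j < m" for i j
      using h_ge[OF that, of i] h0[of i] by (cases "h i = 0") (auto simp: norm_divide)
    define \<tau> where "\<tau> i = (\<lambda>j\<in>{..<m}. rd (\<phi> j i / of_real (h i)))" for i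
    have \<tau>I: "\<tau> i \<in> I" for i using rd dir by (auto simp: \<tau>_def I_def)
    define \<beta> where "\<beta> i = b (\<tau> i)" for i
    have \<beta>k: "\<beta> i < k" for i using \<tau>I bij_betwE[OF b] by (auto simp: \<beta>_def k_def)
    define \<theta> where "\<theta> j l = inv_into I b l j" for j l
    have close: "norm (\<phi> j i - of_real (h i) * \<theta> j (\<beta> i)) \<le> \<delta> * h i" if "j < m" for i j
    proof (cases "h i = 0")
      case True
      then show ?thesis using h_ge[OF that, of i] by simp
    next
      case False
      have "inv_into I b (\<beta> i) = \<tau> i"
        unfolding \<beta>_def using \<tau>I bij_betw_imp_inj_on[OF b] by (intro inv_into_f_f) auto
      then have th: "\<theta> j (\<beta> i) = rd (\<phi> j i / of_real (h i))"
        using that by (simp add: \<theta>_def \<tau>_def)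
      have "\<phi> j i - of_real (h i) * \<theta> j (\<beta> i) = of_real (h i) * (\<phi> j i / of_real (h i) - \<theta> j (\<beta> i))"
        using False by (simp add: right_diff_distrib)
      then have "norm (\<phi> j i - of_real (h i) * \<theta> j (\<beta> i)) = h i * norm (\<phi> j i / of_real (h i) - \<theta> j (\<beta> i))"
        using h0[of i] by (simp add: norm_mult)
      also have "\<dots> \<le> h i * \<delta>"
        using rd[OF dir[OF that, of i]] h0[of i] unfolding th by (intro mult_left_mono) auto
      finally show ?thesis by (simp add: mult.commute)
    qed
    define S where "S l = {i\<in>{..<n}. \<beta> i = l}" for l
    \<comment> \<open>On each block \<open>\<psi>\<close> is \<open>H\<close> normalised in the dual
      norm, and \<open>G l\<close> norms \<open>H\<close>. The rank one map that sends
      \<open>v\<close> to the pairing of \<open>\<psi>\<close> with \<open>v\<close> times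
      \<open>G l\<close> is therefore contractive and leaves the pairing with \<open>H\<close>
      unchanged.\<close>
    define H where "H i = (of_real (h i) :: 'k)" for i
    have "\<exists>v. (\<Sum>i\<in>S l. H i * v i) = of_real (lps q (S l) H) \<and> lps p (S l) v \<le> 1" for l
      by (rule exists_norming[OF pq]) (simp add: S_def)
    then obtain G where G: "\<And>l. (\<Sum>i\<in>S l. H i * G l i) = of_real (lps q (S l) H)"
      "\<And>l. lps p (S l) (G l) \<le> 1" by metis
    define g where "g i = G (\<beta> i) i" for i
    define \<psi> where "\<psi> i = H i / of_real (lps q (S (\<beta> i)) H)" for i
    have g1: "lps p (S l) g \<le> 1" for l
    proof -
      have "lps p (S l) g = lps p (S l) (G l)" by (rule lps_cong) (auto simp: S_def g_def)
      then show ?thesis using G(2) by simp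
    qed
    have \<psi>1: "lps q (S l) \<psi> \<le> 1" for l
    proof -
      have "lps q (S l) \<psi> = lps q (S l) (\<lambda>i. (1 / of_real (lps q (S l) H)) * H i)"
        by (rule lps_cong) (auto simp: S_def \<psi>_def)
      also have "\<dots> = norm (1 / of_real (lps q (S l) H) :: 'k) * lps q (S l) H"
        using D by (intro lps_mult) auto
      also have "\<dots> \<le> 1" by (simp add: norm_divide)
      finally show ?thesis .
    qed
    define \<alpha> where "\<alpha> l i = (if \<beta> i = l then \<psi> i else 0)" for l i
    define \<gamma> where "\<gamma> l i = (if \<beta> i = l then g i else 0)" for l i
    have \<alpha>_sum: "(\<Sum>i<n. \<alpha> l i * v i) = (\<Sum>i\<in>S l. \<psi> i * v i)" for l v
    proof -
      have "(\<Sum>i<n. \<alpha> l i * v i) = (\<Sum>i<n. if \<beta> i = l then \<psi> i * v i else 0)"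
        by (intro sum.cong) (auto simp: \<alpha>_def)
      also have "\<dots> = (\<Sum>i\<in>S l. \<psi> i * v i)" unfolding S_def by (rule sum.inter_filter[symmetric]) simp
      finally show ?thesis .
    qed
    have \<gamma>_sum: "(\<Sum>l<k. t l * \<gamma> l i) = t (\<beta> i) * g i" for t i
    proof -
      have "(\<Sum>l<k. t l * \<gamma> l i) = (\<Sum>l<k. if l = \<beta> i then t (\<beta> i) * g i else 0)"
        by (intro sum.cong) (auto simp: \<gamma>_def)
      then show ?thesis using \<beta>k[of i] by simp
    qed
    have c1: "lps p {..<k} (\<lambda>l. \<Sum>i<n. \<alpha> l i * v i) \<le> lps p {..<n} v" for v
      unfolding \<alpha>_sum S_def
      by (rule lps_block_functionals[OF pq]) (use \<beta>k \<psi>1 in \<open>auto simp: S_def\<close>)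
    have c2: "lps p {..<n} (\<lambda>i. \<Sum>l<k. t l * \<gamma> l i) \<le> lps p {..<k} t" for t
      unfolding \<gamma>_sum
      by (rule lps_block_vectors) (use \<beta>k g1 D in \<open>auto simp: S_def\<close>)
    have c3: "norm (\<Sum>i<n. \<phi> j i * (v i - (\<Sum>l<k. (\<Sum>i'<n. \<alpha> l i' * v i') * \<gamma> l i)))
         \<le> \<epsilon> * lps p {..<n} v" if j: "j < m" for v j
    proof -
      define E where "E i = (\<Sum>l<k. (\<Sum>i'<n. \<alpha> l i' * v i') * \<gamma> l i)" for i
      define w where "w i = v i - E i" for i
      have E: "E i = (\<Sum>i'\<in>S (\<beta> i). \<psi> i' * v i') * g i" for i
        unfolding E_def \<alpha>_sum by (rule \<gamma>_sum)
      have E_le: "lps p {..<n} E \<le> lps p {..<n} v"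
        unfolding E_def using order_trans[OF c2 c1] .
      \<comment> \<open>On a block where the dual norm \<open>s\<close> is 0, \<open>H\<close>
        vanishes and division by 0 makes \<open>\<psi>\<close> vanish too, so the identity
        \<open>\<psi> i * s = H i\<close> holds there as well.\<close>
      have block0: "(\<Sum>i\<in>S l. H i * w i) = 0" for l
      proof -
        define s where "s = lps q (S l) H"
        have "(\<Sum>i\<in>S l. H i * E i) = (\<Sum>i\<in>S l. (\<Sum>i'\<in>S l. \<psi> i' * v i') * (H i * G l i))"
          by (intro sum.cong refl) (auto simp: E S_def g_def)
        also have "\<dots> = (\<Sum>i'\<in>S l. \<psi> i' * v i') * of_real s"
          using G(1)[of l] by (simp only: s_def flip: sum_distrib_left)
        also have "\<dots> = (\<Sum>i\<in>S l. \<psi> i * of_real s * v i)"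
          unfolding sum_distrib_right by (simp add: mult_ac)
        also have "\<dots> = (\<Sum>i\<in>S l. H i * v i)"
        proof (intro sum.cong refl)
          fix i assume i: "i \<in> S l"
          have "H i = 0" if "s = 0"
            using lps_eq_0D[of q "S l" H i] that i D by (simp add: s_def S_def)
          then have "\<psi> i * of_real s = H i" using i by (auto simp: \<psi>_def s_def S_def)
          then show "\<psi> i * of_real s * v i = H i * v i" by simp
        qed
        finally show ?thesis by (simp add: w_def right_diff_distrib sum_subtractf)
      qed
      \<comment> \<open>The direction \<open>\<theta> j\<close> is constant on blocks, so the main
        part of \<open>\<phi> j\<close> pairs to 0 with \<open>w\<close>; only the rounding error of
        the directions remains.\<close>
      have "(\<Sum>i<n. H i * \<theta> j (\<beta> i) * w i) = (\<Sum>l<k. \<Sum>i\<in>{i\<in>{..<n}. \<beta> i = l}. H i * \<theta> j (\<beta> i) * w i)"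
        by (rule sum.group[symmetric]) (use \<beta>k in auto)
      also have "\<dots> = (\<Sum>l<k. \<theta> j l * (\<Sum>i\<in>S l. H i * w i))"
        unfolding sum_distrib_left S_def by (intro sum.cong refl) auto
      also have "\<dots> = 0" by (simp add: block0)
      finally have z: "(\<Sum>i<n. H i * \<theta> j (\<beta> i) * w i) = 0" .
      have "(\<Sum>i<n. \<phi> j i * w i) = (\<Sum>i<n. (\<phi> j i - H i * \<theta> j (\<beta> i)) * w i)"
        using z by (simp add: left_diff_distrib sum_subtractf)
      then have "norm (\<Sum>i<n. \<phi> j i * w i) \<le> (\<Sum>i<n. norm ((\<phi> j i - H i * \<theta> j (\<beta> i)) * w i))"
        by (simp add: norm_sum)
      also have "\<dots> \<le> (\<Sum>i<n. \<delta> * h i * (norm (v i) + norm (E i)))"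
        unfolding norm_mult w_def H_def using close[OF j] \<delta> h0
        by (intro sum_mono mult_mono) (auto intro: norm_triangle_ineq4)
      also have "\<dots> = \<delta> * (\<Sum>j<m. (\<Sum>i<n. norm (\<phi> j i) * norm (v i)) + (\<Sum>i<n. norm (\<phi> j i) * norm (E i)))"
      proof -
        have "(\<Sum>i<n. h i * x i) = (\<Sum>j<m. \<Sum>i<n. norm (\<phi> j i) * x i)" for x
          unfolding h_def sum_distrib_right by (rule sum.swap)
        then show ?thesis
          by (simp add: distrib_left sum.distrib mult.assoc flip: sum_distrib_left)
      qed
      also have "\<dots> \<le> \<delta> * (\<Sum>j<m. L * lps p {..<n} v + L * lps p {..<n} v)"
      proof -
        have "(\<Sum>i<n. norm (\<phi> j i) * norm (x i)) \<le> L * lps p {..<n} v"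
          if "j < m" "lps p {..<n} x \<le> lps p {..<n} v" for x j
        proof -
          have "(\<Sum>i<n. norm (\<phi> j i) * norm (x i)) \<le> lps q {..<n} (\<phi> j) * lps p {..<n} x"
            by (rule holder_sum[OF pq]) simp
          also have "\<dots> \<le> L * lps p {..<n} v" using \<phi> that \<open>0 \<le> L\<close> by (intro mult_mono) auto
          finally show ?thesis .
        qed
        then show ?thesis using \<delta> E_le by (intro mult_left_mono sum_mono add_mono) auto
      qed
      also have "\<dots> = (\<delta> * (real m * L) * 2) * lps p {..<n} v" by simp
      also have "\<dots> \<le> \<epsilon> * lps p {..<n} v" using \<delta>' by (intro mult_right_mono) auto
      finally show ?thesis unfolding w_def E_def .
    qed
    show "\<exists>\<alpha> \<gamma>. (\<forall>v. lps p {..<k} (\<lambda>l. \<Sum>i<n. \<alpha> l i * v i) \<le> lps p {..<n} v) \<and>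
      (\<forall>t. lps p {..<n} (\<lambda>i. \<Sum>l<k. t l * \<gamma> l i) \<le> lps p {..<k} t) \<and>
      (\<forall>v. \<forall>j<m. norm (\<Sum>i<n. \<phi> j i * (v i - (\<Sum>l<k. (\<Sum>i'<n. \<alpha> l i' * v i') * \<gamma> l i)))
         \<le> \<epsilon> * lps p {..<n} v)"
      using c1 c2 c3 by blast
  qed
qed

section \<open>Disjointification in \<open>\<ell>\<^sub>p\<^sup>n\<close>\<close>

lemma power_mean:
  fixes y :: "'i \<Rightarrow> real"
  assumes "finite S" "S \<noteq> {}" "1 < r" and y: "\<And>i. i \<in> S \<Longrightarrow> 0 \<le> y i"
  shows "(\<Sum>i\<in>S. y i) powr r \<le> real (card S) powr (r - 1) * (\<Sum>i\<in>S. y i powr r)"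
proof -
  obtain r' where rr: "conjugate_exponents r r'" using exists_conjugate_exponent \<open>1 < r\<close> by blast
  have r': "1 < r'" and e: "r / r' = r - 1"
    using rr \<open>1 < r\<close> by (auto simp: conjugate_exponents_def field_simps)
  have "(\<Sum>i\<in>S. y i) = (\<Sum>i\<in>S. norm (1::real) * norm (y i))"
    using y by (intro sum.cong) auto
  also have "\<dots> \<le> lps r' S (\<lambda>_. 1::real) * lps r S y"
    by (rule holder_sum[OF rr \<open>finite S\<close>])
  finally have "(\<Sum>i\<in>S. y i) powr r \<le> (lps r' S (\<lambda>_. 1::real) * lps r S y) powr r"
    using \<open>1 < r\<close> y by (intro powr_mono2) (auto intro: sum_nonneg)
  also have "\<dots> = real (card S) powr (r - 1) * (\<Sum>i\<in>S. norm (y i) powr r)"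
    using \<open>1 < r\<close> r' by (simp add: powr_mult lps_powr) (simp add: lps_def powr_powr e)
  also have "(\<Sum>i\<in>S. norm (y i) powr r) = (\<Sum>i\<in>S. y i powr r)"
    using y by (intro sum.cong) auto
  finally show ?thesis .
qed

definition signed :: "nat set \<Rightarrow> nat \<Rightarrow> 'k::real_normed_field"
  where "signed A i = (if i \<in> A then 1 else - 1)"

lemma norm_signed [simp]: "norm (signed A i) = 1"
  by (simp add: signed_def)

text \<open>Splitting off the last sign pairs \<open>A\<close> with \<open>insert m A\<close>; the
  parallelogram identity removes the cross terms.\<close>

lemma sum_Pow_signed:
  fixes a :: "nat \<Rightarrow> 'k::real_or_complex"
  shows "(\<Sum>A\<in>Pow {..<m}. (norm (\<Sum>i<m. signed A i * a i))\<^sup>2) = 2 ^ m * (\<Sum>i<m. (norm (a i))\<^sup>2)"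
proof (induction m)
  case 0
  show ?case by simp
next
  case (Suc m)
  let ?s = "\<lambda>A. \<Sum>i<m. signed A i * a i"
  have Pow: "Pow {..<Suc m} = Pow {..<m} \<union> insert m ` Pow {..<m}"
    by (simp add: lessThan_Suc Pow_insert)
  have disj: "Pow {..<m} \<inter> insert m ` Pow {..<m} = {}" by auto
  have inj: "inj_on (insert m) (Pow {..<m})"
    by (intro inj_onI) (metis PowD insert_ident lessThan_iff less_irrefl subsetD)
  have ins: "(\<Sum>i<Suc m. signed (insert m A) i * a i) = ?s A + a m" for A
    by (auto simp: signed_def intro: sum.cong)
  have notin: "(\<Sum>i<Suc m. signed A i * a i) = ?s A - a m" if "A \<in> Pow {..<m}" for A
    using that by (auto simp: signed_def)
  have "(\<Sum>A\<in>Pow {..<Suc m}. (norm (\<Sum>i<Suc m. signed A i * a i))\<^sup>2)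
    = (\<Sum>A\<in>Pow {..<m}. (norm (\<Sum>i<Suc m. signed A i * a i))\<^sup>2)
    + (\<Sum>A\<in>Pow {..<m}. (norm (\<Sum>i<Suc m. signed (insert m A) i * a i))\<^sup>2)"
    unfolding Pow using disj by (subst sum.union_disjoint) (auto simp: sum.reindex[OF inj])
  also have "\<dots> = (\<Sum>A\<in>Pow {..<m}. (norm (?s A - a m))\<^sup>2 + (norm (?s A + a m))\<^sup>2)"
    unfolding ins sum.distrib using notin by simp
  also have "\<dots> = (\<Sum>A\<in>Pow {..<m}. 2 * (norm (?s A))\<^sup>2 + 2 * (norm (a m))\<^sup>2)"
    by (intro sum.cong refl, subst add.commute, rule norm_parallelogram)
  also have "\<dots> = 2 ^ Suc m * (\<Sum>i<Suc m. (norm (a i))\<^sup>2)"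
    using Suc.IH by (simp add: sum.distrib card_Pow algebra_simps flip: sum_distrib_left)
  finally show ?case .
qed

text \<open>One half of Khintchine's inequality, with constant 1: for \<open>p > 2\<close> the
  \<open>p\<close>-th moment dominates the second one by convexity.\<close>

lemma sum_powr_signed_ge:
  fixes a :: "nat \<Rightarrow> 'k::real_or_complex"
  assumes "2 < p"
  shows "2 ^ m * (\<Sum>i<m. (norm (a i))\<^sup>2) powr (p / 2)
    \<le> (\<Sum>A\<in>Pow {..<m}. norm (\<Sum>i<m. signed A i * a i) powr p)"
proof -
  let ?W = "\<Sum>i<m. (norm (a i))\<^sup>2"
  let ?N = "2 ^ m :: real"
  have W: "0 \<le> ?W" by (simp add: sum_nonneg)
  have "(?N * ?W) powr (p / 2) \<le> real (card (Pow {..<m})) powr (p / 2 - 1) *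
      (\<Sum>A\<in>Pow {..<m}. ((norm (\<Sum>i<m. signed A i * a i))\<^sup>2) powr (p / 2))"
    unfolding sum_Pow_signed[symmetric] using assms by (intro power_mean) auto
  also have "\<dots> = ?N powr (p / 2 - 1) * (\<Sum>A\<in>Pow {..<m}. norm (\<Sum>i<m. signed A i * a i) powr p)"
    by (simp add: card_Pow powr_powr flip: powr_numeral)
  finally have "?N powr (p / 2 - 1) * (?N * ?W powr (p / 2)) \<le>
      ?N powr (p / 2 - 1) * (\<Sum>A\<in>Pow {..<m}. norm (\<Sum>i<m. signed A i * a i) powr p)"
    using W by (simp add: powr_mult powr_diff)
  then show ?thesis by simp
qed

text \<open>The opposite half for \<open>p < 2\<close>: the second moment dominates, by
  \<open>power_mean\<close> with exponent \<open>2 / p\<close>.\<close>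

lemma sum_powr_signed_le:
  fixes a :: "nat \<Rightarrow> 'k::real_or_complex"
  assumes "0 < p" "p < 2"
  shows "(\<Sum>A\<in>Pow {..<m}. norm (\<Sum>i<m. signed A i * a i) powr p)
    \<le> 2 ^ m * (\<Sum>i<m. (norm (a i))\<^sup>2) powr (p / 2)"
proof -
  let ?W = "\<Sum>i<m. (norm (a i))\<^sup>2"
  let ?N = "2 ^ m :: real"
  let ?X = "\<Sum>A\<in>Pow {..<m}. norm (\<Sum>i<m. signed A i * a i) powr p"
  have W: "0 \<le> ?W" and X: "0 \<le> ?X" by (simp_all add: sum_nonneg)
  have "?X powr (2 / p) \<le> real (card (Pow {..<m})) powr (2 / p - 1) *
      (\<Sum>A\<in>Pow {..<m}. (norm (\<Sum>i<m. signed A i * a i) powr p) powr (2 / p))"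
    using assms by (intro power_mean) auto
  also have "\<dots> = ?N powr (2 / p - 1) * (\<Sum>A\<in>Pow {..<m}. (norm (\<Sum>i<m. signed A i * a i))\<^sup>2)"
    using assms by (simp add: card_Pow powr_powr)
  also have "\<dots> = ?N powr (2 / p) * ?W"
    unfolding sum_Pow_signed by (simp add: powr_diff)
  finally have "(?X powr (2 / p)) powr (p / 2) \<le> (?N powr (2 / p) * ?W) powr (p / 2)"
    using assms by (intro powr_mono2) auto
  then show ?thesis using assms W X by (simp add: powr_powr powr_mult)
qed

lemma lps_const:
  assumes "\<And>i. i < m \<Longrightarrow> norm (t i) = 1" "0 < p"
  shows "lps p {..<m} t powr p = real m"
  using assms by (simp add: lps_powr)

text \<open>
  Averaging over signs compares the square function \<open>W = (\<Sum>i. |u i|\<^sup>2)\<close> with \<open>Q = (\<Sum>i. |u i|\<^sup>p)\<close>: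
  \<open>(\<Sum>s. Q)\<close> is comparable to \<open>m\<close>, and \<open>(\<Sum>s. W\<^sup>p\<^sup>/\<^sup>2)\<close> is at most (if \<open>2 < p\<close>) or at least
  (if \<open>p < 2\<close>) a constant times \<open>m\<close>. Where \<open>M\<close> is small relative to \<open>W\<close> or \<open>Q\<close>, respectively, the
  integrand with the lower bound is a small multiple of the other one.
\<close>

lemma max_function_large:
  fixes p D :: real
  assumes "1 < p" "p \<noteq> 2" "1 \<le> D"
  shows "\<exists>c>0. \<forall>(m::nat) (n::nat) (u :: nat \<Rightarrow> nat \<Rightarrow> 'k::real_or_complex) M.
    (\<forall>t. lps p {..<m} t \<le> D * lps p {..<n} (\<lambda>s. \<Sum>i<m. t i * u i s)) \<longrightarrow>
    (\<forall>t. lps p {..<n} (\<lambda>s. \<Sum>i<m. t i * u i s) \<le> D * lps p {..<m} t) \<longrightarrow>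
    (\<forall>i<m. \<forall>s<n. norm (u i s) \<le> M s) \<longrightarrow>
    c * real m \<le> (\<Sum>s<n. M s powr p)"
proof -
  \<comment> \<open>The two-sided estimate tested on unit vectors controls the sum of the
    \<open>Q s\<close>. Tested on sign vectors, the \<open>p\<close>-th power of whose norm is
    \<open>m\<close>, it controls the averaged signed sums.\<close>
  have moments: "real m / D powr p \<le> (\<Sum>s<n. \<Sum>i<m. norm (u i s) powr p)"
    "(\<Sum>s<n. \<Sum>i<m. norm (u i s) powr p) \<le> D powr p * real m"
    "2 ^ m * (real m / D powr p) \<le> (\<Sum>s<n. \<Sum>A\<in>Pow {..<m}. norm (\<Sum>i<m. signed A i * u i s) powr p)"
    "(\<Sum>s<n. \<Sum>A\<in>Pow {..<m}. norm (\<Sum>i<m. signed A i * u i s) powr p) \<le> 2 ^ m * (D powr p * real m)"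
    if lower: "\<forall>t. lps p {..<m} t \<le> D * lps p {..<n} (\<lambda>s. \<Sum>i<m. t i * u i s)"
      and upper: "\<forall>t. lps p {..<n} (\<lambda>s. \<Sum>i<m. t i * u i s) \<le> D * lps p {..<m} t"
    for m n :: nat and u :: "nat \<Rightarrow> nat \<Rightarrow> 'k"
  proof -
    have lo: "lps p {..<m} t powr p / D powr p \<le> (\<Sum>s<n. norm (\<Sum>i<m. t i * u i s) powr p)" for t
    proof -
      have "lps p {..<m} t powr p \<le> (D * lps p {..<n} (\<lambda>s. \<Sum>i<m. t i * u i s)) powr p"
        using lower assms by (intro powr_mono2) auto
      also have "\<dots> = D powr p * (\<Sum>s<n. norm (\<Sum>i<m. t i * u i s) powr p)"
        using assms by (simp add: powr_mult lps_powr)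
      finally show ?thesis using assms by (simp add: field_simps)
    qed
    have up: "(\<Sum>s<n. norm (\<Sum>i<m. t i * u i s) powr p) \<le> D powr p * lps p {..<m} t powr p" for t
    proof -
      have "lps p {..<n} (\<lambda>s. \<Sum>i<m. t i * u i s) powr p \<le> (D * lps p {..<m} t) powr p"
        using upper assms by (intro powr_mono2) auto
      then show ?thesis using assms by (simp add: powr_mult lps_powr)
    qed
    have unit: "(\<Sum>j<m. (if j = i then 1 else 0) * u j s) = u i s" if "i < m" for i s
      using that by (simp add: if_distrib[of "\<lambda>x. x * _"] cong: if_cong)
    have unit': "lps p {..<m} (\<lambda>j. if j = i then 1 else (0::'k)) = 1" if "i < m" for i
      using lps_unit[of "{..<m}" i p "1::'k"] that assms by simp
    have swap: "(\<Sum>s<n. \<Sum>i<m. norm (u i s) powr p) = (\<Sum>i<m. \<Sum>s<n. norm (u i s) powr p)"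
      by (rule sum.swap)
    have "(\<Sum>i<m. 1 / D powr p) \<le> (\<Sum>i<m. \<Sum>s<n. norm (u i s) powr p)"
    proof (rule sum_mono)
      fix i assume "i \<in> {..<m}"
      then have i: "i < m" by simp
      show "1 / D powr p \<le> (\<Sum>s<n. norm (u i s) powr p)"
        using lo[of "\<lambda>j. if j = i then 1 else 0"] unfolding unit[OF i] unit'[OF i] by simp
    qed
    then show "real m / D powr p \<le> (\<Sum>s<n. \<Sum>i<m. norm (u i s) powr p)" unfolding swap by simp
    have "(\<Sum>i<m. \<Sum>s<n. norm (u i s) powr p) \<le> (\<Sum>i<m. D powr p)"
    proof (rule sum_mono)
      fix i assume "i \<in> {..<m}"
      then have i: "i < m" by simp
      show "(\<Sum>s<n. norm (u i s) powr p) \<le> D powr p"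
        using up[of "\<lambda>j. if j = i then 1 else 0"] unfolding unit[OF i] unit'[OF i] by simp
    qed
    then show "(\<Sum>s<n. \<Sum>i<m. norm (u i s) powr p) \<le> D powr p * real m"
      unfolding swap by (simp add: mult.commute)
    have c: "lps p {..<m} (signed A :: nat \<Rightarrow> 'k) powr p = real m" for A
      using assms by (intro lps_const) auto
    have swap': "(\<Sum>s<n. \<Sum>A\<in>Pow {..<m}. norm (\<Sum>i<m. signed A i * u i s) powr p) =
        (\<Sum>A\<in>Pow {..<m}. \<Sum>s<n. norm (\<Sum>i<m. signed A i * u i s) powr p)"
      by (rule sum.swap)
    have "(\<Sum>A\<in>Pow {..<m}. real m / D powr p) \<le>
        (\<Sum>A\<in>Pow {..<m}. \<Sum>s<n. norm (\<Sum>i<m. signed A i * u i s) powr p)"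
    proof (rule sum_mono)
      fix A assume "A \<in> Pow {..<m}"
      show "real m / D powr p \<le> (\<Sum>s<n. norm (\<Sum>i<m. signed A i * u i s) powr p)"
        using lo[of "signed A"] unfolding c .
    qed
    then show "2 ^ m * (real m / D powr p) \<le> (\<Sum>s<n. \<Sum>A\<in>Pow {..<m}. norm (\<Sum>i<m. signed A i * u i s) powr p)"
      unfolding swap' by (simp add: card_Pow)
    have "(\<Sum>A\<in>Pow {..<m}. \<Sum>s<n. norm (\<Sum>i<m. signed A i * u i s) powr p) \<le>
        (\<Sum>A\<in>Pow {..<m}. D powr p * real m)"
    proof (rule sum_mono)
      fix A assume "A \<in> Pow {..<m}"
      show "(\<Sum>s<n. norm (\<Sum>i<m. signed A i * u i s) powr p) \<le> D powr p * real m"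
        using up[of "signed A"] unfolding c .
    qed
    then show "(\<Sum>s<n. \<Sum>A\<in>Pow {..<m}. norm (\<Sum>i<m. signed A i * u i s) powr p) \<le> 2 ^ m * (D powr p * real m)"
      unfolding swap' by (simp add: card_Pow)
  qed
  define d where "d = D powr p"
  have d: "1 \<le> d" unfolding d_def using assms by (simp add: ge_one_powr_ge_zero)
  \<comment> \<open>With \<open>\<kappa> * d = 1 / (2 * d)\<close>, the term to be absorbed costs
    exactly half of the lower bound \<open>m / d\<close>.\<close>
  define \<kappa> where "\<kappa> = 1 / (2 * d * d)"
  have \<kappa>: "0 < \<kappa>" "\<kappa> * d = 1 / (2 * d)" using d by (auto simp: \<kappa>_def)
  show ?thesis
  proof (cases "2 < p")
    case True
    \<comment> \<open>The threshold for comparing \<open>M s\<close> with \<open>sqrt (W s)\<close>: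
      below \<open>\<tau> * sqrt (W s)\<close>, the factor \<open>M s powr (p - 2)\<close> is at
      most \<open>\<kappa> * W s powr (p / 2 - 1)\<close>.\<close>
    define \<tau> where "\<tau> = \<kappa> powr (1 / (p - 2))"
    have \<tau>: "0 < \<tau>" "\<tau> powr (p - 2) = \<kappa>" using True \<kappa> by (auto simp: \<tau>_def powr_powr)
    show ?thesis
    proof (intro exI[of _ "\<tau>\<^sup>2 / (2 * d)"] conjI allI impI)
      show "0 < \<tau>\<^sup>2 / (2 * d)" using \<tau> d by simp
      fix m n :: nat and u :: "nat \<Rightarrow> nat \<Rightarrow> 'k" and M
      assume *: "\<forall>t. lps p {..<m} t \<le> D * lps p {..<n} (\<lambda>s. \<Sum>i<m. t i * u i s)"
        "\<forall>t. lps p {..<n} (\<lambda>s. \<Sum>i<m. t i * u i s) \<le> D * lps p {..<m} t"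
        and M: "\<forall>i<m. \<forall>s<n. norm (u i s) \<le> M s"
      define W where "W s = (\<Sum>i<m. (norm (u i s))\<^sup>2)" for s
      define Q where "Q s = (\<Sum>i<m. norm (u i s) powr p)" for s
      have W0: "0 \<le> W s" for s by (simp add: W_def sum_nonneg)
      have pt: "Q s \<le> M s powr p / \<tau>\<^sup>2 + \<kappa> * W s powr (p / 2)" if "s < n" for s
      proof (cases "m = 0")
        case True
        then show ?thesis using \<kappa> by (simp add: Q_def W_def)
      next
        case False
        then have M0: "0 \<le> M s" using M that norm_ge_zero order_trans by (metis gr0I)
        have "Q s \<le> (\<Sum>i<m. M s powr (p - 2) * (norm (u i s))\<^sup>2)"
          unfolding Q_def
        proof (intro sum_mono)
          fix i assume "i \<in> {..<m}"
          then have "norm (u i s) powr (p - 2) \<le> M s powr (p - 2)"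
            using M that True by (intro powr_mono2) auto
          then have "norm (u i s) powr (p - 2) * (norm (u i s))\<^sup>2 \<le> M s powr (p - 2) * (norm (u i s))\<^sup>2"
            by (intro mult_right_mono) auto
          moreover have "norm (u i s) powr (p - 2) * (norm (u i s))\<^sup>2 = norm (u i s) powr p"
            by (cases "u i s = 0") (auto simp: powr_diff)
          ultimately show "norm (u i s) powr p \<le> M s powr (p - 2) * (norm (u i s))\<^sup>2" by simp
        qed
        also have "\<dots> = M s powr (p - 2) * W s" by (simp add: W_def sum_distrib_left)
        also have "\<dots> \<le> M s powr p / \<tau>\<^sup>2 + \<kappa> * W s powr (p / 2)"
        proof (cases "\<tau> * sqrt (W s) \<le> M s")
          case True
          then have "(\<tau> * sqrt (W s))\<^sup>2 \<le> (M s)\<^sup>2" using \<tau> W0 by (intro power_mono) auto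
          then have "W s \<le> (M s)\<^sup>2 / \<tau>\<^sup>2" using \<tau> W0 by (simp add: power_mult_distrib field_simps)
          then have "M s powr (p - 2) * W s \<le> M s powr (p - 2) * ((M s)\<^sup>2 / \<tau>\<^sup>2)"
            by (intro mult_left_mono) auto
          also have "\<dots> = M s powr p / \<tau>\<^sup>2"
            using M0 by (cases "M s = 0") (auto simp: powr_diff)
          finally show ?thesis using \<kappa> by (smt (verit) mult_nonneg_nonneg powr_ge_zero)
        next
          case False
          then have "M s powr (p - 2) \<le> (\<tau> * sqrt (W s)) powr (p - 2)"
            using M0 \<open>2 < p\<close> by (intro powr_mono2) auto
          also have "\<dots> = \<kappa> * W s powr (p / 2 - 1)"
            using \<tau> W0 by (simp add: powr_mult powr_powr diff_divide_distrib flip: powr_half_sqrt)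
          finally have "M s powr (p - 2) * W s \<le> \<kappa> * W s powr (p / 2 - 1) * W s"
            using W0 by (intro mult_right_mono) auto
          also have "\<dots> = \<kappa> * W s powr (p / 2)"
            using W0[of s] by (cases "W s = 0") (auto simp: powr_diff)
          finally show ?thesis using \<tau> by (smt (verit) divide_nonneg_nonneg powr_ge_zero zero_le_power2)
        qed
        finally show ?thesis .
      qed
      have "2 ^ m * (\<Sum>s<n. W s powr (p / 2)) \<le> 2 ^ m * (d * real m)"
      proof -
        have "2 ^ m * (\<Sum>s<n. W s powr (p / 2)) \<le> (\<Sum>s<n. \<Sum>A\<in>Pow {..<m}. norm (\<Sum>i<m. signed A i * u i s) powr p)"
          unfolding sum_distrib_left W_def using True by (intro sum_mono sum_powr_signed_ge)
        also have "\<dots> \<le> 2 ^ m * (d * real m)" using moments(4)[OF *] by (simp add: d_def)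
        finally show ?thesis .
      qed
      then have Wle: "(\<Sum>s<n. W s powr (p / 2)) \<le> d * real m" by simp
      have "real m / d \<le> (\<Sum>s<n. Q s)" using moments(1)[OF *] by (simp add: Q_def d_def)
      also have "\<dots> \<le> (\<Sum>s<n. M s powr p / \<tau>\<^sup>2 + \<kappa> * W s powr (p / 2))" using pt by (intro sum_mono) auto
      also have "\<dots> = (\<Sum>s<n. M s powr p) / \<tau>\<^sup>2 + \<kappa> * (\<Sum>s<n. W s powr (p / 2))"
        by (simp add: sum.distrib sum_divide_distrib sum_distrib_left)
      also have "\<dots> \<le> (\<Sum>s<n. M s powr p) / \<tau>\<^sup>2 + \<kappa> * (d * real m)"
        using Wle \<kappa> by (intro add_left_mono mult_left_mono) auto
      also have "\<kappa> * (d * real m) = real m / (2 * d)" using \<kappa>(2) by (simp flip: mult.assoc)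
      finally have "real m / (2 * d) \<le> (\<Sum>s<n. M s powr p) / \<tau>\<^sup>2" using d by (simp add: field_simps)
      then show "\<tau>\<^sup>2 / (2 * d) * real m \<le> (\<Sum>s<n. M s powr p)" using \<tau> d by (simp add: field_simps)
    qed
  next
    case False
    then have p2: "p < 2" using assms by simp
    \<comment> \<open>Here \<open>W\<close> and \<open>Q\<close> exchange roles:
      \<open>W s powr (p / 2)\<close> is at most
      \<open>(M s powr p) powr (1 - p / 2) * Q s powr (p / 2)\<close>, and the threshold compares
      \<open>M s powr p\<close> with \<open>\<tau> * Q s\<close>.\<close>
    define \<tau> where "\<tau> = \<kappa> powr (1 / (1 - p / 2))"
    have \<tau>: "0 < \<tau>" "\<tau> powr (1 - p / 2) = \<kappa>" using p2 \<kappa> by (auto simp: \<tau>_def powr_powr)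
    show ?thesis
    proof (intro exI[of _ "\<tau> powr (p / 2) / (2 * d)"] conjI allI impI)
      show "0 < \<tau> powr (p / 2) / (2 * d)" using \<tau> d by simp
      fix m n :: nat and u :: "nat \<Rightarrow> nat \<Rightarrow> 'k" and M
      assume *: "\<forall>t. lps p {..<m} t \<le> D * lps p {..<n} (\<lambda>s. \<Sum>i<m. t i * u i s)"
        "\<forall>t. lps p {..<n} (\<lambda>s. \<Sum>i<m. t i * u i s) \<le> D * lps p {..<m} t"
        and M: "\<forall>i<m. \<forall>s<n. norm (u i s) \<le> M s"
      define W where "W s = (\<Sum>i<m. (norm (u i s))\<^sup>2)" for s
      define Q where "Q s = (\<Sum>i<m. norm (u i s) powr p)" for s
      have W0: "0 \<le> W s" and Q0: "0 \<le> Q s" for s by (simp_all add: W_def Q_def sum_nonneg)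
      have pt: "W s powr (p / 2) \<le> M s powr p / \<tau> powr (p / 2) + \<kappa> * Q s" if "s < n" for s
      proof (cases "m = 0")
        case True
        then show ?thesis by (simp add: Q_def W_def)
      next
        case False
        then have M0: "0 \<le> M s" using M that norm_ge_zero order_trans by (metis gr0I)
        have "W s \<le> (\<Sum>i<m. M s powr (2 - p) * norm (u i s) powr p)"
          unfolding W_def
        proof (intro sum_mono)
          fix i assume "i \<in> {..<m}"
          then have "norm (u i s) powr (2 - p) \<le> M s powr (2 - p)"
            using M that p2 by (intro powr_mono2) auto
          then have "norm (u i s) powr (2 - p) * norm (u i s) powr p \<le> M s powr (2 - p) * norm (u i s) powr p"
            by (intro mult_right_mono) auto
          moreover have "norm (u i s) powr (2 - p) * norm (u i s) powr p = (norm (u i s))\<^sup>2"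
            by (cases "u i s = 0") (auto simp: powr_diff)
          ultimately show "(norm (u i s))\<^sup>2 \<le> M s powr (2 - p) * norm (u i s) powr p" by simp
        qed
        also have "\<dots> = M s powr (2 - p) * Q s" by (simp add: Q_def sum_distrib_left)
        finally have "W s powr (p / 2) \<le> (M s powr (2 - p) * Q s) powr (p / 2)"
          using W0 assms by (intro powr_mono2) auto
        also have "\<dots> = (M s powr p) powr (1 - p / 2) * Q s powr (p / 2)"
        proof -
          have "(2 - p) * (p / 2) = p * (1 - p / 2)" by (simp add: field_simps)
          then have "(M s powr (2 - p)) powr (p / 2) = (M s powr p) powr (1 - p / 2)"
            by (simp only: powr_powr)
          then show ?thesis using Q0 by (simp only: powr_mult powr_ge_zero)
        qed
        also have "\<dots> \<le> M s powr p / \<tau> powr (p / 2) + \<kappa> * Q s"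
        proof (cases "\<tau> * Q s \<le> M s powr p")
          case True
          then have "(\<tau> * Q s) powr (p / 2) \<le> (M s powr p) powr (p / 2)"
            using \<tau> Q0 assms by (intro powr_mono2) auto
          then have "Q s powr (p / 2) \<le> (M s powr p) powr (p / 2) / \<tau> powr (p / 2)"
            using \<tau> Q0 by (simp add: powr_mult field_simps)
          then have "(M s powr p) powr (1 - p / 2) * Q s powr (p / 2)
              \<le> (M s powr p) powr (1 - p / 2) * ((M s powr p) powr (p / 2) / \<tau> powr (p / 2))"
            by (intro mult_left_mono) auto
          also have "\<dots> = M s powr p / \<tau> powr (p / 2)"
            by (simp flip: powr_add)
          finally show ?thesis using \<kappa> Q0 by (smt (verit) mult_nonneg_nonneg)
        next
          case False
          then have "(M s powr p) powr (1 - p / 2) \<le> (\<tau> * Q s) powr (1 - p / 2)"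
            using p2 by (intro powr_mono2) auto
          also have "\<dots> = \<kappa> * Q s powr (1 - p / 2)"
            using \<tau> Q0 by (simp add: powr_mult)
          finally have "(M s powr p) powr (1 - p / 2) * Q s powr (p / 2)
              \<le> \<kappa> * Q s powr (1 - p / 2) * Q s powr (p / 2)"
            by (intro mult_right_mono) auto
          also have "\<dots> = \<kappa> * Q s" using Q0[of s] by (simp add: mult.assoc flip: powr_add)
          finally show ?thesis by (smt (verit) divide_nonneg_nonneg powr_ge_zero)
        qed
        finally show ?thesis .
      qed
      have "2 ^ m * (real m / d) \<le> 2 ^ m * (\<Sum>s<n. W s powr (p / 2))"
      proof -
        have "2 ^ m * (real m / d) \<le> (\<Sum>s<n. \<Sum>A\<in>Pow {..<m}. norm (\<Sum>i<m. signed A i * u i s) powr p)"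
          using moments(3)[OF *] by (simp add: d_def)
        also have "\<dots> \<le> 2 ^ m * (\<Sum>s<n. W s powr (p / 2))"
          unfolding sum_distrib_left W_def using p2 assms by (intro sum_mono sum_powr_signed_le) auto
        finally show ?thesis .
      qed
      then have "real m / d \<le> (\<Sum>s<n. W s powr (p / 2))" by (rule mult_left_le_imp_le) simp
      also have "\<dots> \<le> (\<Sum>s<n. M s powr p / \<tau> powr (p / 2) + \<kappa> * Q s)" using pt by (intro sum_mono) auto
      also have "\<dots> = (\<Sum>s<n. M s powr p) / \<tau> powr (p / 2) + \<kappa> * (\<Sum>s<n. Q s)"
        by (simp add: sum.distrib sum_divide_distrib sum_distrib_left)
      also have "\<dots> \<le> (\<Sum>s<n. M s powr p) / \<tau> powr (p / 2) + \<kappa> * (d * real m)"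
        using moments(2)[OF *] \<kappa> by (intro add_left_mono mult_left_mono) (auto simp: Q_def d_def)
      also have "\<kappa> * (d * real m) = real m / (2 * d)" using \<kappa>(2) by (simp flip: mult.assoc)
      finally have "real m / (2 * d) \<le> (\<Sum>s<n. M s powr p) / \<tau> powr (p / 2)" using d by (simp add: field_simps)
      then show "\<tau> powr (p / 2) / (2 * d) * real m \<le> (\<Sum>s<n. M s powr p)" using \<tau> d by (simp add: field_simps)
    qed
  qed
qed

text \<open>For \<open>z \<noteq> 0\<close> the value \<open>cnj z\<close> is determined by its
  product with \<open>z\<close>; this uniqueness yields multiplicativity and involutivity from the
  norm identity.\<close>

lemma obtain_conjugation:
  obtains cnj :: "'k::real_or_complex \<Rightarrow> 'k"
  where "\<And>x y. cnj (x + y) = cnj x + cnj y" "\<And>x y. cnj (x * y) = cnj x * cnj y"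
    "\<And>z. cnj (cnj z) = z" "\<And>z. norm (cnj z) = norm z" "\<And>z. z * cnj z = of_real ((norm z)\<^sup>2)"
proof -
  obtain cnj :: "'k \<Rightarrow> 'k" where add: "\<And>x y. cnj (x + y) = cnj x + cnj y"
    and mult: "\<And>z. z * cnj z = of_real ((norm z)\<^sup>2)"
    using exists_conjugation by blast
  have zero: "cnj 0 = 0" using add[of 0 0] by simp
  have eq: "cnj z = w" if "z * w = of_real ((norm z)\<^sup>2)" "z \<noteq> 0" for z w
    using mult[of z] that by (metis mult_left_cancel)
  have norm: "norm (cnj z) = norm z" for z
  proof (cases "z = 0")
    case False
    have "norm z * norm (cnj z) = norm z * norm z"
      using mult[of z] by (metis norm_mult norm_of_real abs_power2 power2_eq_square)
    then show ?thesis using False by simp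
  qed (simp add: zero)
  have "cnj (cnj z) = z" for z
  proof (cases "z = 0")
    case False
    then have "cnj z \<noteq> 0" using norm[of z] by auto
    then show ?thesis using mult[of z] norm[of z] by (intro eq) (simp_all add: mult.commute)
  qed (simp add: zero)
  moreover have "cnj (x * y) = cnj x * cnj y" for x y
  proof (cases "x * y = 0")
    case False
    have "(x * y) * (cnj x * cnj y) = (x * cnj x) * (y * cnj y)" by (simp add: mult_ac)
    also have "\<dots> = of_real ((norm (x * y))\<^sup>2)" unfolding mult by (simp add: norm_mult power_mult_distrib)
    finally show ?thesis using False by (rule eq)
  qed (auto simp: zero)
  ultimately show ?thesis using that add mult norm by blast
qed

text \<open>For \<open>p \<noteq> 2\<close>, each coordinate \<open>s\<close> is given to an index
  \<open>i\<close> at which \<open>norm (u i s)\<close> is largest, and \<open>g i\<close> norms the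
  part of \<open>u i\<close> on the coordinates that \<open>i\<close> received. As these sets are
  disjoint, the functionals are jointly bounded, and \<open>max_function_large\<close> bounds the
  sum of the \<open>r i powr p\<close> from below. For \<open>p = 2\<close> the maxima can be
  negligible, as for an orthogonal matrix with entries of equal modulus; there the conjugate
  transpose of \<open>u\<close> serves instead.\<close>

lemma exists_disjoint_functionals:
  fixes p D :: real
  assumes pq: "conjugate_exponents p q" and "1 \<le> D"
  shows "\<exists>c>0. \<forall>(m::nat) (n::nat) (u :: nat \<Rightarrow> nat \<Rightarrow> 'k::real_or_complex).
    (\<forall>t. lps p {..<m} t \<le> D * lps p {..<n} (\<lambda>s. \<Sum>i<m. t i * u i s)) \<longrightarrow>
    (\<forall>t. lps p {..<n} (\<lambda>s. \<Sum>i<m. t i * u i s) \<le> D * lps p {..<m} t) \<longrightarrow>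
    (\<exists>g r. (\<forall>v. lps p {..<m} (\<lambda>i. \<Sum>s<n. g i s * v s) \<le> D * lps p {..<n} v) \<and>
      (\<forall>i<m. 0 \<le> r i \<and> (\<Sum>s<n. g i s * u i s) = of_real (r i)) \<and>
      c * real m \<le> (\<Sum>i<m. r i))"
proof (cases "p = 2")
  case True
  then have q2: "q = 2" using pq by (auto simp: conjugate_exponents_def field_simps)
  have pp: "conjugate_exponents p p" using pq True q2 by simp
  obtain cnj :: "'k \<Rightarrow> 'k" where cnj: "\<And>x y. cnj (x + y) = cnj x + cnj y"
    "\<And>x y. cnj (x * y) = cnj x * cnj y" "\<And>z. cnj (cnj z) = z" "\<And>z. norm (cnj z) = norm z"
    "\<And>z. z * cnj z = of_real ((norm z)\<^sup>2)"
    using obtain_conjugation by blast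
  have cnj0: "cnj 0 = 0" using cnj(1)[of 0 0] by simp
  have cnj_sum: "cnj (\<Sum>i\<in>I. f i) = (\<Sum>i\<in>I. cnj (f i))" for f and I :: "nat set"
    by (induction I rule: infinite_finite_induct) (simp_all add: cnj cnj0)
  show ?thesis
  \<comment> \<open>Testing the lower estimate on unit vectors shows that each \<open>u i\<close>
    has norm at least \<open>1 / D\<close>, and \<open>r i\<close> is the square of this
    norm.\<close>
  proof (intro exI[of _ "1 / D\<^sup>2"] conjI allI impI)
    show "0 < 1 / D\<^sup>2" using assms by simp
    fix m n :: nat and u :: "nat \<Rightarrow> nat \<Rightarrow> 'k"
    assume lower: "\<forall>t. lps p {..<m} t \<le> D * lps p {..<n} (\<lambda>s. \<Sum>i<m. t i * u i s)"
      and upper: "\<forall>t. lps p {..<n} (\<lambda>s. \<Sum>i<m. t i * u i s) \<le> D * lps p {..<m} t"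
    define r where "r i = (\<Sum>s<n. (norm (u i s))\<^sup>2)" for i
    have bound: "lps p {..<m} (\<lambda>i. \<Sum>s<n. cnj (u i s) * v s) \<le> D * lps p {..<n} v" for v
    proof (rule lps_dual_le[OF pp])
      fix w
      have nc: "norm (\<Sum>i<m. cnj (u i s) * w i) = norm (\<Sum>i<m. cnj (w i) * u i s)" for s
      proof -
        have "(\<Sum>i<m. cnj (u i s) * w i) = cnj (\<Sum>i<m. cnj (w i) * u i s)"
          by (simp add: cnj_sum cnj(2,3) mult.commute)
        then show ?thesis using cnj(4) by simp
      qed
      have "(\<Sum>i<m. (\<Sum>s<n. cnj (u i s) * v s) * w i) = (\<Sum>i<m. \<Sum>s<n. v s * (cnj (u i s) * w i))"
        unfolding sum_distrib_right by (simp add: mult_ac)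
      also have "\<dots> = (\<Sum>s<n. v s * (\<Sum>i<m. cnj (u i s) * w i))"
        unfolding sum_distrib_left by (rule sum.swap)
      finally have "norm (\<Sum>i<m. (\<Sum>s<n. cnj (u i s) * v s) * w i)
          \<le> lps p {..<n} v * lps p {..<n} (\<lambda>s. \<Sum>i<m. cnj (u i s) * w i)"
        using holder[OF pp, of "{..<n}" v] by simp
      also have "lps p {..<n} (\<lambda>s. \<Sum>i<m. cnj (u i s) * w i) = lps p {..<n} (\<lambda>s. \<Sum>i<m. cnj (w i) * u i s)"
        using nc by (rule lps_cong)
      also have "lps p {..<n} v * \<dots> \<le> lps p {..<n} v * (D * lps p {..<m} (\<lambda>i. cnj (w i)))"
        using upper by (intro mult_left_mono) auto
      also have "lps p {..<m} (\<lambda>i. cnj (w i)) = lps p {..<m} w" using cnj(4) by (rule lps_cong)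
      finally show "norm (\<Sum>i<m. (\<Sum>s<n. cnj (u i s) * v s) * w i) \<le> D * lps p {..<n} v * lps p {..<m} w"
        by (simp add: mult_ac)
    qed (use assms in auto)
    have diag: "(\<Sum>s<n. cnj (u i s) * u i s) = of_real (r i)" for i
      using cnj(5) by (simp add: r_def mult.commute)
    have "1 / D\<^sup>2 \<le> r i" if "i < m" for i
    proof -
      have "lps p {..<m} (\<lambda>j. if j = i then 1 else (0::'k)) = 1"
        using lps_unit[of "{..<m}" i p "1::'k"] that True by simp
      moreover have "(\<Sum>j<m. (if j = i then 1 else 0) * u j s) = u i s" for s
        using that by (simp add: if_distrib[of "\<lambda>x. x * _"] cong: if_cong)
      ultimately have "1 \<le> D * lps p {..<n} (u i)"
        using spec[OF lower, of "\<lambda>j. if j = i then 1 else 0"] by simp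
      then have "1 \<le> (D * lps p {..<n} (u i))\<^sup>2" by simp
      also have "\<dots> = D\<^sup>2 * lps p {..<n} (u i) powr p" by (simp add: power_mult_distrib True)
      also have "lps p {..<n} (u i) powr p = r i"
        using lps_powr[of p "{..<n}" "u i"] by (simp add: r_def True)
      finally show ?thesis using assms by (simp add: field_simps)
    qed
    then have "(\<Sum>i<m. 1 / D\<^sup>2) \<le> (\<Sum>i<m. r i)" by (intro sum_mono) auto
    then have "1 / D\<^sup>2 * real m \<le> (\<Sum>i<m. r i)" by simp
    moreover have "0 \<le> r i" for i by (simp add: r_def sum_nonneg)
    ultimately show "\<exists>g r. (\<forall>v. lps p {..<m} (\<lambda>i. \<Sum>s<n. g i s * v s) \<le> D * lps p {..<n} v) \<and>
      (\<forall>i<m. 0 \<le> r i \<and> (\<Sum>s<n. g i s * u i s) = of_real (r i)) \<and> 1 / D\<^sup>2 * real m \<le> (\<Sum>i<m. r i)"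
      using bound diag by (intro exI[of _ "\<lambda>i s. cnj (u i s)"] exI[of _ r]) blast
  qed
next
  case False
  have p1: "1 < p" and q1: "1 < q" using conjugate_exponentsD[OF pq] by auto
  obtain c where "0 < c" and c: "\<And>(m::nat) (n::nat) (u :: nat \<Rightarrow> nat \<Rightarrow> 'k) M.
    (\<forall>t. lps p {..<m} t \<le> D * lps p {..<n} (\<lambda>s. \<Sum>i<m. t i * u i s)) \<Longrightarrow>
    (\<forall>t. lps p {..<n} (\<lambda>s. \<Sum>i<m. t i * u i s) \<le> D * lps p {..<m} t) \<Longrightarrow>
    (\<forall>i<m. \<forall>s<n. norm (u i s) \<le> M s) \<Longrightarrow> c * real m \<le> (\<Sum>s<n. M s powr p)"
    using max_function_large[OF p1 False \<open>1 \<le> D\<close>, where ?'k='k] by blast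
  show ?thesis
  proof (intro exI[of _ "c / D powr (p - 1)"] conjI allI impI)
    show "0 < c / D powr (p - 1)" using assms \<open>0 < c\<close> by simp
    fix m n :: nat and u :: "nat \<Rightarrow> nat \<Rightarrow> 'k"
    assume lower: "\<forall>t. lps p {..<m} t \<le> D * lps p {..<n} (\<lambda>s. \<Sum>i<m. t i * u i s)"
      and upper: "\<forall>t. lps p {..<n} (\<lambda>s. \<Sum>i<m. t i * u i s) \<le> D * lps p {..<m} t"
    show "\<exists>g r. (\<forall>v. lps p {..<m} (\<lambda>i. \<Sum>s<n. g i s * v s) \<le> D * lps p {..<n} v) \<and>
      (\<forall>i<m. 0 \<le> r i \<and> (\<Sum>s<n. g i s * u i s) = of_real (r i)) \<and>
      c / D powr (p - 1) * real m \<le> (\<Sum>i<m. r i)"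
    proof (cases "m = 0")
      case True
      then show ?thesis using assms by simp
    next
      case False
      have "\<exists>i<m. \<forall>j<m. norm (u j s) \<le> norm (u i s)" for s
      proof -
        have fin: "finite ((\<lambda>i. norm (u i s)) ` {..<m})" and ne: "(\<lambda>i. norm (u i s)) ` {..<m} \<noteq> {}"
          using False by auto
        obtain i where i: "i < m" "norm (u i s) = Max ((\<lambda>i. norm (u i s)) ` {..<m})"
          using Max_in[OF fin ne] by auto
        then show ?thesis using Max_ge[OF fin] by (intro exI[of _ i]) auto
      qed
      then obtain \<beta> where \<beta>: "\<And>s. \<beta> s < m" "\<And>s j. j < m \<Longrightarrow> norm (u j s) \<le> norm (u (\<beta> s) s)"
        by metis
      define S where "S i = {s\<in>{..<n}. \<beta> s = i}" for i
      define r where "r i = lps p (S i) (u i)" for i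
      have "\<exists>v. (\<Sum>s\<in>S i. u i s * v s) = of_real (r i) \<and> lps q (S i) v \<le> 1" for i
        unfolding r_def by (rule exists_norming[OF conjugate_exponents_sym[OF pq]]) (simp add: S_def)
      then obtain G where G: "\<And>i. (\<Sum>s\<in>S i. u i s * G i s) = of_real (r i)" "\<And>i. lps q (S i) (G i) \<le> 1"
        by metis
      define \<phi> where "\<phi> s = G (\<beta> s) s" for s
      have \<phi>1: "lps q (S i) \<phi> \<le> 1" for i
      proof -
        have "lps q (S i) \<phi> = lps q (S i) (G i)" by (rule lps_cong) (auto simp: S_def \<phi>_def)
        then show ?thesis using G(2) by simp
      qed
      define g where "g i s = (if \<beta> s = i then \<phi> s else 0)" for i s
      have g_sum: "(\<Sum>s<n. g i s * v s) = (\<Sum>s\<in>S i. \<phi> s * v s)" for i v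
      proof -
        have "(\<Sum>s<n. g i s * v s) = (\<Sum>s<n. if \<beta> s = i then \<phi> s * v s else 0)"
          by (intro sum.cong) (auto simp: g_def)
        also have "\<dots> = (\<Sum>s\<in>S i. \<phi> s * v s)" unfolding S_def by (rule sum.inter_filter[symmetric]) simp
        finally show ?thesis .
      qed
      have bound: "lps p {..<m} (\<lambda>i. \<Sum>s<n. g i s * v s) \<le> D * lps p {..<n} v" for v
      proof -
        have "lps p {..<m} (\<lambda>i. \<Sum>s<n. g i s * v s) \<le> lps p {..<n} v"
          unfolding g_sum S_def
          by (rule lps_block_functionals[OF pq]) (use \<beta> \<phi>1 in \<open>auto simp: S_def\<close>)
        also have "\<dots> \<le> D * lps p {..<n} v"
          using mult_right_mono[OF \<open>1 \<le> D\<close> lps_nonneg] by simp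
        finally show ?thesis .
      qed
      have diag: "(\<Sum>s<n. g i s * u i s) = of_real (r i)" for i
      proof -
        have "(\<Sum>s\<in>S i. \<phi> s * u i s) = (\<Sum>s\<in>S i. u i s * G i s)"
          by (intro sum.cong refl) (auto simp: S_def \<phi>_def)
        then show ?thesis unfolding g_sum using G(1) by simp
      qed
      have r0: "0 \<le> r i" for i by (simp add: r_def)
      have rD: "r i \<le> D" if "i < m" for i
      proof -
        have "r i \<le> lps p {..<n} (u i)" unfolding r_def using p1 by (intro lps_mono_set) (auto simp: S_def)
        also have "u i = (\<lambda>s. \<Sum>j<m. (if j = i then 1 else 0) * u j s)"
          using that by (simp add: if_distrib[of "\<lambda>x. x * _"] cong: if_cong)
        also have "lps p {..<n} \<dots> \<le> D * lps p {..<m} (\<lambda>j. if j = i then 1 else (0::'k))"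
          by (rule spec[OF upper])
        also have "\<dots> = D" using lps_unit[of "{..<m}" i p "1::'k"] that p1 by simp
        finally show ?thesis .
      qed
      \<comment> \<open>Since \<open>r i \<le> D\<close>, a lower bound for \<open>p\<close>-th
        powers turns into a linear one; this is the origin of the factor
        \<open>D powr (p - 1)\<close>.\<close>
      have rp: "r i powr p \<le> D powr (p - 1) * r i" if "i < m" for i
      proof -
        have "r i powr p = r i powr (p - 1) * r i" using r0[of i] by (cases "r i = 0") (auto simp: powr_diff)
        also have "\<dots> \<le> D powr (p - 1) * r i"
          using r0 rD[OF that] p1 by (intro mult_right_mono powr_mono2) auto
        finally show ?thesis .
      qed
      have "c * real m \<le> (\<Sum>s<n. norm (u (\<beta> s) s) powr p)"
        using \<beta> by (intro c[OF lower upper]) auto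
      also have "\<dots> = (\<Sum>i<m. \<Sum>s\<in>{s\<in>{..<n}. \<beta> s = i}. norm (u (\<beta> s) s) powr p)"
        by (rule sum.group[symmetric]) (use \<beta> in auto)
      also have "\<dots> = (\<Sum>i<m. r i powr p)"
        unfolding r_def using p1 by (intro sum.cong refl) (auto simp: lps_powr S_def)
      also have "\<dots> \<le> (\<Sum>i<m. D powr (p - 1) * r i)" using rp by (intro sum_mono) auto
      also have "\<dots> = D powr (p - 1) * (\<Sum>i<m. r i)" by (simp add: sum_distrib_left)
      finally have "c / D powr (p - 1) * real m \<le> (\<Sum>i<m. r i)"
        using \<open>1 \<le> D\<close> by (simp add: field_simps)
      then show ?thesis using bound diag r0 by blast
    qed
  qed
qed

section \<open>Matrices with large diagonal\<close>

text \<open>Read \<open>R j i\<close> as an arc from \<open>j\<close> to \<open>i\<close>. All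
  out-degrees are at most \<open>d\<close>, so the average in-degree is too, and some vertex has
  in-degree at most \<open>d\<close>. Selecting it and discarding it with its neighbours costs at
  most \<open>2 * d + 1\<close> vertices.\<close>

lemma exists_independent_subset:
  fixes R :: "'i \<Rightarrow> 'i \<Rightarrow> bool"
  assumes "finite V" "\<And>j. j \<in> V \<Longrightarrow> card {i\<in>V. R j i} \<le> d" "(2 * d + 1) * k \<le> card V"
  shows "\<exists>S\<subseteq>V. card S = k \<and> (\<forall>i\<in>S. \<forall>j\<in>S. i \<noteq> j \<longrightarrow> \<not> R i j)"
  using assms
proof (induction k arbitrary: V)
  case 0
  then show ?case by (intro exI[of _ "{}"]) auto
next
  case (Suc k)
  have cc: "card {i\<in>V. P i} = (\<Sum>i\<in>V. if P i then 1 else 0)" for P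
    by (simp only: card_eq_sum sum.inter_filter[OF \<open>finite V\<close>])
  have "\<exists>j\<in>V. card {i\<in>V. R i j} \<le> d"
  proof (rule ccontr)
    assume "\<not> ?thesis"
    then have "(\<Sum>j\<in>V. d + 1) \<le> (\<Sum>j\<in>V. card {i\<in>V. R i j})" by (intro sum_mono) auto
    also have "\<dots> = (\<Sum>j\<in>V. \<Sum>i\<in>V. if R i j then 1 else 0)"
      by (simp only: cc)
    also have "\<dots> = (\<Sum>i\<in>V. \<Sum>j\<in>V. if R i j then 1 else 0)" by (rule sum.swap)
    also have "\<dots> = (\<Sum>i\<in>V. card {j\<in>V. R i j})"
      by (simp only: cc)
    also have "\<dots> \<le> (\<Sum>i\<in>V. d)" using Suc.prems by (intro sum_mono) auto
    finally show False using Suc.prems by auto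
  qed
  then obtain j where j: "j \<in> V" "card {i\<in>V. R i j} \<le> d" by blast
  define B where "B = insert j ({i\<in>V. R j i} \<union> {i\<in>V. R i j})"
  have "card B \<le> Suc (card ({i\<in>V. R j i} \<union> {i\<in>V. R i j}))"
    unfolding B_def using Suc.prems by (intro card_insert_le_m1) (auto simp: card_insert_if)
  also have "\<dots> \<le> Suc (card {i\<in>V. R j i} + card {i\<in>V. R i j})" using card_Un_le by auto
  also have "\<dots> \<le> 2 * d + 1" using Suc.prems(2)[OF j(1)] j(2) by simp
  finally have B: "card B \<le> 2 * d + 1" .
  have "card V - card B \<le> card (V - B)" by (intro diff_card_le_card_Diff) (use Suc.prems in \<open>auto simp: B_def\<close>)
  then have "(2 * d + 1) * k \<le> card (V - B)" using B Suc.prems(3) by simp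
  moreover have "card {i \<in> V - B. R l i} \<le> d" if "l \<in> V - B" for l
    using Suc.prems(1,2) that by (intro order_trans[OF card_mono Suc.prems(2)[of l]]) auto
  ultimately obtain S where S: "S \<subseteq> V - B" "card S = k" "\<forall>i\<in>S. \<forall>j\<in>S. i \<noteq> j \<longrightarrow> \<not> R i j"
    using Suc.IH[of "V - B"] Suc.prems(1) by auto
  have "finite S" using S(1) Suc.prems(1) by (meson finite_Diff finite_subset)
  moreover have "j \<notin> S" using S(1) by (auto simp: B_def)
  ultimately have "card (insert j S) = Suc k" using S(2) by simp
  moreover have "insert j S \<subseteq> V" using S(1) j(1) by auto
  moreover have "\<forall>a\<in>insert j S. \<forall>b\<in>insert j S. a \<noteq> b \<longrightarrow> \<not> R a b"
    using S(1,3) by (auto simp: B_def)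
  ultimately show ?case by blast
qed

text \<open>Diagonal entries are at most \<open>D\<close> in norm, so a large trace forces at least
  \<open>c * m / (2 * D)\<close> of them to be at least \<open>c / 2\<close>. A column of norm at
  most \<open>D\<close> has at most \<open>(D / \<delta>) powr p\<close> entries above
  \<open>\<delta>\<close>; such entries form a sparse directed graph, and an independent set in it
  gives the submatrix.\<close>

lemma exists_principal_submatrix:
  fixes p c D \<delta> :: real and k :: nat
  assumes "1 < p" "0 < c" "0 < D" "0 < \<delta>"
  shows "\<exists>m. \<forall>G :: nat \<Rightarrow> nat \<Rightarrow> 'k::real_normed_field.
    (\<forall>j<m. lps p {..<m} (\<lambda>i. G i j) \<le> D) \<longrightarrow> c * real m \<le> (\<Sum>i<m. norm (G i i)) \<longrightarrow>
    (\<exists>\<sigma>. inj_on \<sigma> {..<k} \<and> (\<forall>i<k. \<sigma> i < m \<and> c / 2 \<le> norm (G (\<sigma> i) (\<sigma> i))) \<and>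
      (\<forall>i<k. \<forall>j<k. i \<noteq> j \<longrightarrow> norm (G (\<sigma> i) (\<sigma> j)) \<le> \<delta>))"
proof -
  define d where "d = nat \<lceil>(D / \<delta>) powr p\<rceil>"
  define m where "m = nat \<lceil>real ((2 * d + 1) * k) * (2 * D) / c\<rceil>"
  have m: "real ((2 * d + 1) * k) \<le> c * real m / (2 * D)"
  proof -
    have "real ((2 * d + 1) * k) * (2 * D) / c \<le> real m" unfolding m_def by linarith
    then show ?thesis using assms by (simp add: field_simps)
  qed
  show ?thesis
  proof (intro exI[of _ m] allI impI)
    fix G :: "nat \<Rightarrow> nat \<Rightarrow> 'k"
    assume col: "\<forall>j<m. lps p {..<m} (\<lambda>i. G i j) \<le> D" and tr: "c * real m \<le> (\<Sum>i<m. norm (G i i))"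
    define V where "V = {i\<in>{..<m}. c / 2 \<le> norm (G i i)}"
    have V: "finite V" "V \<subseteq> {..<m}" by (auto simp: V_def)
    have GD: "norm (G i j) \<le> D" if "i < m" "j < m" for i j
      using norm_le_lps[of "{..<m}" i p "\<lambda>i. G i j"] col that assms by fastforce
    have "(\<Sum>i<m. norm (G i i)) \<le> (\<Sum>i<m. (if i \<in> V then D else 0) + c / 2)"
      using GD assms by (intro sum_mono) (auto simp: V_def intro: add_increasing2)
    also have "\<dots> = real (card V) * D + real m * (c / 2)"
      using V by (simp add: sum.distrib sum.If_cases Int_absorb1)
    finally have "c * real m / (2 * D) \<le> real (card V)" using tr assms by (simp add: field_simps)
    with m have "real ((2 * d + 1) * k) \<le> real (card V)" by simp
    then have cV: "(2 * d + 1) * k \<le> card V" by (simp only: of_nat_le_iff)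
    have deg: "card {i\<in>V. \<delta> < norm (G i j)} \<le> d" if "j \<in> V" for j
    proof -
      let ?A = "{i\<in>V. \<delta> < norm (G i j)}"
      have "real (card ?A) * \<delta> powr p = (\<Sum>i\<in>?A. \<delta> powr p)" by simp
      also have "\<dots> \<le> (\<Sum>i\<in>?A. norm (G i j) powr p)" using assms by (intro sum_mono powr_mono2) auto
      also have "\<dots> \<le> (\<Sum>i<m. norm (G i j) powr p)" using V by (intro sum_mono2) auto
      also have "\<dots> \<le> D powr p"
        using col that V assms by (subst lps_le_iff[symmetric]) (auto simp: V_def)
      finally have "real (card ?A) \<le> (D / \<delta>) powr p" using assms by (simp add: powr_divide field_simps)
      then show ?thesis unfolding d_def by linarith
    qed
    obtain S where S: "S \<subseteq> V" "card S = k" "\<forall>i\<in>S. \<forall>j\<in>S. i \<noteq> j \<longrightarrow> \<not> \<delta> < norm (G j i)"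
      using exists_independent_subset[of V "\<lambda>j i. \<delta> < norm (G i j)", OF V(1) deg cV] by blast
    have "finite S" using S(1) V(1) finite_subset by blast
    then obtain \<sigma> where \<sigma>: "bij_betw \<sigma> {..<k} S"
      using ex_bij_betw_nat_finite[of S] S(2) by (auto simp: atLeast0LessThan)
    have mem: "\<sigma> i \<in> S" if "i < k" for i using \<sigma> that by (auto simp: bij_betw_def)
    have inj: "inj_on \<sigma> {..<k}" using \<sigma> by (simp add: bij_betw_def)
    show "\<exists>\<sigma>. inj_on \<sigma> {..<k} \<and> (\<forall>i<k. \<sigma> i < m \<and> c / 2 \<le> norm (G (\<sigma> i) (\<sigma> i))) \<and>
      (\<forall>i<k. \<forall>j<k. i \<noteq> j \<longrightarrow> norm (G (\<sigma> i) (\<sigma> j)) \<le> \<delta>)"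
    proof (intro exI[of _ \<sigma>] conjI allI impI)
      show "inj_on \<sigma> {..<k}" by (rule inj)
      fix i assume i: "i < k"
      then have "\<sigma> i \<in> V" using mem S(1) by blast
      then show "\<sigma> i < m" "c / 2 \<le> norm (G (\<sigma> i) (\<sigma> i))" by (auto simp: V_def)
      fix j assume "j < k" "i \<noteq> j"
      then have "\<sigma> i \<noteq> \<sigma> j" using inj i by (auto simp: inj_on_def)
      then show "norm (G (\<sigma> i) (\<sigma> j)) \<le> \<delta>" using S(3)[rule_format, OF mem[OF \<open>j < k\<close>] mem[OF i]] by simp
    qed
  qed
qed

text \<open>\<open>M\<close> is the identity plus a perturbation whose norm is at most 1/2. The
  estimate that the norm of \<open>s\<close> is at most twice that of \<open>M s\<close> gives
  injectivity, hence solvability in finite dimension, and also the bound for the inverse.\<close>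

lemma exists_right_inverse:
  fixes M :: "nat \<Rightarrow> nat \<Rightarrow> 'k::real_normed_field"
  assumes pq: "conjugate_exponents p q"
    and close: "\<And>i j. i < k \<Longrightarrow> j < k \<Longrightarrow> norm (M i j - (if i = j then 1 else 0)) \<le> 1 / (2 * (real k)\<^sup>2)"
  shows "\<exists>P. (\<forall>i<k. \<forall>l<k. (\<Sum>j<k. M i j * P j l) = (if i = l then 1 else 0)) \<and>
    (\<forall>t. lps p {..<k} (\<lambda>j. \<Sum>l<k. P j l * t l) \<le> 2 * lps p {..<k} t)"
proof -
  note D = conjugate_exponentsD[OF pq]
  have p0: "0 < p" and q0: "0 < q" using D by auto
  define K where "K i j = M i j - (if i = j then 1 else 0)" for i j
  have key: "lps p {..<k} s \<le> 2 * lps p {..<k} t" if st: "\<And>i. i < k \<Longrightarrow> (\<Sum>j<k. M i j * s j) = t i" for s t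
  proof (cases "k = 0")
    case False
    obtain f where f: "(\<Sum>i<k. s i * f i) = of_real (lps p {..<k} s)" "lps q {..<k} f \<le> 1"
      using exists_norming[OF conjugate_exponents_sym[OF pq], of "{..<k}" s] by auto
    have s_eq: "s i = t i - (\<Sum>j<k. K i j * s j)" if "i < k" for i
    proof -
      have "(\<Sum>j<k. K i j * s j) = (\<Sum>j<k. M i j * s j) - (\<Sum>j<k. if j = i then s i else 0)"
        unfolding sum_subtractf[symmetric] by (intro sum.cong) (auto simp: K_def left_diff_distrib)
      then show ?thesis using st that by simp
    qed
    have f1: "norm (f i) \<le> 1" if "i < k" for i
      using norm_le_lps[of "{..<k}" i q f] f(2) that q0 by simp
    have Ks: "norm (\<Sum>j<k. K i j * s j) \<le> 1 / (2 * real k) * lps p {..<k} s" if "i < k" for i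
    proof -
      have "norm (\<Sum>j<k. K i j * s j) \<le> (\<Sum>j<k. 1 / (2 * (real k)\<^sup>2) * lps p {..<k} s)"
      proof (intro order_trans[OF norm_sum] sum_mono)
        fix j assume "j \<in> {..<k}"
        then have "norm (K i j) \<le> 1 / (2 * (real k)\<^sup>2)" "norm (s j) \<le> lps p {..<k} s"
          using close[OF that, of j] norm_le_lps[of "{..<k}" j p s] p0 by (simp_all only: K_def finite_lessThan) auto
        then show "norm (K i j * s j) \<le> 1 / (2 * (real k)\<^sup>2) * lps p {..<k} s"
          unfolding norm_mult by (intro mult_mono) auto
      qed
      then show ?thesis using False by (simp add: power2_eq_square)
    qed
    have "lps p {..<k} s = norm (\<Sum>i<k. s i * f i)" unfolding f(1) by simp
    also have "(\<Sum>i<k. s i * f i) = (\<Sum>i<k. f i * t i) - (\<Sum>i<k. f i * (\<Sum>j<k. K i j * s j))"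
      unfolding sum_subtractf[symmetric] using s_eq
      by (intro sum.cong refl) (metis lessThan_iff mult.commute right_diff_distrib)
    also have "norm \<dots> \<le> norm (\<Sum>i<k. f i * t i) + norm (\<Sum>i<k. f i * (\<Sum>j<k. K i j * s j))"
      by (rule norm_triangle_ineq4)
    also have "\<dots> \<le> 1 * lps p {..<k} t + (\<Sum>i<k. 1 * (1 / (2 * real k) * lps p {..<k} s))"
    proof (rule add_mono)
      have "norm (\<Sum>i<k. f i * t i) \<le> lps q {..<k} f * lps p {..<k} t" by (rule holder[OF pq]) simp
      also have "\<dots> \<le> 1 * lps p {..<k} t" using f(2) by (intro mult_right_mono) auto
      finally show "norm (\<Sum>i<k. f i * t i) \<le> 1 * lps p {..<k} t" .
      show "norm (\<Sum>i<k. f i * (\<Sum>j<k. K i j * s j)) \<le> (\<Sum>i<k. 1 * (1 / (2 * real k) * lps p {..<k} s))"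
      proof (intro order_trans[OF norm_sum] sum_mono)
        fix i assume "i \<in> {..<k}"
        then show "norm (f i * (\<Sum>j<k. K i j * s j)) \<le> 1 * (1 / (2 * real k) * lps p {..<k} s)"
          unfolding norm_mult using f1[of i] Ks[of i] by (intro mult_mono) auto
      qed
    qed
    also have "\<dots> = lps p {..<k} t + lps p {..<k} s / 2" using False by simp
    finally show ?thesis by simp
  qed simp
  have "\<exists>s. \<forall>i<k. (\<Sum>j<k. M i j * s j) = (if i = l then 1 else 0)" if "l < k" for l
  proof -
    \<comment> \<open>The right-hand side becomes column \<open>k\<close> of a homogeneous system of
      \<open>k\<close> equations in \<open>k + 1\<close> unknowns. By \<open>key\<close> a
      nontrivial solution cannot have last coordinate 0, and dividing by that coordinate solves the
      original system.\<close>
    define M' where "M' i j = (if j < k then M i j else if i = l then - 1 else 0)" for i j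
    obtain t where t: "\<exists>j\<in>{..<Suc k}. t j \<noteq> 0" "\<forall>i\<in>{..<k}. (\<Sum>j\<in>{..<Suc k}. M' i j * t j) = 0"
      using exists_nontrivial_kernel[of "{..<k}" "{..<Suc k}" M'] by auto
    have eq: "(\<Sum>j<k. M i j * t j) = (if i = l then t k else 0)" if "i < k" for i
      using t(2) that by (auto simp: M'_def lessThan_Suc split: if_splits)
    have "t k \<noteq> 0"
    proof
      assume "t k = 0"
      then have "lps p {..<k} t \<le> 2 * lps p {..<k} (\<lambda>_. 0::'k)" using eq by (intro key) auto
      then have "lps p {..<k} t = 0" by (simp add: order_antisym)
      then have "t j = 0" if "j < k" for j using that p0 lps_eq_0D[of p "{..<k}" t j] by simp
      with t(1) \<open>t k = 0\<close> show False by (auto simp: less_Suc_eq)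
    qed
    have "(\<Sum>j<k. M i j * (t j / t k)) = (if i = l then 1 else 0)" if "i < k" for i
    proof -
      have "(\<Sum>j<k. M i j * (t j / t k)) = (\<Sum>j<k. M i j * t j) / t k" by (simp add: sum_divide_distrib)
      then show ?thesis using eq[OF that] \<open>t k \<noteq> 0\<close> by simp
    qed
    then show ?thesis by (intro exI[of _ "\<lambda>j. t j / t k"]) simp
  qed
  then have "\<forall>l. \<exists>s. l < k \<longrightarrow> (\<forall>i<k. (\<Sum>j<k. M i j * s j) = (if i = l then 1 else 0))"
    by blast
  then obtain s where s: "\<And>l i. l < k \<Longrightarrow> i < k \<Longrightarrow> (\<Sum>j<k. M i j * s l j) = (if i = l then 1 else 0)"
    by metis
  have "lps p {..<k} (\<lambda>j. \<Sum>l<k. s l j * t l) \<le> 2 * lps p {..<k} t" for t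
  proof (rule key)
    fix i assume i: "i < k"
    have "(\<Sum>j<k. M i j * (\<Sum>l<k. s l j * t l)) = (\<Sum>j<k. \<Sum>l<k. M i j * s l j * t l)"
      by (simp add: sum_distrib_left mult.assoc)
    also have "\<dots> = (\<Sum>l<k. \<Sum>j<k. M i j * s l j * t l)" by (rule sum.swap)
    also have "\<dots> = (\<Sum>l<k. (\<Sum>j<k. M i j * s l j) * t l)" by (simp add: sum_distrib_right)
    also have "\<dots> = (\<Sum>l<k. if l = i then t i else 0)" using s i by (intro sum.cong) auto
    finally show "(\<Sum>j<k. M i j * (\<Sum>l<k. s l j * t l)) = t i" using i by simp
  qed
  with s show ?thesis by (intro exI[of _ "\<lambda>j l. s l j"]) auto
qed

section \<open>Linear maps and their total boundedness\<close>

text \<open>Only additivity and homogeneity, for any pair of scalar multiplications, so that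
  functionals are the case of multiplication in the field.\<close>

definition lin :: "('k \<Rightarrow> 'a::plus \<Rightarrow> 'a) \<Rightarrow> ('k \<Rightarrow> 'b::plus \<Rightarrow> 'b) \<Rightarrow> ('a \<Rightarrow> 'b) \<Rightarrow> bool"
  where "lin sA sB T \<longleftrightarrow> (\<forall>x y. T (x + y) = T x + T y) \<and> (\<forall>c x. T (sA c x) = sB c (T x))"

lemma linD: "lin sA sB T \<Longrightarrow> T (x + y) = T x + T y" "lin sA sB T \<Longrightarrow> T (sA c x) = sB c (T x)"
  by (auto simp: lin_def)

lemma lin_zero:
  fixes T :: "'a::ab_group_add \<Rightarrow> 'b::ab_group_add"
  shows "lin sA sB T \<Longrightarrow> T 0 = 0"
  by (metis add.right_neutral add_left_cancel linD(1))

lemma lin_diff: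
  fixes T :: "'a::ab_group_add \<Rightarrow> 'b::ab_group_add"
  shows "lin sA sB T \<Longrightarrow> T (x - y) = T x - T y"
  by (metis add_diff_cancel_right' diff_add_cancel linD(1))

lemma lin_sum:
  fixes T :: "'a::ab_group_add \<Rightarrow> 'b::ab_group_add"
  shows "lin sA sB T \<Longrightarrow> T (\<Sum>i\<in>I. sA (t i) (x i)) = (\<Sum>i\<in>I. sB (t i) (T (x i)))"
  by (induction I rule: infinite_finite_induct) (simp_all add: lin_zero linD)

text \<open>Compactness in terms of finite nets. The net need not lie in the image, which makes sums
  and uniform limits immediate.\<close>

definition totally_bounded_map :: "('a::real_normed_vector \<Rightarrow> 'b::real_normed_vector) \<Rightarrow> bool"
  where "totally_bounded_map T \<longleftrightarrow>
    (\<forall>\<epsilon>>0. \<exists>Y. finite Y \<and> (\<forall>x. norm x \<le> 1 \<longrightarrow> (\<exists>y\<in>Y. norm (T x - y) < \<epsilon>)))"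

lemma totally_bounded_mapD:
  "\<lbrakk>totally_bounded_map T; 0 < \<epsilon>\<rbrakk> \<Longrightarrow> \<exists>Y. finite Y \<and> (\<forall>x. norm x \<le> 1 \<longrightarrow> (\<exists>y\<in>Y. norm (T x - y) < \<epsilon>))"
  by (auto simp: totally_bounded_map_def)

lemma totally_bounded_map_iff_compact:
  fixes T :: "'a::real_normed_vector \<Rightarrow> 'b::banach"
  shows "totally_bounded_map T \<longleftrightarrow> compact (closure (T ` cball 0 1))"
proof
  assume T: "totally_bounded_map T"
  show "compact (closure (T ` cball 0 1))"
    unfolding compact_eq_totally_bounded
  proof (intro conjI allI impI)
    show "complete (closure (T ` cball 0 1))" by (simp add: complete_eq_closed)
    fix \<epsilon> :: real assume "0 < \<epsilon>"
    then obtain Y where Y: "finite Y" "\<And>x. norm x \<le> 1 \<Longrightarrow> \<exists>y\<in>Y. norm (T x - y) < \<epsilon> / 2"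
      using totally_bounded_mapD[OF T, of "\<epsilon> / 2"] by auto
    have "closure (T ` cball 0 1) \<subseteq> (\<Union>y\<in>Y. ball y \<epsilon>)"
    proof
      fix z assume "z \<in> closure (T ` cball 0 1)"
      then obtain x where x: "norm x \<le> 1" "dist (T x) z < \<epsilon> / 2"
      proof -
        have "\<exists>w\<in>T ` cball 0 1. dist w z < \<epsilon> / 2"
          using \<open>z \<in> closure (T ` cball 0 1)\<close> half_gt_zero[OF \<open>0 < \<epsilon>\<close>]
          unfolding closure_approachable by blast
        then show ?thesis using that by auto
      qed
      obtain y where y: "y \<in> Y" "norm (T x - y) < \<epsilon> / 2" using Y x by blast
      have "dist y z < \<epsilon>"
        using x(2) y(2) dist_triangle[of y z "T x"] by (simp add: dist_norm norm_minus_commute)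
      then show "z \<in> (\<Union>y\<in>Y. ball y \<epsilon>)" using y by auto
    qed
    then show "\<exists>k. finite k \<and> closure (T ` cball 0 1) \<subseteq> (\<Union>x\<in>k. ball x \<epsilon>)" using Y(1) by blast
  qed
next
  assume c: "compact (closure (T ` cball 0 1))"
  show "totally_bounded_map T"
    unfolding totally_bounded_map_def
  proof (intro allI impI)
    fix \<epsilon> :: real assume "0 < \<epsilon>"
    then obtain k where k: "finite k" "closure (T ` cball 0 1) \<subseteq> (\<Union>x\<in>k. ball x \<epsilon>)"
      using c unfolding compact_eq_totally_bounded by blast
    have "\<exists>y\<in>k. norm (T x - y) < \<epsilon>" if "norm x \<le> 1" for x
    proof -
      have "T x \<in> closure (T ` cball 0 1)" using that closure_subset by fastforce
      then obtain y where "y \<in> k" "T x \<in> ball y \<epsilon>" using k(2) by blast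
      then show ?thesis by (auto simp: dist_norm norm_minus_commute)
    qed
    then show "\<exists>Y. finite Y \<and> (\<forall>x. norm x \<le> 1 \<longrightarrow> (\<exists>y\<in>Y. norm (T x - y) < \<epsilon>))" using k(1) by blast
  qed
qed

context banach_space
begin

lemma scaleR_eq_scale: "r *\<^sub>R x = scale (of_real r) x"
  by (simp add: scale_of_real)

lemma lin_scaleR:
  assumes "lin scale sB T" "banach_space sB"
  shows "T (r *\<^sub>R x) = r *\<^sub>R T x"
  using assms by (simp add: scaleR_eq_scale banach_space.scaleR_eq_scale[OF assms(2)] linD)

lemma totally_bounded_map_radius:
  assumes T: "totally_bounded_map T" "lin scale sB T" "banach_space sB" and "0 < \<epsilon>" "0 < R"
  shows "\<exists>Y. finite Y \<and> (\<forall>x. norm x \<le> R \<longrightarrow> (\<exists>y\<in>Y. norm (T x - y) < \<epsilon>))"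
proof -
  obtain Y where Y: "finite Y" "\<And>x. norm x \<le> 1 \<Longrightarrow> \<exists>y\<in>Y. norm (T x - y) < \<epsilon> / R"
    using totally_bounded_mapD[OF T(1), of "\<epsilon> / R"] assms by auto
  have "\<exists>y\<in>(\<lambda>y. R *\<^sub>R y) ` Y. norm (T x - y) < \<epsilon>" if "norm x \<le> R" for x
  proof -
    have "norm ((1 / R) *\<^sub>R x) \<le> 1" using that \<open>0 < R\<close> by (simp add: field_simps)
    then obtain y where y: "y \<in> Y" "norm (T ((1 / R) *\<^sub>R x) - y) < \<epsilon> / R" using Y by blast
    have "T x - R *\<^sub>R y = R *\<^sub>R (T ((1 / R) *\<^sub>R x) - y)"
      using \<open>0 < R\<close> lin_scaleR[OF T(2,3), of "1 / R" x] by (simp add: scaleR_diff_right)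
    then have "norm (T x - R *\<^sub>R y) = R * norm (T ((1 / R) *\<^sub>R x) - y)" using \<open>0 < R\<close> by simp
    also have "\<dots> < \<epsilon>" using y(2) \<open>0 < R\<close> by (simp add: field_simps)
    finally have "norm (T x - R *\<^sub>R y) < \<epsilon>" .
    then show ?thesis using y(1) by blast
  qed
  then show ?thesis using Y(1) by blast
qed

lemma bounded_by_scaling:
  assumes T: "lin scale sB T" "banach_space sB" and B: "\<And>x. norm x \<le> 1 \<Longrightarrow> norm (T x) \<le> B"
  shows "norm (T x) \<le> B * norm x"
proof (cases "x = 0")
  case True
  then show ?thesis by (simp add: lin_zero[OF T(1)])
next
  case False
  have "norm (T ((1 / norm x) *\<^sub>R x)) \<le> B" by (rule B) (simp add: False)
  then show ?thesis using False by (simp add: lin_scaleR[OF T] field_simps)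
qed

lemma totally_bounded_map_bounded:
  assumes T: "totally_bounded_map T" "lin scale sB T" "banach_space sB"
  shows "\<exists>B\<ge>0. \<forall>x. norm (T x) \<le> B * norm x"
proof -
  obtain Y where Y: "finite Y" "\<And>x. norm x \<le> 1 \<Longrightarrow> \<exists>y\<in>Y. norm (T x - y) < 1"
    using totally_bounded_mapD[OF T(1), of 1] by auto
  define B where "B = (\<Sum>y\<in>Y. norm y) + 1"
  have "norm (T x) \<le> B" if x: "norm x \<le> 1" for x
  proof -
    obtain y where y: "y \<in> Y" "norm (T x - y) < 1" using Y(2) x by blast
    have "norm y \<le> (\<Sum>y\<in>Y. norm y)" using y Y by (intro member_le_sum) auto
    moreover have "norm (T x) \<le> norm y + norm (T x - y)" by (rule norm_triangle_sub)
    ultimately show ?thesis using y by (simp add: B_def)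
  qed
  moreover have "0 \<le> B" by (simp add: B_def sum_nonneg)
  ultimately show ?thesis using bounded_by_scaling[OF T(2,3)] by blast
qed

section \<open>Frames\<close>

text \<open>A total function with no condition outside \<open>N\<close>. Along the ultrafilters used
  below every given vector eventually lies in the subspace, so values outside never affect a
  limit.\<close>

definition functional_on :: "'x set \<Rightarrow> ('x \<Rightarrow> 'k) \<Rightarrow> bool"
  where "functional_on N f \<longleftrightarrow>
    (\<forall>x\<in>N. \<forall>y\<in>N. f (x + y) = f x + f y) \<and> (\<forall>c. \<forall>x\<in>N. f (scale c x) = c * f x)"

abbreviation functional :: "('x \<Rightarrow> 'k) \<Rightarrow> bool"
  where "functional \<equiv> functional_on UNIV"

lemma functional_iff_lin: "functional f \<longleftrightarrow> lin scale (*) f"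
  by (auto simp: functional_on_def lin_def)

lemma functional_onD:
  "\<lbrakk>functional_on N f; x \<in> N; y \<in> N\<rbrakk> \<Longrightarrow> f (x + y) = f x + f y"
  "\<lbrakk>functional_on N f; x \<in> N\<rbrakk> \<Longrightarrow> f (scale c x) = c * f x"
  by (auto simp: functional_on_def)

lemma functional_on_zero: "\<lbrakk>functional_on N f; subspace N\<rbrakk> \<Longrightarrow> f 0 = 0"
  using functional_onD(1)[of N f 0 0] by (simp add: subspace_0)

lemma functional_on_diff:
  "\<lbrakk>functional_on N f; subspace N; x \<in> N; y \<in> N\<rbrakk> \<Longrightarrow> f (x - y) = f x - f y"
  using functional_onD(1)[of N f "x - y" y] by (simp add: subspace_diff algebra_simps)

lemma subspace_combination: "\<lbrakk>subspace N; \<And>i. i \<in> I \<Longrightarrow> x i \<in> N\<rbrakk> \<Longrightarrow> (\<Sum>i\<in>I. scale (t i) (x i)) \<in> N"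
  by (intro subspace_sum subspace_scale)

lemma functional_on_sum:
  assumes "functional_on N f" "subspace N" "\<And>i. i \<in> I \<Longrightarrow> x i \<in> N"
  shows "f (\<Sum>i\<in>I. scale (t i) (x i)) = (\<Sum>i\<in>I. t i * f (x i))"
  using assms(3)
proof (induction I rule: infinite_finite_induct)
  case (insert i I)
  have "(\<Sum>i\<in>I. scale (t i) (x i)) \<in> N" "scale (t i) (x i) \<in> N"
    using insert.prems assms(2) by (auto intro: subspace_combination subspace_scale)
  then show ?case using insert functional_onD[OF assms(1)] by simp
qed (simp_all add: functional_on_zero[OF assms(1,2)])

lemma functional_on_combination:
  assumes "\<And>i. i \<in> I \<Longrightarrow> functional_on N (f i)"
  shows "functional_on N (\<lambda>x. \<Sum>i\<in>I. c i * f i x)"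
  using assms unfolding functional_on_def
  by (auto simp: distrib_left sum.distrib sum_distrib_left mult_ac)

text \<open>An isomorphism \<open>N \<cong> \<ell>\<^sub>p\<^sup>n\<close>, given by the images \<open>e i\<close> of the unit vectors and the coordinates \<open>\<phi> i\<close>.\<close>

definition frame ::
  "real \<Rightarrow> real \<Rightarrow> 'x set \<Rightarrow> nat \<Rightarrow> (nat \<Rightarrow> 'x) \<Rightarrow> (nat \<Rightarrow> 'x \<Rightarrow> 'k) \<Rightarrow> bool"
  where "frame p D N n e \<phi> \<longleftrightarrow> subspace N \<and> (\<forall>i<n. functional_on N (\<phi> i)) \<and>
    (\<forall>i<n. e i \<in> N) \<and>
    (\<forall>x\<in>N. x = (\<Sum>i<n. scale (\<phi> i x) (e i))) \<and>
    (\<forall>t. \<forall>i<n. \<phi> i (\<Sum>j<n. scale (t j) (e j)) = t i) \<and>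
    (\<forall>x\<in>N. lps p {..<n} (\<lambda>i. \<phi> i x) \<le> norm x) \<and>
    (\<forall>t. norm (\<Sum>i<n. scale (t i) (e i)) \<le> D * lps p {..<n} t)"

lemma frameD:
  assumes "frame p D N n e \<phi>"
  shows "subspace N" "\<And>i. i < n \<Longrightarrow> functional_on N (\<phi> i)" "\<And>i. i < n \<Longrightarrow> e i \<in> N"
    "\<And>x. x \<in> N \<Longrightarrow> x = (\<Sum>i<n. scale (\<phi> i x) (e i))"
    "\<And>t i. i < n \<Longrightarrow> \<phi> i (\<Sum>j<n. scale (t j) (e j)) = t i"
    "\<And>x. x \<in> N \<Longrightarrow> lps p {..<n} (\<lambda>i. \<phi> i x) \<le> norm x"
    "\<And>t. norm (\<Sum>i<n. scale (t i) (e i)) \<le> D * lps p {..<n} t"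
  using assms unfolding frame_def by blast+

section \<open>From the Banach-Mazur distance to frames\<close>

lemma op_norm_on_bound:
  assumes fin: "op_norm_on E nE nF f = ennreal \<alpha>" "0 \<le> \<alpha>"
    and s: "\<And>r u. u \<in> E \<Longrightarrow> s r u \<in> E" "\<And>r u. u \<in> E \<Longrightarrow> nE (s r u) = \<bar>r\<bar> * nE u"
      "\<And>r u. u \<in> E \<Longrightarrow> nF (f (s r u)) = \<bar>r\<bar> * nF (f u)"
    and nE: "\<And>u. u \<in> E \<Longrightarrow> 0 \<le> nE u" and zero: "\<And>u. u \<in> E \<Longrightarrow> nE u = 0 \<Longrightarrow> nF (f u) = 0"
    and u: "u \<in> E"
  shows "nF (f u) \<le> \<alpha> * nE u"
proof (cases "nE u = 0")
  case True
  then show ?thesis using zero u by simp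
next
  case False
  then have pos: "0 < nE u" using nE[OF u] by simp
  let ?v = "s (1 / nE u) u"
  have "?v \<in> {u \<in> E. nE u \<le> 1}" using s u pos by simp
  then have "ennreal (nF (f ?v)) \<le> ennreal \<alpha>"
    unfolding fin(1)[symmetric] op_norm_on_def by (rule SUP_upper)
  then have "nF (f ?v) \<le> \<alpha>" using fin(2) by (simp add: ennreal_le_iff)
  then show ?thesis using s(3)[OF u, of "1 / nE u"] pos by (simp add: field_simps)
qed

text \<open>In \<open>ennreal\<close> the product \<open>0 * top\<close> is 0, so a finite product
  of operator norms bounds both factors only once neither vanishes.\<close>

lemma op_norm_on_pos:
  assumes "u \<in> E" "nE u \<le> 1" "0 < nF (f u)"
  shows "op_norm_on E nE nF f \<noteq> 0"
proof -
  have "ennreal (nF (f u)) \<le> op_norm_on E nE nF f"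
    unfolding op_norm_on_def using assms by (intro SUP_upper) auto
  then show ?thesis using assms(3) by (metis ennreal_eq_0_iff le_zero_eq not_le)
qed

lemma exists_frame:
  assumes "0 < p" and Lp: "script_Lp_space p"
  shows "\<exists>D\<ge>1. \<forall>M. finite M \<longrightarrow> (\<exists>N n e \<phi>. M \<subseteq> N \<and> frame p D N n e \<phi>)"
proof -
  obtain C where C: "1 \<le> C" and ex: "\<And>M. finite_dim_subspace M \<Longrightarrow>
     \<exists>N. finite_dim_subspace N \<and> M \<subseteq> N \<and>
          banach_mazur_distance scale norm N
            (lp_scale :: 'k \<Rightarrow> _) (lp_norm p (dim N)) (lp_carrier (dim N)) \<le> ennreal C"
    using Lp unfolding script_Lp_space_def by blast
  show ?thesis
  \<comment> \<open>The infimum in the distance need not be attained; a constant above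
    \<open>C\<close> allows an isomorphism to be chosen.\<close>
  proof (intro exI[of _ "C + 1"] conjI allI impI)
    show "1 \<le> C + 1" using C by simp
    fix M :: "'x set" assume "finite M"
    then have "finite_dim_subspace (span M)" unfolding finite_dim_subspace_def by blast
    then obtain N where N: "finite_dim_subspace N" "span M \<subseteq> N"
      and BM: "banach_mazur_distance scale norm N
        (lp_scale :: 'k \<Rightarrow> _) (lp_norm p (dim N)) (lp_carrier (dim N)) \<le> ennreal C"
      using ex by blast
    have subN: "subspace N" using N(1) unfolding finite_dim_subspace_def by auto
    have MN: "M \<subseteq> N" using N(2) span_superset by blast
    define n where "n = dim N"
    let ?L = "lp_carrier n :: (nat \<Rightarrow> 'k) set"
    show "\<exists>N n e \<phi>. M \<subseteq> N \<and> frame p (C + 1) N n e \<phi>"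
    \<comment> \<open>On the zero space both operator norms are 0 and the finiteness argument below
      breaks down; the empty frame works there.\<close>
    proof (cases "N = {0}")
      case True
      then have "frame p (C + 1) N 0 (\<lambda>_. 0) (\<lambda>_ _. 0)"
        using C by (simp add: frame_def)
      then show ?thesis using MN by blast
    next
      case False
      then obtain u0 where u0: "u0 \<in> N" "u0 \<noteq> 0" using subspace_0[OF subN] by blast
      have "ennreal C < ennreal (C + 1)" using C by (simp add: ennreal_less_iff)
      then have "banach_mazur_distance scale norm N
          (lp_scale :: 'k \<Rightarrow> _) (lp_norm p n) ?L < ennreal (C + 1)"
        using BM unfolding n_def by (rule le_less_trans[rotated])
      then obtain f where iso: "linear_iso_between scale N (lp_scale :: 'k \<Rightarrow> _) ?L f"
        and prod: "op_norm_on N norm (lp_norm p n) f * op_norm_on ?L (lp_norm p n) norm (inv_into N f)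
          < ennreal (C + 1)"
        unfolding banach_mazur_distance_def INF_less_iff by blast
      define g where "g = inv_into N f"
      have bij: "bij_betw f N ?L" and f_add: "\<And>u v. u \<in> N \<Longrightarrow> v \<in> N \<Longrightarrow> f (u + v) = f u + f v"
        and f_scale: "\<And>c u. u \<in> N \<Longrightarrow> f (scale c u) = lp_scale c (f u)"
        using iso unfolding linear_iso_between_def by blast+
      have fL: "f u \<in> ?L" if "u \<in> N" for u using bij that by (rule bij_betw_apply)
      have gN: "g v \<in> N" and fg: "f (g v) = v" if "v \<in> ?L" for v
        using bij that unfolding g_def by (auto simp: bij_betw_def inv_into_into f_inv_into_f)
      have gf: "g (f u) = u" if "u \<in> N" for u
        using bij that unfolding g_def by (auto simp: bij_betw_def)
      have L_add: "v + w \<in> ?L" and L_scale: "lp_scale c v \<in> ?L" if "v \<in> ?L" "w \<in> ?L" for v w c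
        using that by (auto simp: lp_carrier_def lp_scale_def)
      have g_eq: "g v = u" if "u \<in> N" "f u = v" for u v using gf that by blast
      have g_add: "g (v + w) = g v + g w" if "v \<in> ?L" "w \<in> ?L" for v w
        using that by (intro g_eq) (auto simp: subspace_add[OF subN] gN f_add fg)
      have g_scale: "g (lp_scale c v) = scale c (g v)" if "v \<in> ?L" for v c
        using that by (intro g_eq) (auto simp: subspace_scale[OF subN] gN f_scale fg)
      have zeroL: "(\<lambda>_. 0) \<in> ?L" by (simp add: lp_carrier_def)
      have g0: "g (\<lambda>_. 0) = 0"
      proof -
        have "g (lp_scale 0 (\<lambda>_. 0)) = scale 0 (g (\<lambda>_. 0))" by (rule g_scale[OF zeroL])
        then show ?thesis by (simp add: lp_scale_def)
      qed
      have norm_scale': "lp_norm p n (lp_scale c v) = norm c * lp_norm p n v" for c :: 'k and v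
        unfolding lp_norm_eq_lps lp_scale_def using \<open>0 < p\<close> by (rule lps_mult)
      have L0: "v = (\<lambda>_. 0)" if "v \<in> ?L" "lp_norm p n v = 0" for v
      proof
        fix i show "v i = 0"
          using that lps_eq_0D[of p "{..<n}" v i] \<open>0 < p\<close>
          by (cases "i < n") (auto simp: lp_norm_eq_lps lp_carrier_def)
      qed
      have npos: "0 < lp_norm p n (f u)" if "u \<in> N" "u \<noteq> 0" for u
      proof -
        have "lp_norm p n (f u) \<noteq> 0" using L0[OF fL[OF that(1)]] gf[OF that(1)] g0 that(2) by auto
        then show ?thesis by (simp add: lp_norm_eq_lps less_le)
      qed
      let ?a = "op_norm_on N norm (lp_norm p n) f"
      let ?b = "op_norm_on ?L (lp_norm p n) norm g"
      have "?a \<noteq> 0"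
      proof (rule op_norm_on_pos)
        let ?u = "scale (of_real (1 / norm u0)) u0"
        show "?u \<in> N" using subN u0 by (simp add: subspace_scale)
        show "norm ?u \<le> 1" using u0 by (simp add: norm_scale norm_divide)
        show "0 < lp_norm p n (f ?u)" using subN u0 by (intro npos) (simp_all add: subspace_scale)
      qed
      moreover have "?b \<noteq> 0"
      proof (rule op_norm_on_pos)
        let ?r = "lp_norm p n (f u0)"
        let ?v = "lp_scale (of_real (1 / ?r)) (f u0)"
        have r: "0 < ?r" by (rule npos[OF u0])
        show "?v \<in> ?L" by (rule L_scale[OF fL fL]) (rule u0)+
        show "lp_norm p n ?v \<le> 1" unfolding norm_scale' using r by (simp add: norm_divide)
        show "0 < norm (g ?v)" using r u0 by (simp add: g_scale fL gf norm_scale norm_divide)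
      qed
      moreover have "?a * ?b \<noteq> top" using prod unfolding g_def by auto
      ultimately have "?a \<noteq> top" "?b \<noteq> top" by (auto simp: ennreal_mult_eq_top_iff)
      then obtain \<alpha> \<beta> where \<alpha>: "0 \<le> \<alpha>" "?a = ennreal \<alpha>" and \<beta>: "0 \<le> \<beta>" "?b = ennreal \<beta>"
        by (metis ennreal_cases)
      have \<alpha>0: "0 < \<alpha>" using \<alpha> \<open>?a \<noteq> 0\<close> by (cases "\<alpha> = 0") auto
      have \<alpha>\<beta>: "\<alpha> * \<beta> \<le> C + 1"
      proof -
        have "ennreal (\<alpha> * \<beta>) < ennreal (C + 1)"
          using prod unfolding g_def[symmetric] \<alpha>(2) \<beta>(2) using \<alpha> \<beta> by (simp add: ennreal_mult)
        then show ?thesis using \<alpha> \<beta> by (simp add: ennreal_less_iff)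
      qed
      have fle: "lp_norm p n (f u) \<le> \<alpha> * norm u" if "u \<in> N" for u
      proof (rule op_norm_on_bound[OF \<alpha>(2,1), where s="\<lambda>r. scale (of_real r)"])
        fix u assume u: "u \<in> N"
        show "scale (of_real r) u \<in> N" for r using subN u by (simp add: subspace_scale)
        show "norm (scale (of_real r) u) = \<bar>r\<bar> * norm u" for r by (simp add: norm_scale)
        show "lp_norm p n (f (scale (of_real r) u)) = \<bar>r\<bar> * lp_norm p n (f u)" for r
          unfolding f_scale[OF u] norm_scale' by simp
        assume "norm u = 0"
        then have "f u = lp_scale 0 (f u)" using f_scale[OF u, of 0] by simp
        then show "lp_norm p n (f u) = 0" using norm_scale'[of 0 "f u"] by simp
      qed (use that in auto)
      have gle: "norm (g v) \<le> \<beta> * lp_norm p n v" if "v \<in> ?L" for v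
      proof (rule op_norm_on_bound[OF \<beta>(2,1), where s="\<lambda>r. lp_scale (of_real r)"])
        fix v assume v: "v \<in> ?L"
        show "lp_scale (of_real r) v \<in> ?L" for r by (rule L_scale[OF v v])
        show "lp_norm p n (lp_scale (of_real r) v) = \<bar>r\<bar> * lp_norm p n v" for r
          unfolding norm_scale' by simp
        show "norm (g (lp_scale (of_real r) v)) = \<bar>r\<bar> * norm (g v)" for r
          unfolding g_scale[OF v] by (simp add: norm_scale)
        show "0 \<le> lp_norm p n v" by (simp add: lp_norm_eq_lps)
        show "norm (g v) = 0" if "lp_norm p n v = 0" using L0[OF v that] g0 by simp
      qed (use that in auto)
      \<comment> \<open>Dividing by \<open>\<alpha>\<close> makes the coordinates contractive and
        puts the whole distortion \<open>\<alpha> * \<beta>\<close> on the vectors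
        \<open>e i\<close>.\<close>
      define \<phi> where "\<phi> i x = f x i / of_real \<alpha>" for i x
      define e where "e i = scale (of_real \<alpha>) (g (\<lambda>j. if j = i then 1 else 0))" for i
      have comb: "(\<Sum>i<k. scale (t i) (e i)) = g (\<lambda>i. if i < k then of_real \<alpha> * t i else 0)"
        if "k \<le> n" for k t
        using that
      proof (induction k)
        case 0
        then show ?case using g0 by simp
      next
        case (Suc k)
        let ?d = "\<lambda>j. if j = k then 1 else (0::'k)"
        let ?w = "\<lambda>i. if i < k then of_real \<alpha> * t i else 0"
        have dL: "?d \<in> ?L" and wL: "?w \<in> ?L" using Suc.prems by (auto simp: lp_carrier_def)
        have "(\<Sum>i<Suc k. scale (t i) (e i)) = g ?w + scale (t k) (scale (of_real \<alpha>) (g ?d))"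
          using Suc by (simp add: e_def)
        also have "\<dots> = g (?w + lp_scale (of_real \<alpha> * t k) ?d)"
          unfolding g_add[OF wL L_scale[OF dL dL]] g_scale[OF dL] by (simp add: mult.commute)
        also have "?w + lp_scale (of_real \<alpha> * t k) ?d = (\<lambda>i. if i < Suc k then of_real \<alpha> * t i else 0)"
          by (auto simp: fun_eq_iff lp_scale_def less_Suc_eq)
        finally show ?case .
      qed
      have tL: "(\<lambda>i. if i < n then of_real \<alpha> * t i else 0) \<in> ?L" for t
        by (simp add: lp_carrier_def)
      have "frame p (C + 1) N n e \<phi>"
        unfolding frame_def
      proof (intro conjI allI ballI impI)
        show "subspace N" by (rule subN)
        show "functional_on N (\<phi> i)" for i
          unfolding functional_on_def \<phi>_def
          by (auto simp: f_add f_scale lp_scale_def add_divide_distrib)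
        show "e i \<in> N" if "i < n" for i
          unfolding e_def using that by (intro subspace_scale[OF subN] gN) (auto simp: lp_carrier_def)
        fix x assume x: "x \<in> N"
        have "(\<lambda>i. if i < n then of_real \<alpha> * \<phi> i x else 0) = f x"
          using fL[OF x] \<alpha>0 by (auto simp: fun_eq_iff \<phi>_def lp_carrier_def)
        then show "x = (\<Sum>i<n. scale (\<phi> i x) (e i))" using comb[of n "\<lambda>i. \<phi> i x"] gf[OF x] by simp
        have "lps p {..<n} (\<lambda>i. \<phi> i x) = lps p {..<n} (\<lambda>i. (1 / of_real \<alpha>) * f x i)"
          by (rule lps_cong) (simp add: \<phi>_def norm_divide)
        also have "\<dots> = lp_norm p n (f x) / \<alpha>"
          unfolding lps_mult[OF \<open>0 < p\<close>] using \<alpha>0 by (simp add: norm_divide lp_norm_eq_lps)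
        also have "\<dots> \<le> norm x" using fle[OF x] \<alpha>0 by (simp add: field_simps)
        finally show "lps p {..<n} (\<lambda>i. \<phi> i x) \<le> norm x" .
      next
        fix t i assume "i < n"
        then show "\<phi> i (\<Sum>j<n. scale (t j) (e j)) = t i"
          using comb[of n t] fg[OF tL] \<alpha>0 by (simp add: \<phi>_def)
      next
        fix t
        have "norm (\<Sum>i<n. scale (t i) (e i)) \<le> \<beta> * lp_norm p n (\<lambda>i. if i < n then of_real \<alpha> * t i else 0)"
          unfolding comb[OF order_refl] by (rule gle[OF tL])
        also have "lp_norm p n (\<lambda>i. if i < n then of_real \<alpha> * t i else 0) = lps p {..<n} (\<lambda>i. of_real \<alpha> * t i)"
          unfolding lp_norm_eq_lps by (rule lps_cong) simp
        also have "\<beta> * \<dots> = (\<alpha> * \<beta>) * lps p {..<n} t"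
          using \<open>0 < p\<close> \<alpha>0 by (simp add: lps_mult)
        also have "\<dots> \<le> (C + 1) * lps p {..<n} t" using \<alpha>\<beta> by (intro mult_right_mono) auto
        finally show "norm (\<Sum>i<n. scale (t i) (e i)) \<le> (C + 1) * lps p {..<n} t" .
      qed
      then show ?thesis using MN by blast
    qed
  qed
qed

lemma exists_large_independent:
  assumes "infinite_dimensional"
  shows "\<exists>M. finite M \<and> card M = m \<and> independent M"
proof -
  obtain B where B: "independent B" "span B = UNIV"
    using basis_exists[of UNIV] by (metis UNIV_eq_I subset_UNIV top.extremum_uniqueI)
  have "infinite B" using assms B unfolding infinite_dimensional_def finite_dim_subspace_def by metis
  then obtain M where "M \<subseteq> B" "finite M" "card M = m" using infinite_arbitrarily_large by blast
  then show ?thesis using B independent_mono by blast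
qed

lemma frame_card_le:
  assumes "frame p D N n e \<phi>" "finite M" "M \<subseteq> N" "independent M"
  shows "card M \<le> n"
proof -
  have "M \<subseteq> span (e ` {..<n})"
  proof
    fix x assume "x \<in> M"
    then have "x = (\<Sum>i<n. scale (\<phi> i x) (e i))" using frameD(4)[OF assms(1)] assms(3) by blast
    also have "\<dots> \<in> span (e ` {..<n})" by (intro span_sum span_scale span_base) auto
    finally show "x \<in> span (e ` {..<n})" .
  qed
  then have "card M \<le> card (e ` {..<n})"
    using independent_span_bound[of "e ` {..<n}" M] assms(4) by simp
  also have "\<dots> \<le> n" using card_image_le[of "{..<n}" e] by simp
  finally show ?thesis .
qed

end

section \<open>Limits along an ultrafilter\<close>

lemma ultra_eventually_const:
  assumes U: "ultra U" and "finite Y" "eventually (\<lambda>i. h i \<in> Y) U"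
  shows "\<exists>y\<in>Y. eventually (\<lambda>i. h i = y) U"
proof (rule ccontr)
  assume "\<not> ?thesis"
  then have "\<forall>y\<in>Y. eventually (\<lambda>i. h i \<noteq> y) U" using U unfolding ultra_def by blast
  then have "eventually (\<lambda>i. \<forall>y\<in>Y. h i \<noteq> y) U" using \<open>finite Y\<close> by (simp add: eventually_ball_finite)
  with assms(3) have "eventually (\<lambda>i. False) U" by eventually_elim blast
  then show False using U unfolding ultra_def by simp
qed

lemma eventually_subset_of_finite:
  assumes "U \<le> finite_subsets_at_top UNIV" "\<And>M. finite M \<Longrightarrow> M \<subseteq> N M" "finite A"
  shows "eventually (\<lambda>M. finite M \<and> A \<subseteq> N M) U"
proof -
  have "eventually (\<lambda>M. finite M \<and> A \<subseteq> M) (finite_subsets_at_top UNIV)"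
    using \<open>finite A\<close> unfolding eventually_finite_subsets_at_top by blast
  then have "eventually (\<lambda>M. finite M \<and> A \<subseteq> N M) (finite_subsets_at_top UNIV)"
    by eventually_elim (use assms(2) in blast)
  then show ?thesis using assms(1) filter_leD by blast
qed

lemma lps_tendsto_le:
  assumes "F \<noteq> bot" "0 < p" "0 \<le> C" "\<And>i. i < k \<Longrightarrow> ((\<lambda>x. f x i) \<longlongrightarrow> l i) F"
    and "eventually (\<lambda>x. lps p {..<k} (f x) \<le> C) F"
  shows "lps p {..<k} l \<le> C"
proof -
  have "((\<lambda>x. \<Sum>i<k. norm (f x i) powr p) \<longlongrightarrow> (\<Sum>i<k. norm (l i) powr p)) F"
    using assms by (intro tendsto_sum tendsto_powr' tendsto_norm) auto
  moreover have "eventually (\<lambda>x. (\<Sum>i<k. norm (f x i) powr p) \<le> C powr p) F"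
    using assms(5) by eventually_elim (use assms(2,3) lps_le_iff in blast)
  ultimately have "(\<Sum>i<k. norm (l i) powr p) \<le> C powr p"
    using assms(1) tendsto_upperbound by blast
  then show ?thesis using assms(2,3) by (simp add: lps_le_iff)
qed

context banach_space
begin

lemma tendsto_scale_left:
  assumes "(g \<longlongrightarrow> c) F"
  shows "((\<lambda>i. scale (g i) v) \<longlongrightarrow> scale c v) F"
proof -
  have "((\<lambda>i. norm (g i - c) * norm v) \<longlongrightarrow> norm (c - c) * norm v) F"
    using assms by (intro tendsto_intros)
  then have "((\<lambda>i. norm (scale (g i) v - scale c v)) \<longlongrightarrow> 0) F"
    by (simp add: norm_scale flip: scale_left_diff_distrib)
  then show ?thesis using LIM_zero_cancel tendsto_norm_zero_iff by blast
qed

text \<open>The values at one vector stay in a compact ball, so they converge along the ultrafilter.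
  Two given vectors eventually lie in a common \<open>N M\<close>, which makes the limit
  additive.\<close>

lemma exists_limit_functional:
  fixes N :: "'x set \<Rightarrow> 'x set" and a :: "'x set \<Rightarrow> 'x \<Rightarrow> 'k"
  assumes U: "ultra U" "U \<le> finite_subsets_at_top UNIV"
    and a: "\<And>M. finite M \<Longrightarrow> M \<subseteq> N M" "\<And>M. finite M \<Longrightarrow> functional_on (N M) (a M)"
      "\<And>M x. finite M \<Longrightarrow> x \<in> N M \<Longrightarrow> norm (a M x) \<le> C * norm x"
  shows "\<exists>f. functional f \<and> (\<forall>x. ((\<lambda>M. a M x) \<longlongrightarrow> f x) U)"
proof -
  have ne: "U \<noteq> bot" using U by (simp add: ultra_def)
  have ev2: "eventually (\<lambda>M. finite M \<and> {x, y} \<subseteq> N M) U" for x y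
    by (rule eventually_subset_of_finite[OF U(2) a(1)]) simp_all
  have "\<exists>l. ((\<lambda>M. a M x) \<longlongrightarrow> l) U" for x
  proof -
    have "eventually (\<lambda>M. a M x \<in> cball 0 (C * norm x)) U"
      using ev2[of x x] by eventually_elim (use a(3) in auto)
    from ultra_tendsto_compact[OF U(1) compact_scalar_cball this] show ?thesis by blast
  qed
  then obtain f where f: "\<And>x. ((\<lambda>M. a M x) \<longlongrightarrow> f x) U" by metis
  have "f (x + y) = f x + f y" for x y
  proof (rule tendsto_unique[OF ne f])
    have "eventually (\<lambda>M. a M x + a M y = a M (x + y)) U"
      using ev2[of x y] by eventually_elim (use a(2) functional_onD(1) in fastforce)
    then show "((\<lambda>M. a M (x + y)) \<longlongrightarrow> f x + f y) U"
      using tendsto_add[OF f f] by (rule Lim_transform_eventually[rotated])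
  qed
  moreover have "f (scale c x) = c * f x" for c x
  proof (rule tendsto_unique[OF ne f])
    have "eventually (\<lambda>M. c * a M x = a M (scale c x)) U"
      using ev2[of x x] by eventually_elim (use a(2) functional_onD(2) in fastforce)
    then show "((\<lambda>M. a M (scale c x)) \<longlongrightarrow> c * f x) U"
      using tendsto_mult_left[OF f] by (rule Lim_transform_eventually[rotated])
  qed
  ultimately show ?thesis using f unfolding functional_on_def by blast
qed

lemma norm_combination_unit:
  fixes k :: nat
  assumes c: "\<And>t. norm (\<Sum>l<k. scale (t l) (c l)) \<le> C * lps p {..<k} t" and "l < k" "0 < p"
  shows "norm (c l) \<le> C"
proof -
  have "(\<Sum>j<k. scale (if j = l then 1 else 0) (c j)) = (\<Sum>j<k. if j = l then c l else 0)"
    by (intro sum.cong) auto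
  also have "\<dots> = c l" using assms(2) by simp
  finally show ?thesis
    using c[of "\<lambda>j. if j = l then 1 else 0"] lps_unit[of "{..<k}" l p "1::'k"] assms by simp
qed

section \<open>Approximation of compact operators\<close>

text \<open>The error is measured after applying \<open>T\<close>: the residual vector itself is in
  general not small, only its image is.\<close>

definition approx_factorization ::
  "real \<Rightarrow> real \<Rightarrow> real \<Rightarrow> ('x \<Rightarrow> 'x) \<Rightarrow> 'x set \<Rightarrow> nat \<Rightarrow> (nat \<Rightarrow> 'x \<Rightarrow> 'k) \<Rightarrow> (nat \<Rightarrow> 'x) \<Rightarrow> bool"
  where "approx_factorization p D \<epsilon> T N k a c \<longleftrightarrow>
    (\<forall>l<k. functional_on N (a l)) \<and>
    (\<forall>x\<in>N. lps p {..<k} (\<lambda>l. a l x) \<le> norm x) \<and>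
    (\<forall>t. norm (\<Sum>l<k. scale (t l) (c l)) \<le> D * lps p {..<k} t) \<and>
    (\<forall>x\<in>N. norm (T (x - (\<Sum>l<k. scale (a l x) (c l)))) \<le> \<epsilon> * norm x)"

lemma approx_factorizationD:
  assumes "approx_factorization p D \<epsilon> T N k a c"
  shows "\<And>l. l < k \<Longrightarrow> functional_on N (a l)"
    "\<And>x. x \<in> N \<Longrightarrow> lps p {..<k} (\<lambda>l. a l x) \<le> norm x"
    "\<And>t. norm (\<Sum>l<k. scale (t l) (c l)) \<le> D * lps p {..<k} t"
    "\<And>x. x \<in> N \<Longrightarrow> norm (T (x - (\<Sum>l<k. scale (a l x) (c l)))) \<le> \<epsilon> * norm x"
  using assms unfolding approx_factorization_def by blast+

text \<open>Let \<open>S x\<close> be the image under \<open>T\<close> of the residual of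
  \<open>x\<close>. It is close to some net point \<open>y j\<close>, and a functional
  \<open>\<Lambda> j\<close> norms \<open>y j\<close> up to the factor \<open>D\<close>. The block
  projection almost preserves the functionals \<open>\<Lambda> j \<circ> T\<close>, so
  \<open>\<Lambda> j (S x)\<close> is small; hence \<open>y j\<close> is small, and so is
  \<open>S x\<close>.\<close>

lemma frame_approximation:
  fixes T :: "'x \<Rightarrow> 'x"
  assumes pq: "conjugate_exponents p q" and "1 \<le> D"
    and frames: "\<And>M. finite M \<Longrightarrow> \<exists>N n e \<phi>. M \<subseteq> N \<and> frame p D N n e \<phi>"
    and T: "lin scale scale T" "totally_bounded_map T" and "0 < \<epsilon>"
  shows "\<exists>k. \<forall>M. finite M \<longrightarrow> (\<exists>N a c. M \<subseteq> N \<and> approx_factorization p D \<epsilon> T N k a c)"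
proof -
  have p0: "0 < p" using conjugate_exponentsD(1)[OF pq] by simp
  note bs = banach_space_axioms
  obtain B where B: "0 \<le> B" "\<And>x. norm (T x) \<le> B * norm x"
    using totally_bounded_map_bounded[OF T(2,1) bs] by blast
  \<comment> \<open>The final estimate is
    \<open>\<epsilon>' + D * (\<epsilon>' + \<epsilon>')\<close>: the distance to the net point,
    plus the norm of the net point as seen by its functional.\<close>
  define \<epsilon>' where "\<epsilon>' = \<epsilon> / (1 + 2 * D)"
  have "0 < 1 + 2 * D" using \<open>1 \<le> D\<close> by simp
  then have "0 < \<epsilon>'" "\<epsilon>' * (1 + 2 * D) = \<epsilon>" using \<open>0 < \<epsilon>\<close> by (simp_all add: \<epsilon>'_def)
  then have \<epsilon>': "0 < \<epsilon>'" "\<epsilon>' + D * (\<epsilon>' + \<epsilon>') = \<epsilon>" by (simp_all add: algebra_simps)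
  \<comment> \<open>\<open>1 + D\<close> bounds the residuals of vectors of norm at most 1. The net,
    and with it \<open>m\<close> and \<open>k\<close>, is fixed before \<open>M\<close>.\<close>
  obtain Y where Y: "finite Y" "\<And>x. norm x \<le> 1 + D \<Longrightarrow> \<exists>y\<in>Y. norm (T x - y) < \<epsilon>'"
    using totally_bounded_map_radius[OF T(2,1) bs \<epsilon>'(1), of "1 + D"] \<open>1 \<le> D\<close> by auto
  obtain m :: nat and y where y: "Y = y ` {j. j < m}"
    using Y(1) by (metis finite_imp_nat_seg_image_inj_on)
  have L0: "0 \<le> B * D" using B \<open>1 \<le> D\<close> by simp
  obtain k :: nat where k: "\<And>(n::nat) (\<phi> :: nat \<Rightarrow> nat \<Rightarrow> 'k). (\<forall>j<m. lps q {..<n} (\<phi> j) \<le> B * D) \<Longrightarrow>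
    (\<exists>\<alpha> \<gamma>. (\<forall>v. lps p {..<k} (\<lambda>l. \<Sum>i<n. \<alpha> l i * v i) \<le> lps p {..<n} v) \<and>
      (\<forall>t. lps p {..<n} (\<lambda>i. \<Sum>l<k. t l * \<gamma> l i) \<le> lps p {..<k} t) \<and>
      (\<forall>v. \<forall>j<m. norm (\<Sum>i<n. \<phi> j i * (v i - (\<Sum>l<k. (\<Sum>i'<n. \<alpha> l i' * v i') * \<gamma> l i)))
         \<le> \<epsilon>' * lps p {..<n} v))"
    using exists_block_projection[OF pq L0 \<epsilon>'(1), of m, where ?'k='k] by blast
  show ?thesis
  proof (intro exI[of _ k] allI impI)
    fix M :: "'x set" assume "finite M"
    obtain N n e \<phi> where MN: "M \<subseteq> N" and fr: "frame p D N n e \<phi>" using frames[OF \<open>finite M\<close>] by blast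
    \<comment> \<open>A second frame, around the images of the \<open>e i\<close> and the net
      points, supplies the functionals that norm the net points.\<close>
    have "finite ((\<lambda>i. T (e i)) ` {..<n} \<union> y ` {..<m})" by simp
    from frames[OF this] obtain N' n' e' \<phi>' where
      N': "(\<lambda>i. T (e i)) ` {..<n} \<union> y ` {..<m} \<subseteq> N'" and fr': "frame p D N' n' e' \<phi>'" by blast
    note F = frameD[OF fr] and F' = frameD[OF fr']
    have yN': "y j \<in> N'" if "j < m" for j using N' that by blast
    have TeN': "T (e i) \<in> N'" if "i < n" for i using N' that by blast
    have "\<exists>f. (\<Sum>i<n'. \<phi>' i (y j) * f i) = of_real (lps p {..<n'} (\<lambda>i. \<phi>' i (y j))) \<and> lps q {..<n'} f \<le> 1" for j
      by (rule exists_norming[OF conjugate_exponents_sym[OF pq]]) simp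
    then obtain f where f: "\<And>j. (\<Sum>i<n'. \<phi>' i (y j) * f j i) = of_real (lps p {..<n'} (\<lambda>i. \<phi>' i (y j)))"
      "\<And>j. lps q {..<n'} (f j) \<le> 1" by metis
    define X where "X v = (\<Sum>i<n. scale (v i) (e i))" for v
    define \<Lambda> where "\<Lambda> j z = (\<Sum>i<n'. f j i * \<phi>' i z)" for j z
    define \<Phi> where "\<Phi> j s = \<Lambda> j (T (e s))" for j s
    have TX: "T (X v) = (\<Sum>s<n. scale (v s) (T (e s)))" for v
      unfolding X_def by (rule lin_sum[OF T(1)])
    have TXN': "T (X v) \<in> N'" for v
      unfolding TX using F'(1) TeN' by (intro subspace_combination) auto
    have \<Lambda>: "functional_on N' (\<Lambda> j)" for j
      unfolding \<Lambda>_def using F'(2) by (intro functional_on_combination) auto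
    have key: "\<Lambda> j (T (X v)) = (\<Sum>s<n. \<Phi> j s * v s)" for j v
      unfolding TX \<Phi>_def using functional_on_sum[OF \<Lambda> F'(1), of "{..<n}" "\<lambda>s. T (e s)" j v] TeN'
      by (simp add: mult.commute)
    have \<Lambda>_le: "norm (\<Lambda> j z) \<le> norm z" if "z \<in> N'" for j z
    proof -
      have "norm (\<Lambda> j z) \<le> lps q {..<n'} (f j) * lps p {..<n'} (\<lambda>i. \<phi>' i z)"
        unfolding \<Lambda>_def by (rule holder[OF pq]) simp
      also have "\<dots> \<le> 1 * norm z" using f(2) F'(6)[OF that] by (intro mult_mono) auto
      finally show ?thesis by simp
    qed
    have "lps q {..<n} (\<Phi> j) \<le> B * D" for j
    proof (rule lps_dual_le[OF pq])
      fix v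
      have "norm (\<Sum>i<n. \<Phi> j i * v i) \<le> norm (T (X v))" unfolding key[symmetric] by (rule \<Lambda>_le[OF TXN'])
      also have "\<dots> \<le> B * norm (X v)" by (rule B)
      also have "\<dots> \<le> B * (D * lps p {..<n} v)" unfolding X_def using F(7) B(1) by (intro mult_left_mono)
      finally show "norm (\<Sum>i<n. \<Phi> j i * v i) \<le> B * D * lps p {..<n} v" by simp
    qed (use L0 in auto)
    then obtain \<alpha> \<gamma> where \<alpha>: "\<And>v. lps p {..<k} (\<lambda>l. \<Sum>i<n. \<alpha> l i * v i) \<le> lps p {..<n} v"
      and \<gamma>: "\<And>t. lps p {..<n} (\<lambda>i. \<Sum>l<k. t l * \<gamma> l i) \<le> lps p {..<k} t"
      and \<alpha>\<gamma>: "\<And>v j. j < m \<Longrightarrow> norm (\<Sum>i<n. \<Phi> j i * (v i - (\<Sum>l<k. (\<Sum>i'<n. \<alpha> l i' * v i') * \<gamma> l i)))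
         \<le> \<epsilon>' * lps p {..<n} v"
      using k[of n \<Phi>] by blast
    define a where "a l x = (\<Sum>i<n. \<alpha> l i * \<phi> i x)" for l x
    define c where "c l = X (\<gamma> l)" for l
    have comb: "(\<Sum>l<k. scale (t l) (c l)) = X (\<lambda>i. \<Sum>l<k. t l * \<gamma> l i)" for t
    proof -
      have "(\<Sum>l<k. scale (t l) (c l)) = (\<Sum>l<k. \<Sum>i<n. scale (t l * \<gamma> l i) (e i))"
        by (simp add: c_def X_def scale_sum_right)
      also have "\<dots> = (\<Sum>i<n. \<Sum>l<k. scale (t l * \<gamma> l i) (e i))" by (rule sum.swap)
      finally show ?thesis by (simp add: X_def scale_sum_left)
    qed
    have a_fun: "functional_on N (a l)" for l
      unfolding a_def using F(2) by (intro functional_on_combination) auto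
    have a_le: "lps p {..<k} (\<lambda>l. a l x) \<le> norm x" if "x \<in> N" for x
      unfolding a_def using \<alpha>[of "\<lambda>i. \<phi> i x"] F(6)[OF that] by simp
    have c_le: "norm (\<Sum>l<k. scale (t l) (c l)) \<le> D * lps p {..<k} t" for t
    proof -
      have "norm (\<Sum>l<k. scale (t l) (c l)) \<le> D * lps p {..<n} (\<lambda>i. \<Sum>l<k. t l * \<gamma> l i)"
        unfolding comb unfolding X_def by (rule F(7))
      also have "\<dots> \<le> D * lps p {..<k} t" using \<gamma> \<open>1 \<le> D\<close> by (intro mult_left_mono) auto
      finally show ?thesis .
    qed
    define S where "S x = T (x - (\<Sum>l<k. scale (a l x) (c l)))" for x
    have S1: "norm (S x) \<le> \<epsilon>" if x: "x \<in> N" "norm x \<le> 1" for x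
    proof -
      define w where "w i = \<phi> i x - (\<Sum>l<k. (\<Sum>i'<n. \<alpha> l i' * \<phi> i' x) * \<gamma> l i)" for i
      have xX: "x = X (\<lambda>i. \<phi> i x)" unfolding X_def by (rule F(4)[OF x(1)])
      have wX: "x - (\<Sum>l<k. scale (a l x) (c l)) = X w"
        unfolding comb by (subst xX) (simp add: X_def w_def a_def scale_left_diff_distrib sum_subtractf)
      have "norm (x - (\<Sum>l<k. scale (a l x) (c l))) \<le> norm x + norm (\<Sum>l<k. scale (a l x) (c l))"
        by (rule norm_triangle_ineq4)
      also have "norm (\<Sum>l<k. scale (a l x) (c l)) \<le> D * lps p {..<k} (\<lambda>l. a l x)" by (rule c_le)
      also have "\<dots> \<le> D * 1" using a_le[OF x(1)] x(2) \<open>1 \<le> D\<close> by (intro mult_left_mono) auto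
      finally have "norm (x - (\<Sum>l<k. scale (a l x) (c l))) \<le> 1 + D" using x(2) by simp
      then obtain j where j: "j < m" and near: "norm (S x - y j) < \<epsilon>'"
        using Y(2) unfolding S_def y by blast
      have SX: "S x = T (X w)" by (simp add: S_def wX)
      then have SN': "S x \<in> N'" using TXN' by simp
      have "norm (\<Lambda> j (S x)) \<le> \<epsilon>' * lps p {..<n} (\<lambda>i. \<phi> i x)"
        unfolding SX key w_def by (rule \<alpha>\<gamma>[OF j])
      also have "\<dots> \<le> \<epsilon>' * 1" using F(6)[OF x(1)] x(2) \<epsilon>'(1) by (intro mult_left_mono) auto
      finally have \<Lambda>S: "norm (\<Lambda> j (S x)) \<le> \<epsilon>'" by simp
      have "norm (y j) \<le> D * lps p {..<n'} (\<lambda>i. \<phi>' i (y j))"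
        using F'(7)[of "\<lambda>i. \<phi>' i (y j)"] F'(4)[OF yN'[OF j]] by simp
      also have "lps p {..<n'} (\<lambda>i. \<phi>' i (y j)) = norm (\<Lambda> j (y j))"
        using f(1)[of j] by (simp add: \<Lambda>_def mult.commute)
      also have "\<Lambda> j (y j) = \<Lambda> j (S x) - \<Lambda> j (S x - y j)"
        using functional_on_diff[OF \<Lambda> F'(1) SN' yN'[OF j], of j] by simp
      also have "norm \<dots> \<le> \<epsilon>' + \<epsilon>'"
      proof -
        have "norm (\<Lambda> j (S x - y j)) \<le> norm (S x - y j)"
          using subspace_diff[OF F'(1) SN' yN'[OF j]] by (rule \<Lambda>_le)
        then show ?thesis using \<Lambda>S near norm_triangle_ineq4[of "\<Lambda> j (S x)" "\<Lambda> j (S x - y j)"] by linarith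
      qed
      finally have "norm (y j) \<le> D * (\<epsilon>' + \<epsilon>')" using \<open>1 \<le> D\<close> by simp
      then show ?thesis using near \<epsilon>'(2) norm_triangle_sub[of "S x" "y j"] by linarith
    qed
    have S_le: "norm (S x) \<le> \<epsilon> * norm x" if x: "x \<in> N" for x
    proof (cases "x = 0")
      case True
      then show ?thesis using functional_on_zero[OF a_fun F(1)] lin_zero[OF T(1)] by (simp add: S_def)
    next
      case False
      define r :: 'k where "r = of_real (1 / norm x)"
      have "S (scale r x) = scale r (S x)"
        using functional_onD(2)[OF a_fun x]
        by (simp add: S_def linD(2)[OF T(1), symmetric] scale_right_diff_distrib scale_sum_right)
      moreover have "norm (S (scale r x)) \<le> \<epsilon>"
        using x F(1) False by (intro S1) (simp_all add: subspace_scale norm_scale r_def norm_divide)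
      ultimately show ?thesis using False by (simp add: norm_scale r_def norm_divide field_simps)
    qed
    have "approx_factorization p D \<epsilon> T N k a c"
      using a_fun a_le c_le S_le unfolding approx_factorization_def S_def by blast
    then show "\<exists>N a c. M \<subseteq> N \<and> approx_factorization p D \<epsilon> T N k a c" using MN by blast
  qed
qed

text \<open>
  The coordinates \<open>a\<close> are limits of coordinates on finite-dimensional subspaces. The vectors \<open>c\<close> need
  not converge, but their images under \<open>T\<close> lie in a totally bounded set.
\<close>

lemma compact_approximation:
  fixes T :: "'x \<Rightarrow> 'x"
  assumes pq: "conjugate_exponents p q" and "1 \<le> D"
    and frames: "\<And>M. finite M \<Longrightarrow> \<exists>N n e \<phi>. M \<subseteq> N \<and> frame p D N n e \<phi>"
    and T: "lin scale scale T" "totally_bounded_map T" and "0 < \<epsilon>"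
  shows "\<exists>k a c. approx_factorization p D \<epsilon> T UNIV k a c"
proof -
  have p0: "0 < p" using conjugate_exponentsD(1)[OF pq] by simp
  note bs = banach_space_axioms
  \<comment> \<open>One half of the error is spent on the finite-dimensional approximations, the
    other on replacing \<open>c M\<close> by a fixed \<open>c M0\<close>.\<close>
  have "0 < \<epsilon> / 2" using \<open>0 < \<epsilon>\<close> by simp
  from frame_approximation[OF pq \<open>1 \<le> D\<close> frames T this] obtain k where
    "\<And>M. finite M \<Longrightarrow> \<exists>N a c. M \<subseteq> N \<and> approx_factorization p D (\<epsilon> / 2) T N k a c"
    by blast
  then have "\<forall>M. \<exists>N a c. finite M \<longrightarrow> M \<subseteq> N \<and> approx_factorization p D (\<epsilon> / 2) T N k a c"
    by blast
  then obtain N a c where N: "\<And>M. finite M \<Longrightarrow> M \<subseteq> N M"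
    and fac: "\<And>M. finite M \<Longrightarrow> approx_factorization p D (\<epsilon> / 2) T (N M) k (a M) (c M)"
    unfolding choice_iff by blast
  note a = approx_factorizationD(1)[OF fac] and a_le = approx_factorizationD(2)[OF fac]
    and c_le = approx_factorizationD(3)[OF fac] and T_le = approx_factorizationD(4)[OF fac]
  obtain U where U: "ultra U" "U \<le> finite_subsets_at_top (UNIV :: 'x set)"
    using exists_ultra[OF finite_subsets_at_top_neq_bot] by blast
  have ne: "U \<noteq> bot" using U by (simp add: ultra_def)
  have ev: "eventually (\<lambda>M. finite M \<and> x \<in> N M) U" for x
    using eventually_subset_of_finite[OF U(2) N, of "{x}"] by simp
  have evfin: "eventually finite U" using ev[of 0] by eventually_elim simp
  have "\<exists>f. functional f \<and> (\<forall>x. ((\<lambda>M. a M l x) \<longlongrightarrow> f x) U)" if "l < k" for l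
  proof (rule exists_limit_functional[OF U N, where C=1])
    show "functional_on (N M) (a M l)" if "finite M" for M using a that \<open>l < k\<close> by blast
    show "norm (a M l x) \<le> 1 * norm x" if "finite M" "x \<in> N M" for M x
      using norm_le_lps[of "{..<k}" l p "\<lambda>l. a M l x"] a_le[OF that] p0 \<open>l < k\<close> by simp
  qed
  then have "\<forall>l. \<exists>f. l < k \<longrightarrow> functional f \<and> (\<forall>x. ((\<lambda>M. a M l x) \<longlongrightarrow> f x) U)" by blast
  then obtain A where A: "\<And>l. l < k \<Longrightarrow> functional (A l)"
    "\<And>l x. l < k \<Longrightarrow> ((\<lambda>M. a M l x) \<longlongrightarrow> A l x) U" by metis
  have A_le: "lps p {..<k} (\<lambda>l. A l x) \<le> norm x" for x
  proof (rule lps_tendsto_le[OF ne p0])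
    show "eventually (\<lambda>M. lps p {..<k} (\<lambda>l. a M l x) \<le> norm x) U"
      using ev[of x] by eventually_elim (use a_le in blast)
  qed (use A in auto)
  define \<delta> where "\<delta> = \<epsilon> / (4 * (real k + 1))"
  have \<delta>: "0 < \<delta>" "real k * (2 * \<delta>) \<le> \<epsilon> / 2"
    using \<open>0 < \<epsilon>\<close> by (auto simp: \<delta>_def field_simps)
  have D0: "0 < D" using \<open>1 \<le> D\<close> by simp
  obtain Y where Y: "finite Y" "\<And>x. norm x \<le> D \<Longrightarrow> \<exists>y\<in>Y. norm (T x - y) < \<delta>"
    using totally_bounded_map_radius[OF T(2,1) bs \<delta>(1) D0] by blast
  have "\<forall>x. \<exists>y. norm x \<le> D \<longrightarrow> y \<in> Y \<and> norm (T x - y) < \<delta>" using Y(2) by blast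
  then obtain rd where rd: "\<And>x. norm x \<le> D \<Longrightarrow> rd x \<in> Y" "\<And>x. norm x \<le> D \<Longrightarrow> norm (T x - rd x) < \<delta>"
    by metis
  have c1: "norm (c M l) \<le> D" if "finite M" "l < k" for M l
    by (rule norm_combination_unit[OF c_le[OF that(1)] that(2) p0])
  have "\<exists>y\<in>Y. eventually (\<lambda>M. rd (c M l) = y) U" if "l < k" for l
  proof (rule ultra_eventually_const[OF U(1) Y(1)])
    show "eventually (\<lambda>M. rd (c M l) \<in> Y) U"
      using evfin by eventually_elim (use c1 rd(1) that in blast)
  qed
  then have "\<forall>l. \<exists>y. l < k \<longrightarrow> eventually (\<lambda>M. rd (c M l) = y) U" by blast
  then obtain y where y: "\<And>l. l < k \<Longrightarrow> eventually (\<lambda>M. rd (c M l) = y l) U" by metis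
  have "eventually (\<lambda>M. \<forall>l\<in>{..<k}. rd (c M l) = y l) U"
    using y by (intro eventually_ball_finite) auto
  then have evy: "eventually (\<lambda>M. finite M \<and> (\<forall>l<k. rd (c M l) = y l)) U"
    using evfin by eventually_elim auto
  \<comment> \<open>Eventually all \<open>T (c M l)\<close> round to the same net points as for this
    one \<open>M0\<close>. This replaces convergence of the vectors: \<open>c M0\<close> keeps its
    norm bound, and under \<open>T\<close> it differs from \<open>c M\<close> by at most
    \<open>2 * \<delta>\<close> in each coordinate.\<close>
  obtain M0 where M0: "finite M0" "\<And>l. l < k \<Longrightarrow> rd (c M0 l) = y l"
    using eventually_happens'[OF ne evy] by blast
  have near: "norm (T (c M l) - T (c M0 l)) \<le> 2 * \<delta>" if "finite M" "rd (c M l) = y l" "l < k" for M l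
  proof -
    have "norm (T (c M l) - y l) < \<delta>" "norm (T (c M0 l) - y l) < \<delta>"
      using rd(2)[OF c1[OF that(1,3)]] rd(2)[OF c1[OF M0(1) that(3)]] M0(2)[OF that(3)] that(2) by auto
    then show ?thesis using norm_triangle_ineq4[of "T (c M l) - y l" "T (c M0 l) - y l"] by simp
  qed
  have "norm (T (x - (\<Sum>l<k. scale (A l x) (c M0 l)))) \<le> \<epsilon> * norm x" for x
  proof (rule Lim_norm_ubound[OF ne])
    let ?G = "\<lambda>b. T x - (\<Sum>l<k. scale (b l) (T (c M0 l)))"
    have Teq: "T (x - (\<Sum>l<k. scale (b l) (z l))) = T x - (\<Sum>l<k. scale (b l) (T (z l)))" for b z
      by (simp add: lin_diff[OF T(1)] lin_sum[OF T(1)])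
    show "((\<lambda>M. ?G (\<lambda>l. a M l x)) \<longlongrightarrow> T (x - (\<Sum>l<k. scale (A l x) (c M0 l)))) U"
      unfolding Teq using A(2) by (intro tendsto_diff tendsto_const tendsto_sum tendsto_scale_left) auto
    show "eventually (\<lambda>M. norm (?G (\<lambda>l. a M l x)) \<le> \<epsilon> * norm x) U"
      using evy ev[of x]
    proof eventually_elim
      case (elim M)
      have eq: "?G (\<lambda>l. a M l x) = T (x - (\<Sum>l<k. scale (a M l x) (c M l)))
          + (\<Sum>l<k. scale (a M l x) (T (c M l) - T (c M0 l)))"
        unfolding Teq by (simp add: scale_right_diff_distrib sum_subtractf)
      have "norm (\<Sum>l<k. scale (a M l x) (T (c M l) - T (c M0 l))) \<le> (\<Sum>l<k. norm x * (2 * \<delta>))"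
      proof (intro order_trans[OF norm_sum] sum_mono)
        fix l assume l: "l \<in> {..<k}"
        have "norm (a M l x) \<le> norm x"
          using norm_le_lps[of "{..<k}" l p "\<lambda>l. a M l x"] a_le[of M x] elim l p0 by simp
        then show "norm (scale (a M l x) (T (c M l) - T (c M0 l))) \<le> norm x * (2 * \<delta>)"
          unfolding norm_scale using near[of M l] elim l \<delta> by (intro mult_mono) auto
      qed
      also have "\<dots> = (real k * (2 * \<delta>)) * norm x" by simp
      also have "\<dots> \<le> \<epsilon> / 2 * norm x" using \<delta>(2) by (intro mult_right_mono) auto
      finally show ?case
        unfolding eq using T_le[of M x] elim by (intro order_trans[OF norm_triangle_ineq]) auto
    qed
  qed
  then have "approx_factorization p D \<epsilon> T UNIV k A (c M0)"
    using A(1) A_le c_le[OF M0(1)] unfolding approx_factorization_def by blast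
  then show ?thesis by blast
qed

end

section \<open>Complemented copies of \<open>\<ell>\<^sub>p\<^sup>k\<close>\<close>

context banach_space
begin

text \<open>\<open>x\<close> spans a copy of \<open>\<ell>\<^sub>p\<^sup>k\<close> onto which \<open>y \<mapsto> (\<Sum>i<k. scale (B i y) (x i))\<close> projects.\<close>

definition complemented_copy ::
  "real \<Rightarrow> real \<Rightarrow> real \<Rightarrow> nat \<Rightarrow> (nat \<Rightarrow> 'x) \<Rightarrow> (nat \<Rightarrow> 'x \<Rightarrow> 'k) \<Rightarrow> bool"
  where "complemented_copy p C C' k x B \<longleftrightarrow>
    (\<forall>i<k. functional (B i)) \<and>
    (\<forall>y. lps p {..<k} (\<lambda>i. B i y) \<le> C * norm y) \<and>
    (\<forall>t. norm (\<Sum>i<k. scale (t i) (x i)) \<le> C' * lps p {..<k} t) \<and>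
    (\<forall>i<k. \<forall>j<k. B i (x j) = (if i = j then 1 else 0))"

lemma complemented_copyD:
  assumes "complemented_copy p C C' k x B"
  shows "\<And>i. i < k \<Longrightarrow> functional (B i)"
    "\<And>y. lps p {..<k} (\<lambda>i. B i y) \<le> C * norm y"
    "\<And>t. norm (\<Sum>i<k. scale (t i) (x i)) \<le> C' * lps p {..<k} t"
    "\<And>i j. i < k \<Longrightarrow> j < k \<Longrightarrow> B i (x j) = (if i = j then 1 else 0)"
  using assms unfolding complemented_copy_def by blast+

lemma sum_scale_swap:
  "(\<Sum>l\<in>I. scale (t l) (\<Sum>j\<in>J. scale (P j l) (x j))) = (\<Sum>j\<in>J. scale (\<Sum>l\<in>I. P j l * t l) (x j))"
proof -
  have "(\<Sum>l\<in>I. scale (t l) (\<Sum>j\<in>J. scale (P j l) (x j))) = (\<Sum>l\<in>I. \<Sum>j\<in>J. scale (P j l * t l) (x j))"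
    by (simp add: scale_sum_right mult.commute)
  also have "\<dots> = (\<Sum>j\<in>J. \<Sum>l\<in>I. scale (P j l * t l) (x j))" by (rule sum.swap)
  finally show ?thesis by (simp add: scale_sum_left)
qed

lemma norm_combination_subset:
  fixes m k :: nat
  assumes x: "\<And>t. norm (\<Sum>i<m. scale (t i) (x i)) \<le> C * lps p {..<m} t"
    and \<sigma>: "inj_on \<sigma> {..<k}" "\<And>i. i < k \<Longrightarrow> \<sigma> i < m" and "0 < p"
  shows "norm (\<Sum>i<k. scale (t i) (x (\<sigma> i))) \<le> C * lps p {..<k} t"
proof -
  define s where "s i = (if i \<in> \<sigma> ` {..<k} then t (inv_into {..<k} \<sigma> i) else 0)" for i
  have s: "s (\<sigma> i) = t i" if "i < k" for i using that \<sigma>(1) by (simp add: s_def)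
  have sub: "\<sigma> ` {..<k} \<subseteq> {..<m}" using \<sigma>(2) by auto
  have "(\<Sum>i<m. scale (s i) (x i)) = (\<Sum>i\<in>\<sigma> ` {..<k}. scale (s i) (x i))"
    using sub by (intro sum.mono_neutral_right) (auto simp: s_def)
  also have "\<dots> = (\<Sum>i<k. scale (t i) (x (\<sigma> i)))"
    using \<sigma>(1) s by (simp add: sum.reindex)
  finally have 1: "(\<Sum>i<k. scale (t i) (x (\<sigma> i))) = (\<Sum>i<m. scale (s i) (x i))" ..
  have "(\<Sum>i<m. norm (s i) powr p) = (\<Sum>i\<in>\<sigma> ` {..<k}. norm (s i) powr p)"
    using sub by (intro sum.mono_neutral_right) (auto simp: s_def)
  also have "\<dots> = (\<Sum>i<k. norm (t i) powr p)" using \<sigma>(1) s by (simp add: sum.reindex)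
  finally have "lps p {..<m} s = lps p {..<k} t" by (simp add: lps_def)
  then show ?thesis using x[of s] unfolding 1 by simp
qed

text \<open>The vectors \<open>x\<close> are fixed before the finite sets \<open>M\<close>. Larger
  frames then contain them in coordinates, disjointification gives functionals on each frame, and
  bounds and diagonal sum pass to the ultralimit. Only the sum of the diagonal is controlled, not
  each entry, so a selection of indices has to follow.\<close>

lemma exists_limit_functionals:
  assumes pq: "conjugate_exponents p q" and "1 \<le> D" and "infinite_dimensional"
    and frames: "\<And>M. finite M \<Longrightarrow> \<exists>N n e \<phi>. M \<subseteq> N \<and> frame p D N n e \<phi>"
  shows "\<exists>c>0. \<forall>m. \<exists>x B. (\<forall>i<m. functional (B i)) \<and>
    (\<forall>y. lps p {..<m} (\<lambda>i. B i y) \<le> D * norm y) \<and>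
    (\<forall>t. norm (\<Sum>i<m. scale (t i) (x i)) \<le> D * lps p {..<m} t) \<and>
    c * real m \<le> (\<Sum>i<m. norm (B i (x i)))"
proof -
  have p0: "0 < p" using conjugate_exponentsD(1)[OF pq] by simp
  have D0: "0 \<le> D" using \<open>1 \<le> D\<close> by simp
  obtain c where "0 < c" and c: "\<And>(m::nat) (n::nat) (u :: nat \<Rightarrow> nat \<Rightarrow> 'k).
    (\<forall>t. lps p {..<m} t \<le> D * lps p {..<n} (\<lambda>s. \<Sum>i<m. t i * u i s)) \<Longrightarrow>
    (\<forall>t. lps p {..<n} (\<lambda>s. \<Sum>i<m. t i * u i s) \<le> D * lps p {..<m} t) \<Longrightarrow>
    (\<exists>g r. (\<forall>v. lps p {..<m} (\<lambda>i. \<Sum>s<n. g i s * v s) \<le> D * lps p {..<n} v) \<and>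
      (\<forall>i<m. 0 \<le> r i \<and> (\<Sum>s<n. g i s * u i s) = of_real (r i)) \<and>
      c * real m \<le> (\<Sum>i<m. r i))"
    using exists_disjoint_functionals[OF pq \<open>1 \<le> D\<close>, where ?'k='k] by blast
  show ?thesis
  proof (intro exI[of _ c] conjI allI)
    show "0 < c" by fact
    fix m :: nat
    \<comment> \<open>Infinite dimension enters here: a frame around \<open>m\<close> independent
      vectors has at least \<open>m\<close> basis vectors, and the first \<open>m\<close> of them
      are used.\<close>
    obtain M0 where M0: "finite M0" "card M0 = m" "independent M0"
      using exists_large_independent[OF \<open>infinite_dimensional\<close>] by blast
    obtain N0 n0 x \<phi>0 where "M0 \<subseteq> N0" and fr0: "frame p D N0 n0 x \<phi>0" using frames[OF M0(1)] by blast
    then have mn: "m \<le> n0" using frame_card_le[OF fr0 M0(1) _ M0(3)] M0(2) by simp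
    note F0 = frameD[OF fr0]
    have x_upper: "norm (\<Sum>i<m. scale (t i) (x i)) \<le> D * lps p {..<m} t" for t
      using norm_combination_subset[OF F0(7), of "\<lambda>i. i" m t] mn p0 by simp
    have x_lower: "lps p {..<m} t \<le> norm (\<Sum>i<m. scale (t i) (x i))" for t
    proof -
      define s where "s i = (if i < m then t i else 0)" for i
      have "(\<Sum>i<n0. scale (s i) (x i)) = (\<Sum>i<m. scale (s i) (x i))"
        using mn by (intro sum.mono_neutral_right) (auto simp: s_def)
      then have eq: "(\<Sum>i<n0. scale (s i) (x i)) = (\<Sum>i<m. scale (t i) (x i))" by (simp add: s_def)
      have "lps p {..<m} t = lps p {..<m} s" by (rule lps_cong) (simp add: s_def)
      also have "\<dots> \<le> lps p {..<n0} s" using mn p0 by (intro lps_mono_set) auto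
      also have "\<dots> = lps p {..<n0} (\<lambda>i. \<phi>0 i (\<Sum>j<n0. scale (s j) (x j)))"
        by (rule lps_cong) (simp add: F0(5))
      also have "\<dots> \<le> norm (\<Sum>j<n0. scale (s j) (x j))"
        using F0(1,3) by (intro F0(6) subspace_combination) auto
      finally show ?thesis unfolding eq .
    qed
    have "\<exists>N b. finite M \<longrightarrow> M \<subseteq> N \<and> (\<forall>i<m. functional_on N (b i)) \<and>
        (\<forall>y\<in>N. lps p {..<m} (\<lambda>i. b i y) \<le> D * norm y) \<and>
        c * real m \<le> (\<Sum>i<m. norm (b i (x i)))" for M
    proof (cases "finite M")
      case True
      then have "finite (M \<union> x ` {..<m})" by simp
      from frames[OF this] obtain N n e \<phi> where MN: "M \<union> x ` {..<m} \<subseteq> N" and fr: "frame p D N n e \<phi>"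
        by blast
      note F = frameD[OF fr]
      have xN: "x i \<in> N" if "i < m" for i using MN that by blast
      define u where "u i s = \<phi> s (x i)" for i s
      define X where "X t = (\<Sum>i<m. scale (t i) (x i))" for t
      have XN: "X t \<in> N" for t unfolding X_def using F(1) xN by (intro subspace_combination) auto
      have uX: "(\<Sum>i<m. t i * u i s) = \<phi> s (X t)" if "s < n" for t s
        unfolding X_def u_def using functional_on_sum[OF F(2)[OF that] F(1), of "{..<m}" x t] xN by simp
      have lpsX: "lps p {..<n} (\<lambda>s. \<Sum>i<m. t i * u i s) = lps p {..<n} (\<lambda>s. \<phi> s (X t))" for t
        by (rule lps_cong) (simp add: uX)
      have lower: "\<forall>t. lps p {..<m} t \<le> D * lps p {..<n} (\<lambda>s. \<Sum>i<m. t i * u i s)"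
      proof
        fix t
        have "lps p {..<m} t \<le> norm (X t)" unfolding X_def by (rule x_lower)
        also have "norm (X t) = norm (\<Sum>s<n. scale (\<phi> s (X t)) (e s))" using F(4)[OF XN] by metis
        also have "\<dots> \<le> D * lps p {..<n} (\<lambda>s. \<phi> s (X t))" by (rule F(7))
        finally show "lps p {..<m} t \<le> D * lps p {..<n} (\<lambda>s. \<Sum>i<m. t i * u i s)" unfolding lpsX .
      qed
      have upper: "\<forall>t. lps p {..<n} (\<lambda>s. \<Sum>i<m. t i * u i s) \<le> D * lps p {..<m} t"
        unfolding lpsX using order_trans[OF F(6)[OF XN] x_upper[folded X_def]] by blast
      obtain g r where g: "\<And>v. lps p {..<m} (\<lambda>i. \<Sum>s<n. g i s * v s) \<le> D * lps p {..<n} v"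
        and r: "\<And>i. i < m \<Longrightarrow> 0 \<le> r i" "\<And>i. i < m \<Longrightarrow> (\<Sum>s<n. g i s * u i s) = of_real (r i)"
        "c * real m \<le> (\<Sum>i<m. r i)"
        using c[OF lower upper] by blast
      define b where "b i y = (\<Sum>s<n. g i s * \<phi> s y)" for i y
      have "functional_on N (b i)" for i
        unfolding b_def using F(2) by (intro functional_on_combination) auto
      moreover have "lps p {..<m} (\<lambda>i. b i y) \<le> D * norm y" if "y \<in> N" for y
        unfolding b_def using g[of "\<lambda>s. \<phi> s y"] mult_left_mono[OF F(6)[OF that] D0] by linarith
      moreover have "c * real m \<le> (\<Sum>i<m. norm (b i (x i)))"
        using r by (simp add: b_def u_def)
      ultimately show ?thesis using MN by blast
    qed simp
    then have "\<forall>M. \<exists>N b. finite M \<longrightarrow> M \<subseteq> N \<and> (\<forall>i<m. functional_on N (b i)) \<and>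
        (\<forall>y\<in>N. lps p {..<m} (\<lambda>i. b i y) \<le> D * norm y) \<and>
        c * real m \<le> (\<Sum>i<m. norm (b i (x i)))" ..
    then obtain N b where all: "\<forall>M. finite M \<longrightarrow> M \<subseteq> N M \<and> (\<forall>i<m. functional_on (N M) (b M i)) \<and>
        (\<forall>y\<in>N M. lps p {..<m} (\<lambda>i. b M i y) \<le> D * norm y) \<and>
        c * real m \<le> (\<Sum>i<m. norm (b M i (x i)))"
      unfolding choice_iff by blast
    have N: "M \<subseteq> N M" and b: "\<And>i. i < m \<Longrightarrow> functional_on (N M) (b M i)"
      and b_le: "\<And>y. y \<in> N M \<Longrightarrow> lps p {..<m} (\<lambda>i. b M i y) \<le> D * norm y"
      and b_c: "c * real m \<le> (\<Sum>i<m. norm (b M i (x i)))" if "finite M" for M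
      using all[rule_format, OF that] by blast+
    obtain U where U: "ultra U" "U \<le> finite_subsets_at_top (UNIV :: 'x set)"
      using exists_ultra[OF finite_subsets_at_top_neq_bot] by blast
    have ne: "U \<noteq> bot" using U by (simp add: ultra_def)
    have ev: "eventually (\<lambda>M. finite M \<and> y \<in> N M) U" for y
      using eventually_subset_of_finite[OF U(2) N, of "{y}"] by simp
    have "\<exists>f. functional f \<and> (\<forall>y. ((\<lambda>M. b M i y) \<longlongrightarrow> f y) U)" if "i < m" for i
    proof (rule exists_limit_functional[OF U N, where C=D])
      show "functional_on (N M) (b M i)" if "finite M" for M using b[OF that \<open>i < m\<close>] .
      show "norm (b M i y) \<le> D * norm y" if "finite M" "y \<in> N M" for M y
        using norm_le_lps[of "{..<m}" i p "\<lambda>i. b M i y"] b_le[OF that] p0 \<open>i < m\<close> by simp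
    qed
    then have "\<forall>i. \<exists>f. i < m \<longrightarrow> functional f \<and> (\<forall>y. ((\<lambda>M. b M i y) \<longlongrightarrow> f y) U)" by blast
    then obtain B where B: "\<And>i. i < m \<Longrightarrow> functional (B i)"
      "\<And>i y. i < m \<Longrightarrow> ((\<lambda>M. b M i y) \<longlongrightarrow> B i y) U" by metis
    have "lps p {..<m} (\<lambda>i. B i y) \<le> D * norm y" for y
    proof (rule lps_tendsto_le[OF ne p0])
      show "eventually (\<lambda>M. lps p {..<m} (\<lambda>i. b M i y) \<le> D * norm y) U"
        using ev[of y] by eventually_elim (use b_le in blast)
    qed (use B D0 in auto)
    moreover have "c * real m \<le> (\<Sum>i<m. norm (B i (x i)))"
    proof (rule tendsto_lowerbound[OF _ _ ne])
      show "((\<lambda>M. \<Sum>i<m. norm (b M i (x i))) \<longlongrightarrow> (\<Sum>i<m. norm (B i (x i)))) U"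
        using B(2) by (intro tendsto_sum tendsto_norm) auto
      show "eventually (\<lambda>M. c * real m \<le> (\<Sum>i<m. norm (b M i (x i)))) U"
        using ev[of 0] by eventually_elim (use b_c in blast)
    qed
    ultimately show "\<exists>x B. (\<forall>i<m. functional (B i)) \<and>
      (\<forall>y. lps p {..<m} (\<lambda>i. B i y) \<le> D * norm y) \<and>
      (\<forall>t. norm (\<Sum>i<m. scale (t i) (x i)) \<le> D * lps p {..<m} t) \<and>
      c * real m \<le> (\<Sum>i<m. norm (B i (x i)))"
      using B(1) x_upper by blast
  qed
qed

text \<open>Among many vectors, \<open>k\<close> are selected on which the matrix of functional
  values is nearly diagonal; the functionals are divided by the diagonal and the vectors corrected
  by the inverse matrix. \<open>C\<close> dominates \<open>2 * D / c\<close> for the functionals,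
  whose diagonal is at least \<open>c / 2\<close>, and \<open>2 * D\<close> for the vectors, where
  the inverse matrix costs 2.\<close>

lemma exists_complemented_copy:
  assumes pq: "conjugate_exponents p q" and "1 \<le> D" and inf: "infinite_dimensional"
    and frames: "\<And>M. finite M \<Longrightarrow> \<exists>N n e \<phi>. M \<subseteq> N \<and> frame p D N n e \<phi>"
  shows "\<exists>C\<ge>1. \<forall>k. \<exists>x B. complemented_copy p C C k x B"
proof -
  have p1: "1 < p" and p0: "0 < p" using conjugate_exponentsD(1)[OF pq] by simp_all
  obtain c where "0 < c" and c: "\<And>m. \<exists>x B. (\<forall>i<m. functional (B i)) \<and>
    (\<forall>y. lps p {..<m} (\<lambda>i. B i y) \<le> D * norm y) \<and>
    (\<forall>t. norm (\<Sum>i<m. scale (t i) (x i)) \<le> D * lps p {..<m} t) \<and>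
    c * real m \<le> (\<Sum>i<m. norm (B i (x i)))"
    using exists_limit_functionals[OF pq \<open>1 \<le> D\<close> inf frames] by blast
  define C where "C = 2 * D + 2 * D / c"
  have C: "2 * D \<le> C" "2 / c * D \<le> C" "1 \<le> C"
    using \<open>1 \<le> D\<close> \<open>0 < c\<close> by (auto simp: C_def add_increasing2)
  show ?thesis
  proof (intro exI[of _ C] conjI allI)
    show "1 \<le> C" by (rule C)
    fix k :: nat
    \<comment> \<open>After division by diagonal entries of norm at least \<open>c / 2\<close>,
      off-diagonal entries are at most \<open>1 / (2 * (k + 1)^2)\<close>, as
      \<open>exists_right_inverse\<close> requires. The shift to \<open>k + 1\<close> keeps
      \<open>\<delta>\<close> defined and positive for \<open>k = 0\<close>.\<close>
    define \<delta> where "\<delta> = c / (4 * (real k + 1)\<^sup>2)"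
    have \<delta>: "0 < \<delta>" using \<open>0 < c\<close> by (simp add: \<delta>_def)
    have DD: "0 < D * D" using \<open>1 \<le> D\<close> by simp
    obtain m where m: "\<And>G :: nat \<Rightarrow> nat \<Rightarrow> 'k.
      (\<forall>j<m. lps p {..<m} (\<lambda>i. G i j) \<le> D * D) \<Longrightarrow> c * real m \<le> (\<Sum>i<m. norm (G i i)) \<Longrightarrow>
      (\<exists>\<sigma>. inj_on \<sigma> {..<k} \<and> (\<forall>i<k. \<sigma> i < m \<and> c / 2 \<le> norm (G (\<sigma> i) (\<sigma> i))) \<and>
      (\<forall>i<k. \<forall>j<k. i \<noteq> j \<longrightarrow> norm (G (\<sigma> i) (\<sigma> j)) \<le> \<delta>))"
      using exists_principal_submatrix[OF p1 \<open>0 < c\<close> DD \<delta>, of k, where ?'k='k] by blast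
    obtain x B where B: "\<And>i. i < m \<Longrightarrow> functional (B i)"
      "\<And>y. lps p {..<m} (\<lambda>i. B i y) \<le> D * norm y"
      and x: "\<And>t. norm (\<Sum>i<m. scale (t i) (x i)) \<le> D * lps p {..<m} t"
      and tr: "c * real m \<le> (\<Sum>i<m. norm (B i (x i)))"
      using c[of m] by blast
    have col: "\<forall>j<m. lps p {..<m} (\<lambda>i. B i (x j)) \<le> D * D"
    proof (intro allI impI)
      fix j assume "j < m"
      then have "norm (x j) \<le> D" using norm_combination_unit[OF x] p0 by blast
      then have "D * norm (x j) \<le> D * D" using \<open>1 \<le> D\<close> by (intro mult_left_mono) auto
      then show "lps p {..<m} (\<lambda>i. B i (x j)) \<le> D * D" using B(2)[of "x j"] by linarith
    qed
    obtain \<sigma> where \<sigma>: "inj_on \<sigma> {..<k}" "\<And>i. i < k \<Longrightarrow> \<sigma> i < m"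
      "\<And>i. i < k \<Longrightarrow> c / 2 \<le> norm (B (\<sigma> i) (x (\<sigma> i)))"
      "\<And>i j. i < k \<Longrightarrow> j < k \<Longrightarrow> i \<noteq> j \<Longrightarrow> norm (B (\<sigma> i) (x (\<sigma> j))) \<le> \<delta>"
      using m[OF col tr] by blast
    define d where "d i = B (\<sigma> i) (x (\<sigma> i))" for i
    have dn: "c / 2 \<le> norm (d i)" and d0: "d i \<noteq> 0" if "i < k" for i
      using \<sigma>(3)[OF that] \<open>0 < c\<close> by (auto simp: d_def)
    define B' where "B' i y = B (\<sigma> i) y / d i" for i y
    have B'_le: "norm (B' i y) \<le> 2 / c * norm (B (\<sigma> i) y)" if "i < k" for i y
    proof -
      have "norm (B (\<sigma> i) y) / norm (d i) \<le> norm (B (\<sigma> i) y) / (c / 2)"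
        using dn[OF that] \<open>0 < c\<close> by (intro divide_left_mono) (auto intro!: mult_pos_pos)
      then show ?thesis by (simp add: B'_def norm_divide mult.commute)
    qed
    define M where "M i j = B' i (x (\<sigma> j))" for i j
    have "\<exists>P. (\<forall>i<k. \<forall>l<k. (\<Sum>j<k. M i j * P j l) = (if i = l then 1 else 0)) \<and>
      (\<forall>t. lps p {..<k} (\<lambda>j. \<Sum>l<k. P j l * t l) \<le> 2 * lps p {..<k} t)"
    proof (rule exists_right_inverse[OF pq])
      fix i j assume i: "i < k" and j: "j < k"
      show "norm (M i j - (if i = j then 1 else 0)) \<le> 1 / (2 * (real k)\<^sup>2)"
      proof (cases "i = j")
        case True
        then show ?thesis using d0[OF i] by (simp add: M_def B'_def d_def)
      next
        case False
        have "norm (M i j) \<le> 2 / c * \<delta>"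
          unfolding M_def using B'_le[OF i, of "x (\<sigma> j)"] mult_left_mono[OF \<sigma>(4)[OF i j False], of "2 / c"] \<open>0 < c\<close>
          by simp
        also have "2 / c * \<delta> = 1 / (2 * (real k + 1)\<^sup>2)" using \<open>0 < c\<close> by (simp add: \<delta>_def)
        also have "\<dots> \<le> 1 / (2 * (real k)\<^sup>2)"
          using i by (intro divide_left_mono mult_left_mono power_mono mult_pos_pos) auto
        finally show ?thesis using False by simp
      qed
    qed
    then obtain P where P: "\<And>i l. i < k \<Longrightarrow> l < k \<Longrightarrow> (\<Sum>j<k. M i j * P j l) = (if i = l then 1 else 0)"
      and P_le: "\<And>t. lps p {..<k} (\<lambda>j. \<Sum>l<k. P j l * t l) \<le> 2 * lps p {..<k} t" by blast
    \<comment> \<open>Correcting the vectors rather than the functionals leaves the bound for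
      \<open>B'\<close> untouched.\<close>
    define x' where "x' l = (\<Sum>j<k. scale (P j l) (x (\<sigma> j)))" for l
    have B': "functional (B' i)" if "i < k" for i
      using B(1)[OF \<sigma>(2)[OF that]] unfolding functional_on_def B'_def by (simp add: add_divide_distrib)
    have "complemented_copy p C C k x' B'"
      unfolding complemented_copy_def
    proof (intro conjI allI impI)
      show "functional (B' i)" if "i < k" for i by (rule B'[OF that])
      fix y
      have "(\<Sum>i<k. norm (B' i y) powr p) \<le> (\<Sum>i<k. norm (2 / c * norm (B (\<sigma> i) y)) powr p)"
        using B'_le p0 \<open>0 < c\<close> by (intro sum_mono powr_mono2) auto
      then have "lps p {..<k} (\<lambda>i. B' i y) \<le> lps p {..<k} (\<lambda>i. 2 / c * norm (B (\<sigma> i) y))"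
        unfolding lps_def using p0 by (intro powr_mono2) (auto intro: sum_nonneg)
      also have "\<dots> = 2 / c * lps p {..<k} (\<lambda>i. norm (B (\<sigma> i) y))"
        unfolding lps_mult[OF p0] using \<open>0 < c\<close> by simp
      also have "lps p {..<k} (\<lambda>i. norm (B (\<sigma> i) y)) = lps p (\<sigma> ` {..<k}) (\<lambda>i. B i y)"
        unfolding lps_reindex[OF \<sigma>(1)] by (rule lps_def[THEN trans]) (simp add: lps_def)
      also have "2 / c * \<dots> \<le> 2 / c * (D * norm y)"
      proof (rule mult_left_mono)
        have "lps p (\<sigma> ` {..<k}) (\<lambda>i. B i y) \<le> lps p {..<m} (\<lambda>i. B i y)"
          using \<sigma>(2) p0 by (intro lps_mono_set) auto
        then show "lps p (\<sigma> ` {..<k}) (\<lambda>i. B i y) \<le> D * norm y" using B(2)[of y] by simp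
      qed (use \<open>0 < c\<close> in simp)
      also have "\<dots> = (2 / c * D) * norm y" by simp
      also have "\<dots> \<le> C * norm y" using C(2) by (rule mult_right_mono) simp
      finally show "lps p {..<k} (\<lambda>i. B' i y) \<le> C * norm y" .
    next
      fix t
      have "norm (\<Sum>l<k. scale (t l) (x' l)) \<le> D * lps p {..<k} (\<lambda>j. \<Sum>l<k. P j l * t l)"
        unfolding x'_def sum_scale_swap
        by (rule norm_combination_subset[OF x \<sigma>(1,2) p0])
      also have "\<dots> \<le> D * (2 * lps p {..<k} t)" using P_le \<open>1 \<le> D\<close> by (intro mult_left_mono) auto
      also have "\<dots> = (2 * D) * lps p {..<k} t" by simp
      also have "\<dots> \<le> C * lps p {..<k} t" using C(1) by (rule mult_right_mono) simp
      finally show "norm (\<Sum>l<k. scale (t l) (x' l)) \<le> C * lps p {..<k} t" .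
    next
      fix i l assume "i < k" "l < k"
      then show "B' i (x' l) = (if i = l then 1 else 0)"
        using functional_on_sum[OF B'[OF \<open>i < k\<close>], of "{..<k}" "\<lambda>j. x (\<sigma> j)" "\<lambda>j. P j l"] P[of i l]
        by (simp add: x'_def M_def mult.commute)
    qed
    then show "\<exists>x B. complemented_copy p C C k x B" by blast
  qed
qed

text \<open>In a copy of dimension \<open>k * (card G + 1)\<close>, each block of
  \<open>card G + 1\<close> functionals has a nontrivial combination that kills \<open>G\<close>.
  Normalised in the dual norm and paired with a vector of the block that norms it, these
  combinations form a copy of dimension \<open>k\<close> with the same constants.\<close>

lemma exists_complemented_copy_annihilating:
  assumes pq: "conjugate_exponents p q"
    and copies: "\<And>k. \<exists>x B. complemented_copy p C C k x B" and "0 \<le> C" "finite G"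
  shows "\<exists>x B. complemented_copy p C C k x B \<and> (\<forall>i<k. \<forall>y\<in>G. B i y = 0)"
proof -
  note D = conjugate_exponentsD[OF pq]
  have p0: "0 < p" and q0: "0 < q" using D by simp_all
  define g where "g = card G + 1"
  define \<beta> where "\<beta> s = s div g" for s
  have g0: "0 < g" by (simp add: g_def)
  obtain x B where cc: "complemented_copy p C C (k * g) x B" using copies by blast
  note X = complemented_copyD[OF cc]
  define S where "S i = {s\<in>{..<k * g}. \<beta> s = i}" for i
  have \<beta>k: "\<beta> s < k" if "s < k * g" for s using that by (simp add: \<beta>_def less_mult_imp_div_less)
  have cS: "card (S i) = g" if "i < k" for i
  proof -
    have "S i = {i * g..<i * g + g}"
    proof (intro set_eqI iffI)
      fix s assume "s \<in> S i"
      then show "s \<in> {i * g..<i * g + g}"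
        using g0 by (auto simp: S_def \<beta>_def dividend_less_times_div) 
           (metis add.commute dividend_less_times_div mult.commute)
    next
      fix s assume s: "s \<in> {i * g..<i * g + g}"
      then have "s div g = i" using g0 by (intro div_nat_eqI) (auto simp: mult.commute)
      moreover have "s < k * g"
      proof -
        have "s < Suc i * g" using s by simp
        also have "\<dots> \<le> k * g" using that by (intro mult_right_mono) auto
        finally show ?thesis .
      qed
      ultimately show "s \<in> S i" by (simp add: S_def \<beta>_def)
    qed
    then show ?thesis by simp
  qed
  have "\<exists>f h. i < k \<longrightarrow> (\<forall>y\<in>G. (\<Sum>s\<in>S i. f s * B s y) = 0) \<and> lps q (S i) f \<le> 1 \<and>
      lps p (S i) h \<le> 1 \<and> (\<Sum>s\<in>S i. f s * h s) = 1" for i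
  proof (cases "i < k")
    case True
    have "card G < card (S i)" using cS[OF True] by (simp add: g_def)
    then obtain t where t: "\<exists>s\<in>S i. t s \<noteq> 0" "\<And>y. y \<in> G \<Longrightarrow> (\<Sum>s\<in>S i. B s y * t s) = 0"
      using exists_nontrivial_kernel[of G "S i" "\<lambda>y s. B s y"] \<open>finite G\<close> by (auto simp: S_def)
    define r where "r = lps q (S i) t"
    have "r \<noteq> 0" using t(1) lps_eq_0D[of q "S i" t] q0 by (auto simp: r_def S_def)
    then have r: "0 < r" by (simp add: r_def less_le)
    define f where "f s = (1 / of_real r) * t s" for s
    have f1: "lps q (S i) f = 1"
      unfolding f_def lps_mult[OF q0] using r by (simp add: norm_divide r_def[symmetric])
    have "(\<Sum>s\<in>S i. f s * B s y) = 0" if "y \<in> G" for y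
    proof -
      have "(\<Sum>s\<in>S i. f s * B s y) = (1 / of_real r) * (\<Sum>s\<in>S i. B s y * t s)"
        unfolding sum_distrib_left by (simp add: f_def mult_ac)
      then show ?thesis using t(2)[OF that] by simp
    qed
    moreover obtain h where "(\<Sum>s\<in>S i. f s * h s) = of_real (lps q (S i) f)" "lps p (S i) h \<le> 1"
      using exists_norming[OF pq, of "S i" f] by (auto simp: S_def)
    ultimately show ?thesis using f1 by (intro exI[of _ f] exI[of _ h]) simp
  qed simp
  then have "\<forall>i. \<exists>f h. i < k \<longrightarrow> (\<forall>y\<in>G. (\<Sum>s\<in>S i. f s * B s y) = 0) \<and> lps q (S i) f \<le> 1 \<and>
      lps p (S i) h \<le> 1 \<and> (\<Sum>s\<in>S i. f s * h s) = 1" ..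
  then obtain F H where FH: "\<And>i y. i < k \<Longrightarrow> y \<in> G \<Longrightarrow> (\<Sum>s\<in>S i. F i s * B s y) = 0"
    "\<And>i. i < k \<Longrightarrow> lps q (S i) (F i) \<le> 1" "\<And>i. i < k \<Longrightarrow> lps p (S i) (H i) \<le> 1"
    "\<And>i. i < k \<Longrightarrow> (\<Sum>s\<in>S i. F i s * H i s) = 1"
    unfolding choice_iff by blast
  define f where "f s = F (\<beta> s) s" for s
  define h where "h s = H (\<beta> s) s" for s
  have fF: "f s = F i s" and hH: "h s = H i s" if "s \<in> S i" for s i
    using that by (auto simp: f_def h_def S_def)
  define x' where "x' i = (\<Sum>s\<in>S i. scale (h s) (x s))" for i
  define B' where "B' i y = (\<Sum>s\<in>S i. f s * B s y)" for i y
  have B': "functional (B' i)" for i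
    unfolding B'_def using X(1) by (intro functional_on_combination) (auto simp: S_def)
  have "complemented_copy p C C k x' B'"
    unfolding complemented_copy_def
  proof (intro conjI allI impI)
    show "functional (B' i)" for i by (rule B')
    fix y
    have "lps p {..<k} (\<lambda>i. B' i y) \<le> lps p {..<k * g} (\<lambda>s. B s y)"
      unfolding B'_def S_def
    proof (rule lps_block_functionals[OF pq])
      fix i assume i: "i \<in> {..<k}"
      have "lps q (S i) f = lps q (S i) (F i)" by (rule lps_cong) (simp add: fF)
      then show "lps q {s \<in> {..<k * g}. \<beta> s = i} f \<le> 1" using FH(2)[of i] i by (simp add: S_def)
    qed (use \<beta>k in auto)
    then show "lps p {..<k} (\<lambda>i. B' i y) \<le> C * norm y" using X(2)[of y] by linarith
  next
    fix t
    have "(\<Sum>i<k. scale (t i) (x' i)) = (\<Sum>i<k. \<Sum>s\<in>S i. scale (t (\<beta> s) * h s) (x s))"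
      unfolding x'_def scale_sum_right by (intro sum.cong refl) (auto simp: S_def)
    also have "\<dots> = (\<Sum>s<k * g. scale (t (\<beta> s) * h s) (x s))"
      unfolding S_def by (rule sum.group) (use \<beta>k in auto)
    also have "norm \<dots> \<le> C * lps p {..<k * g} (\<lambda>s. t (\<beta> s) * h s)" by (rule X(3))
    also have "\<dots> \<le> C * lps p {..<k} t"
    proof (rule mult_left_mono[OF lps_block_vectors[OF p0]])
      fix i assume i: "i \<in> {..<k}"
      have "lps p (S i) h = lps p (S i) (H i)" by (rule lps_cong) (simp add: hH)
      then show "lps p {s \<in> {..<k * g}. \<beta> s = i} h \<le> 1" using FH(3)[of i] i by (simp add: S_def)
    qed (use \<beta>k \<open>0 \<le> C\<close> in auto)
    finally show "norm (\<Sum>i<k. scale (t i) (x' i)) \<le> C * lps p {..<k} t" .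
  next
    fix i j assume i: "i < k" and j: "j < k"
    have Bx: "B s (x' j) = (if s \<in> S j then h s else 0)" if s: "s \<in> S i" for s
    proof -
      have sk: "s < k * g" using s by (simp add: S_def)
      have "B s (x' j) = (\<Sum>s'\<in>S j. h s' * B s (x s'))"
        unfolding x'_def by (rule functional_on_sum[OF X(1)[OF sk]]) auto
      also have "\<dots> = (\<Sum>s'\<in>S j. if s' = s then h s else 0)"
        using sk by (intro sum.cong refl) (auto simp: X(4) S_def)
      also have "\<dots> = (if s \<in> S j then h s else 0)" by (simp add: S_def)
      finally show ?thesis .
    qed
    show "B' i (x' j) = (if i = j then 1 else 0)"
    proof (cases "i = j")
      case True
      have "B' i (x' j) = (\<Sum>s\<in>S i. F i s * H i s)"
        unfolding B'_def using Bx True by (intro sum.cong refl) (auto simp: fF hH)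
      then show ?thesis using FH(4)[OF i] True by simp
    next
      case False
      then have "s \<notin> S j" if "s \<in> S i" for s using that by (auto simp: S_def)
      then show ?thesis unfolding B'_def using Bx False by (intro trans[OF sum.neutral]) auto
    qed
  qed
  moreover have "B' i y = 0" if "i < k" "y \<in> G" for i y
  proof -
    have "B' i y = (\<Sum>s\<in>S i. F i s * B s y)"
      unfolding B'_def by (intro sum.cong refl) (simp add: fF)
    then show ?thesis using FH(1)[OF that] by simp
  qed
  ultimately show ?thesis by blast
qed

end

section \<open>Series of operators\<close>

lemma geometric_limit:
  fixes u :: "nat \<Rightarrow> 'a::banach"
  assumes "\<And>n. norm (u (Suc n) - u n) \<le> b * (1 / 2) ^ n"
  shows "\<exists>l. u \<longlonglongrightarrow> l \<and> norm (l - u 0) \<le> 2 * b"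
proof -
  define d where "d n = u (Suc n) - u n" for n
  have g: "(\<lambda>n. b * (1 / 2) ^ n) sums (b * 2)"
    using geometric_sums[of "1 / 2 :: real"] by (intro sums_mult) simp
  have sn: "summable (\<lambda>n. norm (d n))"
    using assms by (intro summable_comparison_test'[OF sums_summable[OF g]]) (simp add: d_def)
  then have sd: "summable d" by (rule summable_norm_cancel)
  have "(\<Sum>i<n. d i) = u n - u 0" for n unfolding d_def by (rule sum_lessThan_telescope)
  then have "(\<lambda>n. u n - u 0) \<longlonglongrightarrow> suminf d" using summable_LIMSEQ[OF sd] by simp
  then have "(\<lambda>n. u n - u 0 + u 0) \<longlonglongrightarrow> suminf d + u 0" by (intro tendsto_intros)
  then have "u \<longlonglongrightarrow> suminf d + u 0" by simp
  moreover have "norm (suminf d) \<le> 2 * b"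
  proof -
    have "norm (suminf d) \<le> (\<Sum>n. norm (d n))" by (rule summable_norm[OF sn])
    also have "\<dots> \<le> (\<Sum>n. b * (1 / 2) ^ n)"
      using assms by (intro suminf_le sn sums_summable[OF g]) (simp add: d_def)
    also have "\<dots> = 2 * b" using sums_unique[OF g] by simp
    finally show ?thesis .
  qed
  ultimately show ?thesis by (intro exI[of _ "suminf d + u 0"]) simp
qed

lemma totally_bounded_map_add:
  assumes "totally_bounded_map S" "totally_bounded_map T"
  shows "totally_bounded_map (\<lambda>x. S x + T x)"
  unfolding totally_bounded_map_def
proof (intro allI impI)
  fix \<epsilon> :: real assume "0 < \<epsilon>"
  then obtain Y Z where Y: "finite Y" "\<And>x. norm x \<le> 1 \<Longrightarrow> \<exists>y\<in>Y. norm (S x - y) < \<epsilon> / 2"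
    and Z: "finite Z" "\<And>x. norm x \<le> 1 \<Longrightarrow> \<exists>z\<in>Z. norm (T x - z) < \<epsilon> / 2"
    using totally_bounded_mapD[OF assms(1), of "\<epsilon> / 2"] totally_bounded_mapD[OF assms(2), of "\<epsilon> / 2"]
    by auto
  have "\<exists>w\<in>(\<lambda>(y, z). y + z) ` (Y \<times> Z). norm (S x + T x - w) < \<epsilon>" if x: "norm x \<le> 1" for x
  proof -
    obtain y z where yz: "y \<in> Y" "norm (S x - y) < \<epsilon> / 2" "z \<in> Z" "norm (T x - z) < \<epsilon> / 2"
      using Y(2)[OF x] Z(2)[OF x] by blast
    have "norm (S x + T x - (y + z)) < \<epsilon>"
      using norm_triangle_ineq[of "S x - y" "T x - z"] yz by (simp add: algebra_simps)
    then show ?thesis using yz by force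
  qed
  then show "\<exists>Y. finite Y \<and> (\<forall>x. norm x \<le> 1 \<longrightarrow> (\<exists>y\<in>Y. norm (S x + T x - y) < \<epsilon>))"
    using Y(1) Z(1) by (intro exI[of _ "(\<lambda>(y, z). y + z) ` (Y \<times> Z)"]) auto
qed

lemma totally_bounded_map_zero: "totally_bounded_map (\<lambda>x. 0)"
  unfolding totally_bounded_map_def by (intro allI impI exI[of _ "{0}"]) simp

lemma totally_bounded_map_sum:
  "(\<And>i. i \<in> I \<Longrightarrow> totally_bounded_map (S i)) \<Longrightarrow> totally_bounded_map (\<lambda>x. \<Sum>i\<in>I. S i x)"
  by (induction I rule: infinite_finite_induct)
    (simp_all add: totally_bounded_map_zero totally_bounded_map_add)

lemma totally_bounded_map_limit:
  assumes "\<And>\<epsilon>. 0 < \<epsilon> \<Longrightarrow> \<exists>S. totally_bounded_map S \<and> (\<forall>x. norm x \<le> 1 \<longrightarrow> norm (T x - S x) < \<epsilon>)"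
  shows "totally_bounded_map T"
  unfolding totally_bounded_map_def
proof (intro allI impI)
  fix \<epsilon> :: real assume \<epsilon>: "0 < \<epsilon>"
  obtain S where S: "totally_bounded_map S" "\<And>x. norm x \<le> 1 \<Longrightarrow> norm (T x - S x) < \<epsilon> / 2"
    using assms[OF half_gt_zero[OF \<epsilon>]] by blast
  obtain Y where Y: "finite Y" "\<And>x. norm x \<le> 1 \<Longrightarrow> \<exists>y\<in>Y. norm (S x - y) < \<epsilon> / 2"
    using totally_bounded_mapD[OF S(1) half_gt_zero[OF \<epsilon>]] by blast
  have "\<exists>y\<in>Y. norm (T x - y) < \<epsilon>" if x: "norm x \<le> 1" for x
  proof -
    obtain y where y: "y \<in> Y" "norm (S x - y) < \<epsilon> / 2" using Y(2)[OF x] by blast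
    have "norm (T x - y) < \<epsilon>"
      using norm_triangle_ineq[of "T x - S x" "S x - y"] S(2)[OF x] y(2) by simp
    then show ?thesis using y(1) by blast
  qed
  then show "\<exists>Y. finite Y \<and> (\<forall>x. norm x \<le> 1 \<longrightarrow> (\<exists>y\<in>Y. norm (T x - y) < \<epsilon>))" using Y(1) by blast
qed

context banach_space
begin

lemma bounded_linear_scale: "bounded_linear (scale c)"
proof (rule bounded_linear_intro)
  show "scale c (r *\<^sub>R x) = r *\<^sub>R scale c x" for r x
    by (simp add: scaleR_eq_scale scale_left_commute)
  show "norm (scale c x) \<le> norm x * norm c" for x by (simp add: norm_scale)
qed (simp add: scale_right_distrib)

lemma bounded_linear_lin:
  assumes "lin scale sB T" "banach_space sB" "\<And>x. norm (T x) \<le> K * norm x"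
  shows "bounded_linear T"
  using assms(3) by (intro bounded_linear_intro[where K=K])
    (simp_all add: linD(1)[OF assms(1)] lin_scaleR[OF assms(1,2)] mult.commute)

lemma bounded_linear_functional:
  assumes "functional f" "\<And>x. norm (f x) \<le> K * norm x"
  shows "bounded_linear f"
proof (rule bounded_linear_intro)
  show "f (r *\<^sub>R x) = r *\<^sub>R f x" for r x
    using functional_onD(2)[OF assms(1)] by (simp add: scaleR_eq_scale scaleR_conv_of_real)
  show "norm (f x) \<le> norm x * K" for x using assms(2) by (simp add: mult.commute)
qed (use functional_onD(1)[OF assms(1)] in simp)

lemma totally_bounded_rank_one:
  fixes f :: "'z::real_normed_vector \<Rightarrow> 'k"
  assumes "\<And>x. norm (f x) \<le> K * norm x" "0 \<le> K"
  shows "totally_bounded_map (\<lambda>x. scale (f x) z)"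
  unfolding totally_bounded_map_def
proof (intro allI impI)
  fix \<epsilon> :: real assume "0 < \<epsilon>"
  define \<delta> where "\<delta> = \<epsilon> / (1 + norm z)"
  have "0 < 1 + norm z" by (simp add: add_pos_nonneg)
  then have \<delta>: "0 < \<delta>" "\<delta> * (1 + norm z) = \<epsilon>" using \<open>0 < \<epsilon>\<close> by (simp_all add: \<delta>_def)
  have "\<forall>e>0. \<exists>k. finite k \<and> cball (0::'k) K \<subseteq> (\<Union>x\<in>k. ball x e)"
    using compact_scalar_cball[of K] unfolding compact_eq_totally_bounded by blast
  then obtain N where N: "finite N" "cball (0::'k) K \<subseteq> (\<Union>x\<in>N. ball x \<delta>)" using \<delta>(1) by blast
  have "\<exists>y\<in>(\<lambda>d. scale d z) ` N. norm (scale (f x) z - y) < \<epsilon>" if "norm x \<le> 1" for x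
  proof -
    have "norm (f x) \<le> K" using assms(1)[of x] mult_left_mono[OF that \<open>0 \<le> K\<close>] by simp
    then obtain d where d: "d \<in> N" "norm (f x - d) < \<delta>"
      using N(2) by (auto simp: subset_iff dist_norm norm_minus_commute)
    have "norm (scale (f x) z - scale d z) = norm (f x - d) * norm z"
      by (simp add: norm_scale flip: scale_left_diff_distrib)
    also have "\<dots> \<le> \<delta> * norm z" using d(2) by (intro mult_right_mono) auto
    also have "\<dots> < \<epsilon>" using \<delta> by (simp add: algebra_simps)
    finally show ?thesis using d(1) by blast
  qed
  then show "\<exists>Y. finite Y \<and> (\<forall>x. norm x \<le> 1 \<longrightarrow> (\<exists>y\<in>Y. norm (scale (f x) z - y) < \<epsilon>))"
    using N(1) by (intro exI[of _ "(\<lambda>d. scale d z) ` N"]) auto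
qed

text \<open>On the unit ball the tail after \<open>m\<close> terms is controlled by
  \<open>2 * b * (1 / 2) ^ m\<close>, so the sum is a uniform limit of totally bounded maps;
  \<open>m = 0\<close> gives the norm bound.\<close>

lemma operator_series:
  fixes E :: "nat \<Rightarrow> 'x \<Rightarrow> 'z::banach"
  assumes sB: "banach_space sB" and E: "\<And>n. lin scale sB (E n)" "\<And>n. totally_bounded_map (E n)"
    "\<And>n x. norm (E n x) \<le> b * (1 / 2) ^ n * norm x"
  shows "\<exists>S. lin scale sB S \<and> totally_bounded_map S \<and> (\<forall>x. (\<lambda>n. E n x) sums S x) \<and>
    (\<forall>x. norm (S x) \<le> 2 * b * norm x)"
proof -
  have tail: "\<exists>l. (\<lambda>n. \<Sum>i<m + n. E i x) \<longlonglongrightarrow> l \<and> norm (l - (\<Sum>i<m. E i x)) \<le> 2 * (b * (1 / 2) ^ m * norm x)" for m x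
  proof -
    have "norm (E (m + n) x) \<le> (b * (1 / 2) ^ m * norm x) * (1 / 2) ^ n" for n
      by (rule order_trans[OF E(3)]) (simp add: power_add mult_ac)
    then show ?thesis
      using geometric_limit[where u="\<lambda>n. \<Sum>i<m + n. E i x" and b="b * (1 / 2) ^ m * norm x"] by simp
  qed
  have "\<exists>s. (\<lambda>n. E n x) sums s" for x using tail[where m=0 and x=x] by (auto simp: sums_def)
  then obtain S where S: "\<And>x. (\<lambda>n. E n x) sums S x" by metis
  have near: "norm (S x - (\<Sum>i<m. E i x)) \<le> 2 * (b * (1 / 2) ^ m * norm x)" for m x
  proof -
    obtain l where l: "(\<lambda>n. \<Sum>i<m + n. E i x) \<longlonglongrightarrow> l"
      "norm (l - (\<Sum>i<m. E i x)) \<le> 2 * (b * (1 / 2) ^ m * norm x)" using tail by blast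
    have "(\<lambda>n. \<Sum>i<m + n. E i x) \<longlonglongrightarrow> S x"
    proof -
      have "(\<lambda>n. \<Sum>i<n + m. E i x) \<longlonglongrightarrow> S x"
        using S[of x] unfolding sums_def by (rule LIMSEQ_ignore_initial_segment)
      then show ?thesis by (simp only: add.commute)
    qed
    then show ?thesis using l LIMSEQ_unique by blast
  qed
  have "lin scale sB S"
    unfolding lin_def
  proof (intro conjI allI)
    show "S (x + y) = S x + S y" for x y
    proof -
      have "(\<lambda>n. E n (x + y)) sums (S x + S y)"
        using sums_add[OF S S] by (simp add: linD(1)[OF E(1)])
      then show ?thesis using S sums_unique2 by blast
    qed
    show "S (scale c x) = sB c (S x)" for c x
    proof -
      have "(\<lambda>n. E n (scale c x)) sums sB c (S x)"
        using bounded_linear.sums[OF banach_space.bounded_linear_scale[OF sB] S]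
        by (simp add: linD(2)[OF E(1)])
      then show ?thesis using S sums_unique2 by blast
    qed
  qed
  moreover have "totally_bounded_map S"
  proof (rule totally_bounded_map_limit)
    fix \<epsilon> :: real assume "0 < \<epsilon>"
    have "(\<lambda>m. 2 * (b * (1 / 2) ^ m)) \<longlonglongrightarrow> 2 * (b * 0)"
      by (intro tendsto_intros LIMSEQ_power_zero) simp
    then have "eventually (\<lambda>m. 2 * (b * (1 / 2) ^ m) < \<epsilon>) sequentially"
      using \<open>0 < \<epsilon>\<close> by (intro order_tendstoD) auto
    then obtain m where m: "2 * (b * (1 / 2) ^ m) < \<epsilon>" using eventually_happens'[of sequentially] by auto
    have "norm (S x - (\<Sum>i<m. E i x)) < \<epsilon>" if "norm x \<le> 1" for x
    proof (cases "0 \<le> b")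
      case True
      then have "b * (1 / 2) ^ m * norm x \<le> b * (1 / 2) ^ m * 1" using that by (intro mult_left_mono) auto
      then show ?thesis using near[of x m] m by simp
    next
      case False
      then have "b * (1 / 2) ^ m * norm x \<le> 0" by (intro mult_nonpos_nonneg) auto
      then show ?thesis using near[of x m] \<open>0 < \<epsilon>\<close> by simp
    qed
    then show "\<exists>R. totally_bounded_map R \<and> (\<forall>x. norm x \<le> 1 \<longrightarrow> norm (S x - R x) < \<epsilon>)"
      using E(2) by (intro exI[of _ "\<lambda>x. \<Sum>i<m. E i x"]) (auto intro: totally_bounded_map_sum)
  qed
  moreover have "norm (S x) \<le> 2 * b * norm x" for x using near[of x 0] by simp
  ultimately show ?thesis using S by blast
qed

section \<open>Expansion of a compact operator\<close>

text \<open>The clause \<open>b n i \<in> range T\<close> is carried along because the second factor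
  must send the dense sequence of \<open>Y\<close> into the range of \<open>T\<close>.\<close>

definition expansion :: "real \<Rightarrow> real \<Rightarrow> real \<Rightarrow> ('x \<Rightarrow> 'x) \<Rightarrow>
    (nat \<Rightarrow> nat) \<Rightarrow> (nat \<Rightarrow> nat \<Rightarrow> 'x \<Rightarrow> 'k) \<Rightarrow> (nat \<Rightarrow> nat \<Rightarrow> 'x) \<Rightarrow> bool"
  where "expansion p L \<theta> T k a b \<longleftrightarrow>
    (\<forall>n. \<forall>i<k n. functional (a n i)) \<and>
    (\<forall>n x. lps p {..<k n} (\<lambda>i. a n i x) \<le> norm x) \<and>
    (\<forall>n t. norm (\<Sum>i<k n. scale (t i) (b n i)) \<le> L * \<theta> ^ n * lps p {..<k n} t) \<and>
    (\<forall>n i. b n i \<in> range T) \<and>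
    (\<forall>x. (\<lambda>n. \<Sum>i<k n. scale (a n i x) (b n i)) sums T x)"

lemma expansionD:
  assumes "expansion p L \<theta> T k a b"
  shows "\<And>n i. i < k n \<Longrightarrow> functional (a n i)"
    "\<And>n x. lps p {..<k n} (\<lambda>i. a n i x) \<le> norm x"
    "\<And>n t. norm (\<Sum>i<k n. scale (t i) (b n i)) \<le> L * \<theta> ^ n * lps p {..<k n} t"
    "\<And>n i. b n i \<in> range T"
    "\<And>x. (\<lambda>n. \<Sum>i<k n. scale (a n i x) (b n i)) sums T x"
  using assms unfolding expansion_def by blast+

text \<open>Apply the approximation repeatedly to the remainders \<open>S (Suc n) = S n \<circ> (id - c a)\<close>, starting with \<open>T\<close>.\<close>

lemma compact_expansion:
  fixes T :: "'x \<Rightarrow> 'x"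
  assumes pq: "conjugate_exponents p q" and "1 \<le> D"
    and frames: "\<And>M. finite M \<Longrightarrow> \<exists>N n e \<phi>. M \<subseteq> N \<and> frame p D N n e \<phi>"
    and T: "lin scale scale T" "totally_bounded_map T" and \<theta>: "0 < \<theta>" "\<theta> < 1"
  shows "\<exists>L\<ge>0. \<exists>k a b. expansion p L \<theta> T k a b"
proof -
  note bs = banach_space_axioms
  obtain L0 where L0: "0 < L0" "\<And>x. norm (T x) \<le> L0 * norm x"
  proof -
    obtain B where B: "0 \<le> B" "\<And>x. norm (T x) \<le> B * norm x"
      using totally_bounded_map_bounded[OF T(2,1) bs] by blast
    have "norm (T x) \<le> (B + 1) * norm x" for x using B(2)[of x] by (simp add: distrib_right add_increasing2)
    then show ?thesis using B(1) that[of "B + 1"] by simp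
  qed
  define good where "good n S = (\<lambda>(k, a, c). lin scale scale S \<and> totally_bounded_map S \<and> range S \<subseteq> range T \<and>
     (\<forall>x. norm (S x) \<le> L0 * \<theta> ^ n * norm x) \<and> approx_factorization p D (L0 * \<theta> ^ Suc n) S UNIV k a c)"
    for n :: nat and S
  have ext: "\<exists>z. good n S z" if "lin scale scale S" "totally_bounded_map S" "range S \<subseteq> range T"
    "\<And>x. norm (S x) \<le> L0 * \<theta> ^ n * norm x" for n S
  proof -
    have "0 < L0 * \<theta> ^ Suc n" using L0(1) \<theta>(1) by simp
    from compact_approximation[OF pq \<open>1 \<le> D\<close> frames that(1,2) this]
    obtain k a c where "approx_factorization p D (L0 * \<theta> ^ Suc n) S UNIV k a c" by blast
    then show ?thesis using that by (intro exI[of _ "(k, a, c)"]) (simp add: good_def)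
  qed
  \<comment> \<open>A state carries a remainder together with a factorization of it. The clause for
    \<open>n = 0\<close> pins the start, which the choice principle would otherwise leave
    free.\<close>
  let ?P = "\<lambda>n (S, z). good n S z \<and> (n = 0 \<longrightarrow> S = T)"
  let ?Q = "\<lambda>n (S, (k, a, c)) (S', z'). S' = (\<lambda>x. S (x - (\<Sum>l<k. scale (a l x) (c l))))"
  have "\<exists>f. \<forall>n. ?P n (f n) \<and> ?Q n (f n) (f (Suc n))"
  proof (rule dependent_nat_choice)
    show "\<exists>st. ?P 0 st" using ext[of T 0] T L0(2) by auto
  next
    fix st n assume st: "?P n st"
    obtain S k a c where steq: "st = (S, (k, a, c))" by (metis prod_cases4)
    have S: "lin scale scale S" "totally_bounded_map S" "range S \<subseteq> range T"
      and fac: "approx_factorization p D (L0 * \<theta> ^ Suc n) S UNIV k a c"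
      using st unfolding steq good_def by auto
    note F = approx_factorizationD[OF fac]
    define R where "R x = x - (\<Sum>l<k. scale (a l x) (c l))" for x
    have R_add: "R (x + y) = R x + R y" and R_scale: "R (scale r x) = scale r (R x)" for x y r
      using functional_onD[OF F(1)]
      by (simp_all add: R_def scale_left_distrib sum.distrib scale_right_diff_distrib scale_sum_right)
    have R_le: "norm (R x) \<le> 1 + D" if "norm x \<le> 1" for x
    proof -
      have "norm (R x) \<le> norm x + norm (\<Sum>l<k. scale (a l x) (c l))"
        unfolding R_def by (rule norm_triangle_ineq4)
      also have "norm (\<Sum>l<k. scale (a l x) (c l)) \<le> D * lps p {..<k} (\<lambda>l. a l x)" by (rule F(3))
      also have "\<dots> \<le> D * 1" using F(2)[of x] that \<open>1 \<le> D\<close> by (intro mult_left_mono) auto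
      finally show ?thesis using that by simp
    qed
    have "lin scale scale (\<lambda>x. S (R x))"
      unfolding lin_def by (simp add: R_add R_scale linD[OF S(1)])
    moreover have "totally_bounded_map (\<lambda>x. S (R x))"
      unfolding totally_bounded_map_def
    proof (intro allI impI)
      fix \<epsilon> :: real assume "0 < \<epsilon>"
      then obtain Y where Y: "finite Y" "\<And>x. norm x \<le> 1 + D \<Longrightarrow> \<exists>y\<in>Y. norm (S x - y) < \<epsilon>"
        using totally_bounded_map_radius[OF S(2,1) bs, of \<epsilon> "1 + D"] \<open>1 \<le> D\<close> by auto
      then show "\<exists>Y. finite Y \<and> (\<forall>x. norm x \<le> 1 \<longrightarrow> (\<exists>y\<in>Y. norm (S (R x) - y) < \<epsilon>))"
        using R_le by blast
    qed
    moreover have "range (\<lambda>x. S (R x)) \<subseteq> range T" using S(3) by blast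
    moreover have "norm (S (R x)) \<le> L0 * \<theta> ^ Suc n * norm x" for x using F(4)[of x] by (simp add: R_def)
    ultimately obtain z where "good (Suc n) (\<lambda>x. S (R x)) z" using ext[of "\<lambda>x. S (R x)" "Suc n"] by blast
    then show "\<exists>st'. ?P (Suc n) st' \<and> ?Q n st st'"
      unfolding steq by (intro exI[of _ "(\<lambda>x. S (R x), z)"]) (simp add: R_def)
  qed
  then obtain f where ff: "\<forall>n. ?P n (f n) \<and> ?Q n (f n) (f (Suc n))" by (rule exE)
  have f: "?P n (f n)" "?Q n (f n) (f (Suc n))" for n
    using spec[OF ff, of n] by (rule conjunct1, rule conjunct2)
  define S where "S n = fst (f n)" for n
  define k where "k n = fst (snd (f n))" for n
  define a where "a n = fst (snd (snd (f n)))" for n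
  define c where "c n = snd (snd (snd (f n)))" for n
  have fn: "f n = (S n, (k n, a n, c n))" for n by (simp add: S_def k_def a_def c_def)
  have S0: "S 0 = T" using f(1)[of 0] unfolding fn by simp
  have S: "lin scale scale (S n)" "range (S n) \<subseteq> range T" "\<And>x. norm (S n x) \<le> L0 * \<theta> ^ n * norm x"
    and fac: "approx_factorization p D (L0 * \<theta> ^ Suc n) (S n) UNIV (k n) (a n) (c n)" for n
    using f(1)[of n] unfolding fn good_def by auto
  note F = approx_factorizationD[OF fac]
  have S_Suc: "S (Suc n) x = S n (x - (\<Sum>l<k n. scale (a n l x) (c n l)))" for n x
    using f(2)[of n] unfolding fn by simp
  define b where "b n i = S n (c n i)" for n i
  have "norm (\<Sum>i<k n. scale (t i) (b n i)) \<le> L0 * D * \<theta> ^ n * lps p {..<k n} t" for n t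
  proof -
    have "(\<Sum>i<k n. scale (t i) (b n i)) = S n (\<Sum>i<k n. scale (t i) (c n i))"
      unfolding b_def by (rule lin_sum[OF S(1), symmetric])
    also have "norm \<dots> \<le> L0 * \<theta> ^ n * norm (\<Sum>i<k n. scale (t i) (c n i))" by (rule S(3))
    also have "\<dots> \<le> L0 * \<theta> ^ n * (D * lps p {..<k n} t)" using F(3) L0 \<theta> by (intro mult_left_mono) auto
    finally show ?thesis by (simp add: mult_ac)
  qed
  note b_le = this
  have b_range: "b n i \<in> range T" for n i unfolding b_def using S(2)[of n] by blast
  have b_sums: "(\<lambda>n. \<Sum>i<k n. scale (a n i x) (b n i)) sums T x" for x
  proof -
    have step: "(\<Sum>i<k n. scale (a n i x) (b n i)) = S n x - S (Suc n) x" for n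
      unfolding S_Suc b_def by (simp add: lin_diff[OF S(1)] lin_sum[OF S(1)])
    have part: "(\<Sum>n<m. \<Sum>i<k n. scale (a n i x) (b n i)) = T x - S m x" for m
      unfolding step S0[symmetric] by (rule sum_lessThan_telescope')
    have "(\<lambda>m. S m x) \<longlonglongrightarrow> 0"
    proof (rule Lim_null_comparison)
      show "eventually (\<lambda>m. norm (S m x) \<le> L0 * \<theta> ^ m * norm x) sequentially"
        using S(3) by simp
      have "(\<lambda>m. L0 * \<theta> ^ m * norm x) \<longlonglongrightarrow> L0 * 0 * norm x"
        using \<theta> by (intro tendsto_intros LIMSEQ_power_zero) simp
      then show "(\<lambda>m. L0 * \<theta> ^ m * norm x) \<longlonglongrightarrow> 0" by simp
    qed
    then have "(\<lambda>m. T x - S m x) \<longlonglongrightarrow> T x - 0" by (intro tendsto_intros)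
    then show ?thesis unfolding sums_def part by simp
  qed
  have "expansion p (L0 * D) \<theta> T k a b"
    unfolding expansion_def
    by (intro conjI allI impI) (rule F(1) F(2)[OF UNIV_I] b_le b_range b_sums | assumption)+
  moreover have "0 \<le> L0 * D" using L0 \<open>1 \<le> D\<close> by simp
  ultimately show ?thesis by blast
qed

section \<open>Biorthogonal sequences of copies\<close>

text \<open>The new functionals are chosen to kill all earlier vectors. The earlier functionals are
  made to kill the new vectors by subtracting from these their projections onto the earlier copies.
  Only the vectors grow: summing the bounds of the earlier projections as a geometric series gives
  exactly \<open>(1 + C^2) ^ n\<close>.\<close>

lemma exists_biorthogonal_copies:
  fixes y :: "nat \<Rightarrow> 'x" and k :: "nat \<Rightarrow> nat"
  assumes "0 \<le> C"
    and copies: "\<And>k G. finite G \<Longrightarrow> \<exists>x B. complemented_copy p C C k x B \<and> (\<forall>i<k. \<forall>y\<in>G. B i y = 0)"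
  shows "\<exists>A B. (\<forall>n. complemented_copy p C (C * (1 + C\<^sup>2) ^ n) (k n) (A n) (B n)) \<and>
    (\<forall>m n i j. m \<noteq> n \<longrightarrow> i < k m \<longrightarrow> j < k n \<longrightarrow> B m i (A n j) = 0) \<and>
    (\<forall>n j i. j < n \<longrightarrow> i < k n \<longrightarrow> B n i (y j) = 0)"
proof -
  define P where "P f n r \<longleftrightarrow> complemented_copy p C (C * (1 + C\<^sup>2) ^ n) (k n) (fst r) (snd r) \<and>
      (\<forall>m<n. \<forall>i<k n. \<forall>j<k m. snd r i (fst (f m) j) = 0 \<and> snd (f m) j (fst r i) = 0) \<and>
      (\<forall>j<n. \<forall>i<k n. snd r i (y j) = 0)"
    for f :: "nat \<Rightarrow> (nat \<Rightarrow> 'x) \<times> (nat \<Rightarrow> 'x \<Rightarrow> 'k)" and n r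
  have "\<exists>f. \<forall>n. P f n (f n)"
  proof (rule dependent_wellorder_choice)
    fix r n and f g :: "nat \<Rightarrow> (nat \<Rightarrow> 'x) \<times> (nat \<Rightarrow> 'x \<Rightarrow> 'k)"
    assume "\<And>m. m < n \<Longrightarrow> f m = g m"
    then show "P f n r = P g n r" by (simp add: P_def)
  next
    fix n and f :: "nat \<Rightarrow> (nat \<Rightarrow> 'x) \<times> (nat \<Rightarrow> 'x \<Rightarrow> 'k)"
    assume prev: "\<And>m. m < n \<Longrightarrow> P f m (f m)"
    define A where "A m = fst (f m)" for m
    define B where "B m = snd (f m)" for m
    have cc: "complemented_copy p C (C * (1 + C\<^sup>2) ^ m) (k m) (A m) (B m)" if "m < n" for m
      using prev[OF that] by (simp add: P_def A_def B_def)
    have orth: "B m i (A m' j) = (if m = m' \<and> i = j then 1 else 0)"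
      if "m < n" "m' < n" "i < k m" "j < k m'" for m m' i j
    proof (cases m m' rule: linorder_cases)
      case less
      then show ?thesis using prev[OF that(2)] that by (simp add: P_def A_def B_def)
    next
      case equal
      then show ?thesis using complemented_copyD(4)[OF cc[OF that(1)]] that by simp
    next
      case greater
      then show ?thesis using prev[OF that(1)] that by (simp add: P_def A_def B_def)
    qed
    define G where "G = y ` {..<n} \<union> (\<Union>m<n. A m ` {..<k m})"
    have "finite G" by (simp add: G_def)
    from copies[OF this] obtain x b where xb: "complemented_copy p C C (k n) x b"
      and kill': "\<forall>i<k n. \<forall>z\<in>G. b i z = 0" by blast
    have kill: "b i z = 0" if "i < k n" "z \<in> G" for i z using kill' that by blast
    have killA: "b i (A m l) = 0" if "i < k n" "m < n" "l < k m" for i m l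
      using that by (intro kill) (auto simp: G_def)
    have killy: "b i (y j) = 0" if "i < k n" "j < n" for i j
      using that by (intro kill) (auto simp: G_def)
    note X = complemented_copyD[OF xb]
    \<comment> \<open>\<open>W\<close> removes the components in the earlier copies. The functionals
      \<open>b\<close> kill these copies, so \<open>b \<circ> W = b\<close> and the new vectors stay
      biorthogonal to \<open>b\<close>.\<close>
    define W where "W z = z - (\<Sum>m<n. \<Sum>l<k m. scale (B m l z) (A m l))" for z
    have bW: "b i (W z) = b i z" if "i < k n" for i z
    proof -
      have l: "lin scale (*) (b i)" using X(1)[OF that] by (simp add: functional_iff_lin)
      have "b i (\<Sum>m<n. \<Sum>l<k m. scale (B m l z) (A m l)) = 0"
      proof -
        have "b i (\<Sum>m<n. scale 1 (\<Sum>l<k m. scale (B m l z) (A m l)))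
            = (\<Sum>m<n. 1 * (\<Sum>l<k m. B m l z * b i (A m l)))"
          unfolding lin_sum[OF l] ..
        also have "\<dots> = 0" using that by (simp add: killA)
        finally show ?thesis by simp
      qed
      then show ?thesis by (simp add: W_def lin_diff[OF l])
    qed
    have BW: "B m0 l0 (W z) = 0" if "m0 < n" "l0 < k m0" for m0 l0 z
    proof -
      have l: "lin scale (*) (B m0 l0)"
        using complemented_copyD(1)[OF cc[OF that(1)] that(2)] by (simp add: functional_iff_lin)
      have "B m0 l0 (\<Sum>m<n. scale 1 (\<Sum>l<k m. scale (B m l z) (A m l)))
          = (\<Sum>m<n. 1 * (\<Sum>l<k m. B m l z * B m0 l0 (A m l)))"
        unfolding lin_sum[OF l] ..
      also have "\<dots> = (\<Sum>m<n. if m = m0 then (\<Sum>l<k m0. if l = l0 then B m0 l0 z else 0) else 0)"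
      proof (intro sum.cong refl)
        fix m assume m: "m \<in> {..<n}"
        have "(\<Sum>l<k m. B m l z * B m0 l0 (A m l))
            = (\<Sum>l<k m. if m = m0 \<and> l = l0 then B m0 l0 z else 0)"
          using that m by (intro sum.cong refl) (auto simp: orth)
        then show "1 * (\<Sum>l<k m. B m l z * B m0 l0 (A m l))
            = (if m = m0 then (\<Sum>l<k m0. if l = l0 then B m0 l0 z else 0) else 0)" by simp
      qed
      also have "\<dots> = B m0 l0 z" using that by simp
      finally show ?thesis by (simp add: W_def lin_diff[OF l])
    qed
    have W_le: "norm (W z) \<le> (1 + C\<^sup>2) ^ n * norm z" for z
    proof -
      have summand: "norm (\<Sum>l<k m. scale (B m l z) (A m l)) \<le> (1 + C\<^sup>2) ^ m * C\<^sup>2 * norm z" if "m < n" for m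
      proof -
        note Z = complemented_copyD[OF cc[OF that]]
        have "norm (\<Sum>l<k m. scale (B m l z) (A m l)) \<le> C * (1 + C\<^sup>2) ^ m * lps p {..<k m} (\<lambda>l. B m l z)"
          by (rule Z(3))
        also have "\<dots> \<le> C * (1 + C\<^sup>2) ^ m * (C * norm z)"
          using Z(2) \<open>0 \<le> C\<close> by (intro mult_left_mono) auto
        finally show ?thesis by (simp add: power2_eq_square mult_ac)
      qed
      have "norm (W z) \<le> norm z + norm (\<Sum>m<n. \<Sum>l<k m. scale (B m l z) (A m l))"
        unfolding W_def by (rule norm_triangle_ineq4)
      also have "\<dots> \<le> norm z + (\<Sum>m<n. (1 + C\<^sup>2) ^ m * C\<^sup>2 * norm z)"
        using summand by (intro add_left_mono sum_norm_le) auto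
      also have "\<dots> = (1 + (\<Sum>m<n. (1 + C\<^sup>2) ^ m) * C\<^sup>2) * norm z"
        by (simp add: distrib_right sum_distrib_right)
      also have "1 + (\<Sum>m<n. (1 + C\<^sup>2) ^ m) * C\<^sup>2 = (1 + C\<^sup>2) ^ n"
        by (induction n) (simp_all add: algebra_simps)
      finally show ?thesis .
    qed
    have lW: "lin scale scale W"
    proof -
      have BB: "B m l (u + v) = B m l u + B m l v" "B m l (scale c u) = c * B m l u"
        if "m < n" "l < k m" for m l u v c
        using functional_onD[OF complemented_copyD(1)[OF cc[OF that(1)] that(2)]] by simp_all
      show ?thesis
        unfolding lin_def W_def
        by (simp add: BB scale_left_distrib sum.distrib scale_right_diff_distrib scale_sum_right)
    qed
    define A' where "A' i = W (x i)" for i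
    have cc': "complemented_copy p C (C * (1 + C\<^sup>2) ^ n) (k n) A' b"
      unfolding complemented_copy_def
    proof (intro conjI allI impI)
      fix t
      have "norm (\<Sum>i<k n. scale (t i) (A' i)) = norm (W (\<Sum>i<k n. scale (t i) (x i)))"
        unfolding A'_def by (simp add: lin_sum[OF lW])
      also have "\<dots> \<le> (1 + C\<^sup>2) ^ n * norm (\<Sum>i<k n. scale (t i) (x i))" by (rule W_le)
      also have "\<dots> \<le> (1 + C\<^sup>2) ^ n * (C * lps p {..<k n} t)" using X(3) by (intro mult_left_mono) auto
      finally show "norm (\<Sum>i<k n. scale (t i) (A' i)) \<le> C * (1 + C\<^sup>2) ^ n * lps p {..<k n} t"
        by (simp add: mult_ac)
    qed (use X in \<open>simp_all add: A'_def bW\<close>)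
    have "P f n (A', b)"
      unfolding P_def using cc'
      by (simp add: A'_def A_def[symmetric] B_def[symmetric] killA killy BW)
    then show "\<exists>r. P f n r" ..
  qed
  then obtain f where f: "\<And>n. P f n (f n)" by blast
  define A where "A n = fst (f n)" for n
  define B where "B n = snd (f n)" for n
  have "B m i (A n j) = 0" if "m \<noteq> n" "i < k m" "j < k n" for m n i j
    using that f[of m] f[of n] by (cases m n rule: linorder_cases) (auto simp: P_def A_def B_def)
  moreover have "complemented_copy p C (C * (1 + C\<^sup>2) ^ n) (k n) (A n) (B n)" for n
    using f[of n] by (simp add: P_def A_def B_def)
  moreover have "B n i (y j) = 0" if "j < n" "i < k n" for n i j
    using f[of n] that by (simp add: P_def B_def)
  ultimately show ?thesis by blast
qed

end

section \<open>Dense range\<close>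

context banach_space
begin

text \<open>Pigeonhole: with more vectors \<open>x i\<close> than net points, two of them have
  nearly equal images under \<open>S\<close>, although \<open>B i\<close> takes the value 1 on their
  difference. Multiplying the difference by a large \<open>s\<close> and dividing \<open>B i\<close>
  by \<open>s\<close> makes the functional small as well.\<close>

lemma exists_small_vector:
  assumes copies: "\<And>k. \<exists>x B. complemented_copy p C C k x B" and "0 < C" "0 < p"
    and S: "totally_bounded_map S" "lin scale sB S" "banach_space sB" and "0 < \<eta>"
  shows "\<exists>\<xi> f. functional f \<and> f \<xi> = 1 \<and> (\<forall>x. norm (f x) \<le> \<eta> * norm x) \<and> norm (S \<xi>) \<le> \<eta>"
proof -
  \<comment> \<open>This \<open>s\<close> makes the norm of the functional at most
    \<open>C / s = \<eta>\<close>; net accuracy \<open>\<eta> / (2 * s)\<close> for each of two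
    vectors gives \<open>\<eta>\<close> after scaling by \<open>s\<close>.\<close>
  define s where "s = C / \<eta>"
  have s: "0 < s" "C / s = \<eta>" using \<open>0 < C\<close> \<open>0 < \<eta>\<close> by (simp_all add: s_def)
  have "0 < \<eta> / (2 * s)" using s(1) \<open>0 < \<eta>\<close> by simp
  then obtain Y where Y: "finite Y" "\<And>x. norm x \<le> C \<Longrightarrow> \<exists>y\<in>Y. norm (S x - y) < \<eta> / (2 * s)"
    using totally_bounded_map_radius[OF S _ \<open>0 < C\<close>] by blast
  define k where "k = card Y + 1"
  obtain x B where cc: "complemented_copy p C C k x B" using copies by blast
  note X = complemented_copyD[OF cc]
  have x_le: "norm (x i) \<le> C" if "i < k" for i
    by (rule norm_combination_unit[OF X(3) that \<open>0 < p\<close>])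
  have "\<forall>i. \<exists>y. i < k \<longrightarrow> y \<in> Y \<and> norm (S (x i) - y) < \<eta> / (2 * s)" using Y(2) x_le by blast
  then obtain h where h: "\<And>i. i < k \<Longrightarrow> h i \<in> Y" "\<And>i. i < k \<Longrightarrow> norm (S (x i) - h i) < \<eta> / (2 * s)"
    by metis
  have "\<not> inj_on h {..<k}"
  proof
    assume "inj_on h {..<k}"
    then have "card {..<k} \<le> card Y" using h(1) Y(1) by (intro card_inj_on_le) auto
    then show False by (simp add: k_def)
  qed
  then obtain i j where ij: "i < k" "j < k" "i \<noteq> j" "h i = h j" by (auto simp: inj_on_def)
  define \<xi> where "\<xi> = s *\<^sub>R (x i - x j)"
  define f where "f y = B i y / of_real s" for y
  have f: "functional f"
    using X(1)[OF ij(1)] unfolding functional_on_def f_def by (simp add: add_divide_distrib)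
  have "B i (x i - x j) = 1"
    using functional_on_diff[OF X(1)[OF ij(1)]] X(4) ij by simp
  then have f1: "f \<xi> = 1"
    using functional_onD(2)[OF X(1)[OF ij(1)]] s by (simp add: f_def \<xi>_def scaleR_eq_scale)
  have f_le: "norm (f y) \<le> \<eta> * norm y" for y
  proof -
    have "norm (B i y) \<le> C * norm y"
      using norm_le_lps[of "{..<k}" i p "\<lambda>i. B i y"] X(2)[of y] ij \<open>0 < p\<close> by simp
    then have "norm (f y) \<le> C * norm y / s" using s by (simp add: f_def norm_divide divide_right_mono)
    then show ?thesis using s(2) by (simp flip: times_divide_eq_left)
  qed
  have "S \<xi> = s *\<^sub>R (S (x i) - S (x j))"
    by (simp add: \<xi>_def lin_scaleR[OF S(2,3)] lin_diff[OF S(2)])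
  moreover have "norm (S (x i) - S (x j)) \<le> \<eta> / s"
  proof -
    have "norm (S (x i) - S (x j)) \<le> norm (S (x i) - h i) + norm (S (x j) - h j)"
      using norm_triangle_ineq4[of "S (x i) - h i" "S (x j) - h j"] ij(4) by simp
    also have "\<dots> \<le> \<eta> / (2 * s) + \<eta> / (2 * s)" using h(2)[OF ij(1)] h(2)[OF ij(2)] by simp
    finally show ?thesis using s by (simp add: field_simps)
  qed
  then have "s * norm (S (x i) - S (x j)) \<le> s * (\<eta> / s)" using s by (intro mult_left_mono) auto
  ultimately have "norm (S \<xi>) \<le> \<eta>" using s(1) by simp
  with f f1 f_le show ?thesis by blast
qed

text \<open>With \<open>T2 y = T2 (S x)\<close>, the vector \<open>z = y - S x\<close> lies in the
  kernel of \<open>T2\<close>, so adding \<open>sY (f u) z\<close> to \<open>S u\<close> does not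
  change \<open>T2 \<circ> S\<close>. As \<open>f \<xi> = 1\<close>, the new map sends
  \<open>x + \<xi>\<close> to \<open>y + S \<xi> + sY (f x) z\<close>, where the last two terms are
  small.\<close>

lemma dense_perturbation_step:
  fixes S :: "'x \<Rightarrow> 'y::banach" and T2 :: "'y \<Rightarrow> 'x"
  assumes copies: "\<And>k. \<exists>x B. complemented_copy p C C k x B" and "0 < C" "0 < p"
    and sY: "banach_space sY"
    and S: "lin scale sY S" "totally_bounded_map S" and T2: "lin sY scale T2"
    and y: "T2 y \<in> range (\<lambda>x. T2 (S x))" and "0 < \<eta>" "0 < \<epsilon>"
  shows "\<exists>S' \<zeta>. lin scale sY S' \<and> totally_bounded_map S' \<and> (\<forall>x. T2 (S' x) = T2 (S x)) \<and>
    (\<forall>x. norm (S' x - S x) \<le> \<eta> * norm x) \<and> norm (S' \<zeta> - y) \<le> \<epsilon>"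
proof -
  interpret Y: banach_space sY by (rule sY)
  obtain x where x: "T2 y = T2 (S x)" using y by blast
  define z where "z = y - S x"
  have z: "T2 z = 0" by (simp add: z_def lin_diff[OF T2] x)
  \<comment> \<open>The first bound keeps the perturbation below \<open>\<eta>\<close>, the second
    keeps the miss \<open>\<mu> + \<mu> * norm x * norm z\<close> below
    \<open>\<epsilon>\<close>.\<close>
  define \<mu> where "\<mu> = min (\<eta> / (1 + norm z)) (\<epsilon> / (1 + norm x * norm z))"
  have p1: "0 < 1 + norm z" "0 < 1 + norm x * norm z" by (simp_all add: add_pos_nonneg)
  then have \<mu>: "0 < \<mu>" using \<open>0 < \<eta>\<close> \<open>0 < \<epsilon>\<close> by (simp add: \<mu>_def)
  have \<mu>1: "\<mu> * (1 + norm z) \<le> \<eta>"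
  proof -
    have "\<mu> \<le> \<eta> / (1 + norm z)" by (simp add: \<mu>_def)
    then show ?thesis using p1 by (simp add: field_simps)
  qed
  have \<mu>2: "\<mu> * (1 + norm x * norm z) \<le> \<epsilon>"
  proof -
    have "\<mu> \<le> \<epsilon> / (1 + norm x * norm z)" by (simp add: \<mu>_def)
    then show ?thesis using p1 by (simp add: field_simps)
  qed
  obtain \<xi> f where f: "functional f" "f \<xi> = 1" "\<And>x. norm (f x) \<le> \<mu> * norm x" "norm (S \<xi>) \<le> \<mu>"
    using exists_small_vector[OF copies \<open>0 < C\<close> \<open>0 < p\<close> S(2,1) sY \<mu>] by blast
  define S' where "S' u = S u + sY (f u) z" for u
  have "lin scale sY S'"
    unfolding lin_def S'_def using functional_onD[OF f(1)]
    by (simp add: linD[OF S(1)] Y.scale_left_distrib Y.scale_right_distrib)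
  moreover have "totally_bounded_map S'"
    unfolding S'_def using Y.totally_bounded_rank_one[of f \<mu> z] f(3) \<mu>
    by (intro totally_bounded_map_add S(2)) simp
  moreover have "T2 (S' u) = T2 (S u)" for u
    by (simp add: S'_def linD[OF T2] z)
  moreover have "norm (S' u - S u) \<le> \<eta> * norm u" for u
  proof -
    have "norm (S' u - S u) = norm (f u) * norm z" by (simp add: S'_def Y.norm_scale)
    also have "\<dots> \<le> (\<mu> * norm u) * norm z" using f(3) by (intro mult_right_mono) auto
    also have "\<dots> \<le> (\<mu> * (1 + norm z)) * norm u" using \<mu> by (simp add: algebra_simps)
    also have "\<dots> \<le> \<eta> * norm u" using \<mu>1 by (rule mult_right_mono) simp
    finally show ?thesis .
  qed
  moreover have "norm (S' (x + \<xi>) - y) \<le> \<epsilon>"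
  proof -
    have "S' (x + \<xi>) - y = S \<xi> + sY (f x) z"
      using functional_onD(1)[OF f(1), of x \<xi>] f(2)
      by (simp add: S'_def linD[OF S(1)] Y.scale_left_distrib z_def algebra_simps)
    then have "norm (S' (x + \<xi>) - y) \<le> norm (S \<xi>) + norm (f x) * norm z"
      using norm_triangle_ineq[of "S \<xi>" "sY (f x) z"] by (simp add: Y.norm_scale)
    also have "\<dots> \<le> \<mu> + (\<mu> * norm x) * norm z"
      using f(3,4) by (intro add_mono mult_right_mono) auto
    also have "\<dots> = \<mu> * (1 + norm x * norm z)" by (simp add: algebra_simps)
    finally show ?thesis using \<mu>2 by simp
  qed
  ultimately show ?thesis by blast
qed

text \<open>Successive perturbations approximate one \<open>y j\<close> at a time. Each step size is
  chosen after the vector \<open>\<zeta>\<close> that attained the last approximation, so that all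
  later changes at \<open>\<zeta>\<close> are as small as the error already made there.\<close>

lemma exists_dense_range_perturbation:
  fixes S0 :: "'x \<Rightarrow> 'y::banach" and T2 :: "'y \<Rightarrow> 'x" and y :: "nat \<Rightarrow> 'y"
  assumes copies: "\<And>k. \<exists>x B. complemented_copy p C C k x B" and "0 < C" "0 < p"
    and sY: "banach_space sY"
    and S0: "lin scale sY S0" "totally_bounded_map S0"
    and T2: "lin sY scale T2" "\<And>y. norm (T2 y) \<le> K * norm y"
    and y: "\<And>j. T2 (y j) \<in> range (\<lambda>x. T2 (S0 x))" and dense: "closure (range y) = UNIV"
  shows "\<exists>S. lin scale sY S \<and> totally_bounded_map S \<and> (\<forall>x. T2 (S x) = T2 (S0 x)) \<and>
    closure (range S) = UNIV"
proof -
  interpret Y: banach_space sY by (rule sY)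
  \<comment> \<open>Every \<open>y i\<close> is visited at infinitely many stages, hence with
    arbitrarily small error; a single visit would leave an error of fixed size.\<close>
  define yy where "yy n = y (fst (prod_decode n))" for n
  let ?P = "\<lambda>n :: nat. \<lambda>(S, \<eta>, \<zeta> :: 'x). lin scale sY S \<and> totally_bounded_map S \<and> (\<forall>x. T2 (S x) = T2 (S0 x)) \<and>
    (0::real) < \<eta> \<and> (n = 0 \<longrightarrow> S = S0)"
  let ?Q = "\<lambda>n (S, \<eta>, \<zeta> :: 'x) (S', \<eta>', \<zeta>'). (\<forall>x. norm (S' x - S x) \<le> \<eta> * norm x) \<and> \<eta>' \<le> \<eta> / 2 \<and>
    \<eta>' * norm \<zeta>' \<le> (1 / 2) ^ n \<and> norm (S' \<zeta>' - yy n) \<le> (1 / 2) ^ n"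
  have "\<exists>f. \<forall>n. ?P n (f n) \<and> ?Q n (f n) (f (Suc n))"
  proof (rule dependent_nat_choice)
    show "\<exists>st. ?P 0 st" using S0 by (intro exI[of _ "(S0, 1, 0)"]) simp
  next
    fix st n assume st: "?P n st"
    obtain S \<eta> \<zeta> where steq: "st = (S, \<eta>, \<zeta>)" by (metis prod_cases3)
    have S: "lin scale sY S" "totally_bounded_map S" "\<And>x. T2 (S x) = T2 (S0 x)" and \<eta>: "0 < \<eta>"
      using st unfolding steq by auto
    have yn: "T2 (yy n) \<in> range (\<lambda>x. T2 (S x))" unfolding S(3) yy_def by (rule y)
    have half: "0 < (1 / 2 :: real) ^ n" by simp
    obtain S' \<zeta>' where S': "lin scale sY S'" "totally_bounded_map S'" "\<And>x. T2 (S' x) = T2 (S x)"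
      "\<And>x. norm (S' x - S x) \<le> \<eta> * norm x" "norm (S' \<zeta>' - yy n) \<le> (1 / 2) ^ n"
      using dense_perturbation_step[OF copies \<open>0 < C\<close> \<open>0 < p\<close> sY S(1,2) T2(1) yn \<eta> half] by blast
    \<comment> \<open>Halving makes the steps summable, and the second bound protects the value at
      \<open>\<zeta>'\<close> from all later steps.\<close>
    define \<eta>' where "\<eta>' = min (\<eta> / 2) ((1 / 2) ^ n / (1 + norm \<zeta>'))"
    have pos: "0 < 1 + norm \<zeta>'" by (simp add: add_pos_nonneg)
    have \<eta>': "0 < \<eta>'" "\<eta>' \<le> \<eta> / 2"
      using \<eta> pos by (simp add: \<eta>'_def) (simp only: \<eta>'_def min.cobounded1)
    have "\<eta>' * norm \<zeta>' \<le> \<eta>' * (1 + norm \<zeta>')" using \<eta>' by (intro mult_left_mono) auto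
    also have "\<dots> \<le> ((1 / 2) ^ n / (1 + norm \<zeta>')) * (1 + norm \<zeta>')"
      by (intro mult_right_mono) (auto simp: \<eta>'_def)
    also have "\<dots> = (1 / 2) ^ n" using pos by simp
    finally have "\<eta>' * norm \<zeta>' \<le> (1 / 2) ^ n" .
    then show "\<exists>st'. ?P (Suc n) st' \<and> ?Q n st st'"
      unfolding steq using S' S(3) \<eta>' by (intro exI[of _ "(S', \<eta>', \<zeta>')"]) simp
  qed
  then obtain f where ff: "\<forall>n. ?P n (f n) \<and> ?Q n (f n) (f (Suc n))" by (rule exE)
  have f: "?P n (f n)" "?Q n (f n) (f (Suc n))" for n
    using spec[OF ff, of n] by (rule conjunct1, rule conjunct2)
  define S where "S n = fst (f n)" for n
  define \<eta> where "\<eta> n = fst (snd (f n))" for n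
  define \<zeta> where "\<zeta> n = snd (snd (f n))" for n
  have fn: "f n = (S n, \<eta> n, \<zeta> n)" for n by (simp add: S_def \<eta>_def \<zeta>_def)
  have S: "lin scale sY (S n)" "totally_bounded_map (S n)" "T2 (S n x) = T2 (S0 x)" "0 < \<eta> n" for n x
    using f(1)[of n] unfolding fn by auto
  have step: "norm (S (Suc n) x - S n x) \<le> \<eta> n * norm x" and \<eta>_half: "\<eta> (Suc n) \<le> \<eta> n / 2"
    and \<eta>\<zeta>: "\<eta> (Suc n) * norm (\<zeta> (Suc n)) \<le> (1 / 2) ^ n"
    and S\<zeta>: "norm (S (Suc n) (\<zeta> (Suc n)) - yy n) \<le> (1 / 2) ^ n" for n x
    using f(2)[of n] unfolding fn by auto
  have \<eta>_pow: "\<eta> (m + n) \<le> \<eta> m * (1 / 2) ^ n" for m n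
  proof (induction n)
    case (Suc n)
    then show ?case using \<eta>_half[of "m + n"] by simp
  qed simp
  have lim: "\<exists>l. (\<lambda>n. S (m + n) x) \<longlonglongrightarrow> l \<and> norm (l - S m x) \<le> 2 * (\<eta> m * norm x)" for m x
  proof -
    have "norm (S (Suc (m + n)) x - S (m + n) x) \<le> (\<eta> m * norm x) * (1 / 2) ^ n" for n
      using step[of "m + n" x] mult_right_mono[OF \<eta>_pow[of m n] norm_ge_zero[of x]] by (simp add: mult_ac)
    then show ?thesis
      using geometric_limit[where u="\<lambda>n. S (m + n) x" and b="\<eta> m * norm x"] by simp
  qed
  have "\<exists>l. (\<lambda>n. S n x) \<longlonglongrightarrow> l" for x
  proof -
    have "\<exists>l. (\<lambda>n. S (0 + n) x) \<longlonglongrightarrow> l \<and> norm (l - S 0 x) \<le> 2 * (\<eta> 0 * norm x)"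
      by (rule lim)
    then show ?thesis by auto
  qed
  then obtain R where R: "\<And>x. (\<lambda>n. S n x) \<longlonglongrightarrow> R x" by metis
  have near: "norm (R x - S m x) \<le> 2 * (\<eta> m * norm x)" for m x
  proof -
    obtain l where l: "(\<lambda>n. S (m + n) x) \<longlonglongrightarrow> l" "norm (l - S m x) \<le> 2 * (\<eta> m * norm x)"
      using lim by blast
    have "(\<lambda>n. S (n + m) x) \<longlonglongrightarrow> R x" using R[of x] by (rule LIMSEQ_ignore_initial_segment)
    then have "(\<lambda>n. S (m + n) x) \<longlonglongrightarrow> R x" by (simp only: add.commute)
    then show ?thesis using l LIMSEQ_unique by blast
  qed
  have "lin scale sY R"
    unfolding lin_def
  proof (intro conjI allI)
    show "R (x + z) = R x + R z" for x z
    proof -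
      have "(\<lambda>n. S n (x + z)) \<longlonglongrightarrow> R x + R z"
        using tendsto_add[OF R R] by (simp add: linD(1)[OF S(1)])
      then show ?thesis using R LIMSEQ_unique by blast
    qed
    show "R (scale c x) = sY c (R x)" for c x
    proof -
      have "(\<lambda>n. S n (scale c x)) \<longlonglongrightarrow> sY c (R x)"
        using bounded_linear.tendsto[OF Y.bounded_linear_scale R] by (simp add: linD(2)[OF S(1)])
      then show ?thesis using R LIMSEQ_unique by blast
    qed
  qed
  moreover have "totally_bounded_map R"
  proof (rule totally_bounded_map_limit)
    fix \<epsilon> :: real assume "0 < \<epsilon>"
    have "(\<lambda>m. 2 * (\<eta> 0 * (1 / 2) ^ m)) \<longlonglongrightarrow> 2 * (\<eta> 0 * 0)"
      by (intro tendsto_intros LIMSEQ_power_zero) simp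
    then have "eventually (\<lambda>m. 2 * (\<eta> 0 * (1 / 2) ^ m) < \<epsilon>) sequentially"
      using \<open>0 < \<epsilon>\<close> by (intro order_tendstoD) auto
    then obtain m where "2 * (\<eta> 0 * (1 / 2) ^ m) < \<epsilon>" using eventually_happens'[of sequentially] by auto
    then have m: "2 * \<eta> m < \<epsilon>" using \<eta>_pow[of 0 m] by simp
    have "norm (R x - S m x) < \<epsilon>" if "norm x \<le> 1" for x
    proof -
      have "\<eta> m * norm x \<le> \<eta> m * 1" using that S(4)[of m] by (intro mult_left_mono) auto
      then show ?thesis using near[of x m] m by simp
    qed
    then show "\<exists>S'. totally_bounded_map S' \<and> (\<forall>x. norm x \<le> 1 \<longrightarrow> norm (R x - S' x) < \<epsilon>)"
      using S(2)[of m] by blast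
  qed
  moreover have "T2 (R x) = T2 (S0 x)" for x
  proof -
    have "(\<lambda>n. T2 (S n x)) \<longlonglongrightarrow> T2 (R x)"
      by (rule bounded_linear.tendsto[OF Y.bounded_linear_lin[OF T2(1) banach_space_axioms T2(2)] R])
    then show ?thesis using S(3) by (simp add: LIMSEQ_const_iff)
  qed
  moreover have "closure (range R) = UNIV"
  proof -
    have "w \<in> closure (range R)" for w
      unfolding closure_approachable
    proof (intro allI impI)
      fix \<epsilon> :: real assume "0 < \<epsilon>"
      have "w \<in> closure (range y)" using dense by simp
      then obtain i where i: "dist (y i) w < \<epsilon> / 2"
        using half_gt_zero[OF \<open>0 < \<epsilon>\<close>] unfolding closure_approachable by blast
      \<comment> \<open>The limit misses \<open>y i\<close> at \<open>\<zeta> (Suc n)\<close> by at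
        most \<open>3 * (1 / 2) ^ n\<close>, one part from stage \<open>n\<close> and two from all
        later steps; with half of \<open>\<epsilon>\<close> reserved for the distance from
        \<open>y i\<close> to \<open>w\<close>, this gives \<open>\<epsilon> / 6\<close>. The stage
        \<open>prod_encode (i, l)\<close> is at least \<open>l\<close>.\<close>
      obtain l where l: "(1 / 2 :: real) ^ l < \<epsilon> / 6"
        using real_arch_pow_inv[of "\<epsilon> / 6" "1 / 2"] \<open>0 < \<epsilon>\<close> by auto
      define n where "n = prod_encode (i, l)"
      have yn: "yy n = y i" by (simp add: yy_def n_def)
      have "(1 / 2 :: real) ^ n \<le> (1 / 2) ^ l"
        unfolding n_def by (intro power_decreasing le_prod_encode_2) auto
      then have small: "(1 / 2 :: real) ^ n < \<epsilon> / 6" using l by (rule le_less_trans)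
      let ?z = "\<zeta> (Suc n)"
      have "norm (R ?z - S (Suc n) ?z) \<le> 2 * (1 / 2) ^ n" using near[of ?z "Suc n"] \<eta>\<zeta>[of n] by linarith
      then have "norm (R ?z - yy n) \<le> 3 * (1 / 2) ^ n"
        using S\<zeta>[of n] norm_triangle_ineq[of "R ?z - S (Suc n) ?z" "S (Suc n) ?z - yy n"] by simp
      then have "dist (R ?z) (y i) < \<epsilon> / 2" using small yn by (simp add: dist_norm)
      then have "dist (R ?z) w < \<epsilon>" using i dist_triangle[of "R ?z" w "y i"] by simp
      then show "\<exists>v\<in>range R. dist v w < \<epsilon>" by blast
    qed
    then show ?thesis by blast
  qed
  ultimately show ?thesis by blast
qed

section \<open>Weighted finite rank operators, the terms of both factors\<close>

lemma norm_weighted_combination: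
  assumes c: "\<And>t. norm (\<Sum>i<k. scale (t i) (z i)) \<le> M * lps p {..<k} t" and "0 \<le> M" "0 \<le> w" "0 < p"
    and a: "lps p {..<k} a \<le> K"
  shows "norm (\<Sum>i<k. scale (of_real w * a i) (z i)) \<le> M * w * K"
proof -
  have "norm (\<Sum>i<k. scale (of_real w * a i) (z i)) \<le> M * lps p {..<k} (\<lambda>i. of_real w * a i)" by (rule c)
  also have "\<dots> = M * w * lps p {..<k} a" unfolding lps_mult[OF \<open>0 < p\<close>] using \<open>0 \<le> w\<close> by simp
  also have "\<dots> \<le> M * w * K" using a assms(2,3) by (intro mult_left_mono) auto
  finally show ?thesis .
qed

lemma finite_rank_operator:
  fixes k :: nat and f :: "nat \<Rightarrow> 'z::banach \<Rightarrow> 'k"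
  assumes sZ: "banach_space sZ"
    and f: "\<And>i. i < k \<Longrightarrow> banach_space.functional sZ (f i)" "\<And>z. lps p {..<k} (\<lambda>i. f i z) \<le> K * norm z"
    and "0 \<le> K" "0 \<le> w" "0 < p"
  shows "lin sZ scale (\<lambda>z. \<Sum>i<k. scale (of_real w * f i z) (x i))"
    "totally_bounded_map (\<lambda>z. \<Sum>i<k. scale (of_real w * f i z) (x i))"
proof -
  interpret Z: banach_space sZ by (rule sZ)
  show "lin sZ scale (\<lambda>z. \<Sum>i<k. scale (of_real w * f i z) (x i))"
    unfolding lin_def using Z.functional_onD[OF f(1)]
    by (simp add: distrib_left scale_left_distrib sum.distrib scale_sum_right mult_ac)
  show "totally_bounded_map (\<lambda>z. \<Sum>i<k. scale (of_real w * f i z) (x i))"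
  proof (intro totally_bounded_map_sum totally_bounded_rank_one)
    fix i z assume "i \<in> {..<k}"
    then have "norm (f i z) \<le> K * norm z"
      using norm_le_lps[of "{..<k}" i p "\<lambda>i. f i z"] f(2)[of z] \<open>0 < p\<close> by simp
    then show "norm (of_real w * f i z) \<le> w * K * norm z"
      using \<open>0 \<le> w\<close> by (simp add: norm_mult mult_left_mono mult.assoc)
  qed (use assms in simp)
qed

end

section \<open>Bounded and compact operators through \<open>lin\<close> and finite nets, and the
  assembly of the factorization\<close>

lemma bounded_operator_iff:
  assumes "banach_space sX" "banach_space sY"
  shows "bounded_operator sX sY T \<longleftrightarrow> lin sX sY T \<and> (\<exists>C. \<forall>x. norm (T x) \<le> C * norm x)"
  using assms by (auto simp: bounded_operator_def Vector_Spaces.linear_iff lin_def banach_space_def)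

lemma compact_operator_iff:
  assumes "banach_space sX" "banach_space sY"
  shows "compact_operator sX sY T \<longleftrightarrow> lin sX sY T \<and> totally_bounded_map T"
  using assms banach_space.totally_bounded_map_bounded[OF assms(1) _ _ assms(2)]
  by (auto simp: compact_operator_def bounded_operator_iff totally_bounded_map_iff_compact)

theorem theorem2p10:
  fixes sX :: "'k::real_or_complex \<Rightarrow> 'x::banach \<Rightarrow> 'x"
    and sY :: "'k \<Rightarrow> 'y::banach \<Rightarrow> 'y"
    and p :: real
    and T :: "'x \<Rightarrow> 'x"
  assumes "1 < p"
    and "banach_space sX" and "banach_space sY"
    and "separable_space (euclidean :: 'x topology)"
    and "separable_space (euclidean :: 'y topology)"
    and "banach_space.infinite_dimensional sX"
    and "banach_space.infinite_dimensional sY"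
    and "banach_space.script_Lp_space sX p"
    and "banach_space.script_Lp_space sY p"
    and "compact_operator sX sX T"
  shows "\<exists>(T1 :: 'x \<Rightarrow> 'y) (T2 :: 'y \<Rightarrow> 'x).
    bounded_operator sX sY T1 \<and> bounded_operator sY sX T2 \<and>
    T = T2 \<circ> T1 \<and>
    closure (range T1) = UNIV \<and>
    compact_operator sX sY T1 \<and> compact_operator sY sX T2"
proof -
  interpret X: banach_space sX by fact
  interpret Y: banach_space sY by fact
  have p0: "0 < p" using \<open>1 < p\<close> by simp
  obtain q where pq: "conjugate_exponents p q" using exists_conjugate_exponent \<open>1 < p\<close> by blast
  obtain DX where DX: "1 \<le> DX" "\<And>M. finite M \<Longrightarrow> \<exists>N n e \<phi>. M \<subseteq> N \<and> X.frame p DX N n e \<phi>"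
    using X.exists_frame[OF p0 assms(8)] by blast
  obtain DY where DY: "1 \<le> DY" "\<And>M. finite M \<Longrightarrow> \<exists>N n e \<phi>. M \<subseteq> N \<and> Y.frame p DY N n e \<phi>"
    using Y.exists_frame[OF p0 assms(9)] by blast
  \<comment> \<open>Copies in \<open>X\<close> supply the small vectors of the density argument; the
    copies in \<open>Y\<close> carry the factorization.\<close>
  obtain CX where CX: "1 \<le> CX" "\<And>k. \<exists>x B. X.complemented_copy p CX CX k x B"
    using X.exists_complemented_copy[OF pq DX(1) assms(6) DX(2)] by blast
  obtain C where C: "1 \<le> C" "\<And>k. \<exists>x B. Y.complemented_copy p C C k x B"
    using Y.exists_complemented_copy[OF pq DY(1) assms(7) DY(2)] by blast
  have C0: "0 \<le> C" and CX0: "0 < CX" using C CX by simp_all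
  have T: "lin sX sX T" "totally_bounded_map T"
    using assms(10) compact_operator_iff[OF assms(2,2)] by blast+
  obtain y :: "nat \<Rightarrow> 'y" where y: "closure (range y) = UNIV"
  proof -
    obtain Q :: "'y set" where Q: "countable Q" "closure Q = UNIV"
      using assms(5) by (auto simp: separable_space_def)
    then have "Q \<noteq> {}" by auto
    then have "range (from_nat_into Q) = Q" using Q(1) by (rule range_from_nat_into)
    then show ?thesis using that Q(2) by metis
  qed
  \<comment> \<open>The growth rate of the biorthogonal embeddings, known before the rate
    \<open>1 / (4 * r)\<close> of the expansion is chosen.\<close>
  define r where "r = 1 + C\<^sup>2"
  have r: "1 \<le> r" by (simp add: r_def)
  have \<theta>: "0 < 1 / (4 * r)" "1 / (4 * r) < 1" using r by (simp_all add: field_simps)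
  obtain L k a b where L: "0 \<le> L" and exp: "X.expansion p L (1 / (4 * r)) T k a b"
    using X.compact_expansion[OF pq DX T \<theta>] by blast
  note a = X.expansionD(1)[OF exp] and a_le = X.expansionD(2)[OF exp] and b_le = X.expansionD(3)[OF exp]
    and b_range = X.expansionD(4)[OF exp] and T_sums = X.expansionD(5)[OF exp]
  obtain A B where cc: "\<And>n. Y.complemented_copy p C (C * r ^ n) (k n) (A n) (B n)"
    and orth: "\<And>m n i j. m \<noteq> n \<Longrightarrow> i < k m \<Longrightarrow> j < k n \<Longrightarrow> B m i (A n j) = 0"
    and kill: "\<And>n j i. j < n \<Longrightarrow> i < k n \<Longrightarrow> B n i (y j) = 0"
    using Y.exists_biorthogonal_copies[OF C0 Y.exists_complemented_copy_annihilating[OF pq C(2) C0], of k y]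
    unfolding r_def by blast
  note AB = Y.complemented_copyD[OF cc]
  \<comment> \<open>The geometric mean of 1 and the rates would not do on its own:
    \<open>A n\<close> costs \<open>r ^ n\<close> and \<open>b n\<close> gains
    \<open>(4 * r) ^ n\<close>, so dividing by \<open>(2 * r) ^ n\<close> on one side and
    multiplying by it on the other leaves \<open>(1 / 2) ^ n\<close> in both series.\<close>
  define w where "w n = (1 / (2 * r)) ^ n" for n
  have w: "0 < w n" for n using r by (simp add: w_def)
  have w1: "C * r ^ n * w n = C * (1 / 2) ^ n" for n
    using r by (simp add: w_def power_divide power_mult_distrib)
  have w2: "L * (1 / (4 * r)) ^ n * (1 / w n) = L * (1 / 2) ^ n" for n
  proof -
    have "(1 / (4 * r)) ^ n * (2 * r) ^ n = (1 / (4 * r) * (2 * r)) ^ n" by (simp only: power_mult_distrib)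
    also have "1 / (4 * r) * (2 * r) = 1 / 2" using r by simp
    finally have "(1 / (4 * r)) ^ n * (2 * r) ^ n = (1 / 2) ^ n" .
    moreover have "1 / w n = (2 * r) ^ n" by (simp add: w_def power_one_over)
    ultimately show ?thesis by (simp only: mult.assoc)
  qed
  define E where "E n x = (\<Sum>i<k n. sY (of_real (w n) * a n i x) (A n i))" for n x
  define E' where "E' n z = (\<Sum>i<k n. sX (of_real (1 / w n) * B n i z) (b n i))" for n z
  have E: "lin sX sY (E n)" "totally_bounded_map (E n)" "norm (E n x) \<le> C * (1 / 2) ^ n * norm x" for n x
  proof -
    have a_le': "lps p {..<k n} (\<lambda>i. a n i x) \<le> 1 * norm x" for x using a_le by simp
    show "lin sX sY (E n)" "totally_bounded_map (E n)"
      unfolding E_def using w[of n] p0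
      by (intro Y.finite_rank_operator[OF assms(2) a a_le']; simp)+
    have "norm (E n x) \<le> C * r ^ n * w n * norm x"
      unfolding E_def using w[of n] p0 C0 r
      by (intro Y.norm_weighted_combination[where p=p]) (simp_all add: AB(3) a_le)
    then show "norm (E n x) \<le> C * (1 / 2) ^ n * norm x" unfolding w1 .
  qed
  have E': "lin sY sX (E' n)" "totally_bounded_map (E' n)" "norm (E' n z) \<le> L * C * (1 / 2) ^ n * norm z" for n z
  proof -
    have w': "0 \<le> 1 / w n" using w[of n] by simp
    show "lin sY sX (E' n)" "totally_bounded_map (E' n)"
      unfolding E'_def by (rule X.finite_rank_operator[OF assms(3) AB(1,2) C0 w' p0]; assumption)+
    have "norm (E' n z) \<le> L * (1 / (4 * r)) ^ n * (1 / w n) * (C * norm z)"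
      unfolding E'_def using w' p0 L r
      by (intro X.norm_weighted_combination[where p=p]) (simp_all add: b_le AB(2))
    then show "norm (E' n z) \<le> L * C * (1 / 2) ^ n * norm z" unfolding w2 by (simp add: mult_ac)
  qed
  obtain S0 where S0: "lin sX sY S0" "totally_bounded_map S0" "\<And>x. (\<lambda>n. E n x) sums S0 x"
    using X.operator_series[OF assms(3) E] by blast
  obtain T2 where T2: "lin sY sX T2" "totally_bounded_map T2" "\<And>z. (\<lambda>n. E' n z) sums T2 z"
    "\<And>z. norm (T2 z) \<le> 2 * (L * C) * norm z"
    using Y.operator_series[OF assms(2) E'] by blast
  \<comment> \<open>Biorthogonality leaves one term of the series, so \<open>B n i\<close> reads off
    the \<open>n\<close>-th coordinates with the weight that \<open>E'\<close> cancels.\<close>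
  have BS0: "B n i (S0 x) = of_real (w n) * a n i x" if i: "i < k n" for n i x
  proof -
    have f: "Y.functional (B n i)" by (rule AB(1)[OF i])
    have "norm (B n i z) \<le> C * norm z" for z
      using norm_le_lps[of "{..<k n}" i p "\<lambda>i. B n i z"] AB(2)[of n z] i p0 by simp
    then have "(\<lambda>m. B n i (E m x)) sums B n i (S0 x)"
      by (intro bounded_linear.sums[OF Y.bounded_linear_functional[OF f] S0(3)])
    moreover have "B n i (E m x) = (if m = n then of_real (w n) * a n i x else 0)" for m
    proof -
      have "B n i (E m x) = (\<Sum>j<k m. of_real (w m) * a m j x * B n i (A m j))"
        unfolding E_def by (rule Y.functional_on_sum[OF f]) auto
      also have "\<dots> = (\<Sum>j<k m. if m = n \<and> j = i then of_real (w n) * a n i x else 0)"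
        using i by (intro sum.cong refl, cases "m = n") (auto simp: AB(4) orth)
      finally show ?thesis using i by simp
    qed
    ultimately have "(\<lambda>m. if m = n then of_real (w n) * a n i x else 0) sums B n i (S0 x)" by simp
    then show ?thesis using sums_single[of n "\<lambda>_. of_real (w n) * a n i x"] sums_unique2 by blast
  qed
  have T2S0: "T2 (S0 x) = T x" for x
  proof -
    have "E' n (S0 x) = (\<Sum>i<k n. sX (a n i x) (b n i))" for n
      unfolding E'_def using w[of n] BS0 by (intro sum.cong refl) (simp add: less_le)
    then show ?thesis using T2(3)[of "S0 x"] T_sums[of x] sums_unique2 by simp
  qed
  \<comment> \<open>\<open>B n\<close> vanishes on \<open>y j\<close> for \<open>n > j\<close>, so
    \<open>T2 (y j)\<close> is a finite combination of the vectors \<open>b n i\<close> and has a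
    preimage under \<open>T\<close>, which is \<open>T2 \<circ> S0\<close>.\<close>
  have T2y: "T2 (y j) \<in> range (\<lambda>x. T2 (S0 x))" for j
  proof -
    have "E' n (y j) = 0" if "n \<notin> {..j}" for n
      unfolding E'_def using that kill by (intro sum.neutral) auto
    then have "(\<lambda>n. E' n (y j)) sums (\<Sum>n\<le>j. E' n (y j))" by (intro sums_finite) auto
    then have eq: "T2 (y j) = (\<Sum>n\<le>j. E' n (y j))" using T2(3) sums_unique2 by blast
    define c where "c n i = (SOME v. b n i = T v)" for n i
    have c: "b n i = T (c n i)" for n i
    proof -
      have "b n i \<in> range T" by (rule b_range)
      then have "\<exists>v. b n i = T v" by blast
      then show ?thesis unfolding c_def by (rule someI_ex)
    qed
    have E'T: "E' n z = T (\<Sum>i<k n. sX (of_real (1 / w n) * B n i z) (c n i))" for n z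
      unfolding E'_def c by (rule lin_sum[OF T(1), symmetric])
    have "T2 (y j) = T (\<Sum>n\<le>j. sX 1 (\<Sum>i<k n. sX (of_real (1 / w n) * B n i (y j)) (c n i)))"
      unfolding eq lin_sum[OF T(1)] E'T by simp
    then show ?thesis unfolding T2S0 by blast
  qed
  obtain T1 where T1: "lin sX sY T1" "totally_bounded_map T1" "\<And>x. T2 (T1 x) = T2 (S0 x)"
    "closure (range T1) = UNIV"
    using X.exists_dense_range_perturbation[OF CX(2) CX0 p0 assms(3) S0(1,2) T2(1,4) T2y y] by blast
  have "compact_operator sX sY T1" "compact_operator sY sX T2"
    using T1 T2 compact_operator_iff[OF assms(2,3)] compact_operator_iff[OF assms(3,2)] by blast+
  moreover have "T = T2 \<circ> T1" using T1(3) T2S0 by (simp add: fun_eq_iff)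
  ultimately show ?thesis using T1(4) by (auto simp: compact_operator_def)
qed

end
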